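(* Let $\{(\lambda_{jk},\xi_{jk})\}$ be a family of quadratures on $\mathbb{S}^2$ satisfying the quadrature assumption (Q) and let $\kappa$ be a cutoff function satisfying the cutoff assumption (K) (both spelled out in the context). Let $\mathsf{A}=(A_\ell)_{\ell\in\mathbb{N}_0}$ be a sequence of positive reals with $\sum_{\ell=0}^\infty (2\ell+1)A_\ell<\infty$, and let $$u=\sum_{\ell=0}^\infty \sqrt{A_\ell}\sum_{m=-\ell}^{\ell} y_{\ell m} Y_{\ell m},\qquad y_{\ell m}\sim\mathcal{N}(0,1)\ \text{i.i.d.},$$ be the isotropic Gaussian random field on $\mathbb{S}^2$ with power spectrum $\mathsf{A}$. Then the family $\{\psi^{\mathsf{A}}_{jk}\colon j\ge 0,\ k=1,\dots,n_j\}$ of modified needlets $$\psi^{\mathsf{A}}_{jk}(s)=\sqrt{\lambda_{jk}}\sum_{\ell=0}^\infty \kappa\bigl(2^{-j}(2\ell+1)\bigr)\sqrt{A_\ell}\,\frac{2\ell+1}{4\pi}P_\ell(s\cdot\xi_{jk}),\qquad s\in\mathbb{S}^2,$$ is a Parseval frame of the reproducing kernel Hilbert space $\mathcal{H}$ of $u$. Moreover, the functions $\psi^{\mathsf{A}}_{jk}$ are orthogonal in $L_2(\mathbb{S}^2)$ between non-adjacent levels $j$ (that is, $\langle\psi^{\mathsf{A}}_{jk},\psi^{\mathsf{A}}_{j'k'}\rangle_{L_2(\mathbb{S}^2)}=0$ whenever $|j-j'|\ge 2$), and $\psi^{\mathsf{A}}_{jk}$ is orthogonal in $L_2(\mathbb{S}^2)$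 to polynomials of degree less than $\frac12(2^{j-1}-1)$ when $j>1$.
   Context: $\mathbb{S}^2\subset\mathbb{R}^3$ is the unit sphere, $\sigma$ its surface measure with $\sigma(\mathbb{S}^2)=4\pi$, $L_2(\mathbb{S}^2)=L_2(\mathbb{S}^2,\sigma)$, and $d(s,s')=\arccos(s\cdot s')$ is the geodesic distance. $P_\ell$ is the $\ell$-th Legendre polynomial (normalised by $P_\ell(1)=1$), and $\{Y_{\ell m}\colon \ell\in\mathbb{N}_0,\ -\ell\le m\le \ell\}$ are the real-valued spherical harmonics, orthonormal in $L_2(\mathbb{S}^2)$. Polynomials on $\mathbb{S}^2$ are restrictions of polynomials on $\mathbb{R}^3$. Quadrature assumption (Q): for each $j\in\mathbb{N}_0$ there are $n_j\in\mathbb{N}$, weights $\lambda_{jk}>0$ and points $\xi_{jk}\in\mathbb{S}^2$, $k=1,\dots,n_j$, such that: $\int_{\mathbb{S}^2} f\,d\sigma=\sum_{k=1}^{n_j}\lambda_{jk}f(\xi_{jk})$ for every polynomial $f$ of degree at most $2(2^j-1)$; $n_j\le C2^{2j}$ with $C>0$ independent of $j$; with $h_j=\sup_{s\in\mathbb{S}^2}\min_{k}d(s,\xi_{jk})$, one has $\frac{h_j}{4}\le h_{j+1}\le\frac{h_j}{2}$ and $h_j\le d(\xi_{jk},\xi_{jk'})$ for all $k\ne k'$; and $\lambda_{jk}\le c\,2^{-2j}$ with $c>0$ independent of $j$. Cutoff assumption (K): $\kappa\in C^r(\mathbb{R})$ with an integer $r>2$, $\operatorname{supp}\kappa=[\frac12,2]$,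 and $|\kappa(t)|^2+|\kappa(2t)|^2=1$ for $t\in[\frac12,1]$. (Hence the sum over $\ell$ in $\psi^{\mathsf{A}}_{jk}$ is finite.) The covariance function of $u$ is $\mathbb{E}[u(s)u(s')]=\rho(s\cdot s')$ with $\rho(t)=\sum_{\ell=0}^\infty A_\ell\frac{2\ell+1}{4\pi}P_\ell(t)$. The reproducing kernel Hilbert space $\mathcal{H}$ of $u$ is the completion of the span of the functions $\rho_s:=\rho(s\,\cdot\,)$, $\rho_s(t)=\rho(s\cdot t)$, $s\in\mathbb{S}^2$, with respect to the inner product determined by $\langle\rho_s,\rho_{s'}\rangle_{\mathcal{H}}=\rho(s\cdot s')$. A countable family $\{\varphi_i\}$ in a Hilbert space $\mathcal{H}$ is a Parseval frame of $\mathcal{H}$ if $\|f\|_{\mathcal{H}}^2=\sum_i|\langle f,\varphi_i\rangle_{\mathcal{H}}|^2$ for all $f\in\mathcal{H}$. *)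

theory Defs
  imports "HOL-Probability.Probability"
begin

section \<open>The sphere and its surface measure\<close>

abbreviation S2 :: "(real^3) set" where
  "S2 \<equiv> sphere 0 1"

text \<open>
  Surface measure as cone measure: \<open>\<sigma>(B)\<close> is three times the Lebesgue measure of
  \<open>{t x | x \<in> B, 0 < t < 1}\<close>. The lemma below confirms the normalisation.
\<close>

definition sphere_measure :: "(real^3) measure" where
  "sphere_measure = scale_measure 3
     (distr (restrict_space lborel (ball 0 1 - {0})) (restrict_space borel S2) (\<lambda>x. x /\<^sub>R norm x))"

lemma emeasure_sphere_measure: "emeasure sphere_measure S2 = ennreal (4 * pi)"
proof -
  have meas: "(\<lambda>x::real^3. x /\<^sub>R norm x) \<in>
      restrict_space lborel (ball 0 1 - {0}) \<rightarrow>\<^sub>M restrict_space borel S2"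
    by (intro measurable_restrict_space2 measurable_restrict_space1)
       (auto simp: space_restrict_space)
  have null: "emeasure lborel (ball 0 1 - {0::real^3}) = emeasure lborel (ball 0 1 :: (real^3) set)"
    by (rule emeasure_Diff_null_set) (auto simp: null_sets_def)
  have "emeasure (distr (restrict_space lborel (ball 0 1 - {0})) (restrict_space borel S2)
           (\<lambda>x::real^3. x /\<^sub>R norm x)) S2
      = emeasure (restrict_space lborel (ball 0 1 - {0::real^3})) (ball 0 1 - {0})"
    using measurable_space[OF meas]
    by (subst emeasure_distr[OF meas])
       (auto simp: sets_restrict_space space_restrict_space intro!: arg_cong2[of _ _ _ _ emeasure])
  also have "\<dots> = ennreal (4 / 3 * pi)"
    by (subst emeasure_restrict_space) (auto simp: null emeasure_ball unit_ball_vol_3)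
  finally show ?thesis
    by (simp add: sphere_measure_def flip: ennreal_numeral ennreal_mult'')
qed

definition L2_inner :: "(real^3 \<Rightarrow> real) \<Rightarrow> (real^3 \<Rightarrow> real) \<Rightarrow> real" where
  "L2_inner f g = (\<integral>s. f s * g s \<partial>sphere_measure)"

definition geodesic_dist :: "real^3 \<Rightarrow> real^3 \<Rightarrow> real" where
  "geodesic_dist s t = arccos (s \<bullet> t)"


section \<open>Polynomials and spherical harmonics\<close>

definition poly_degree_le :: "nat \<Rightarrow> (real^3 \<Rightarrow> real) \<Rightarrow> bool" where
  "poly_degree_le n p \<longleftrightarrow> (\<exists>c :: nat \<Rightarrow> nat \<Rightarrow> nat \<Rightarrow> real. \<forall>x.
     p x = (\<Sum>(i, j, k) \<in> {(i, j, k). i + j + k \<le> n}. c i j k * x$1 ^ i * x$2 ^ j * x$3 ^ k))"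

definition homogeneous_poly :: "nat \<Rightarrow> (real^3 \<Rightarrow> real) \<Rightarrow> bool" where
  "homogeneous_poly n p \<longleftrightarrow> (\<exists>c :: nat \<Rightarrow> nat \<Rightarrow> nat \<Rightarrow> real. \<forall>x.
     p x = (\<Sum>(i, j, k) \<in> {(i, j, k). i + j + k = n}. c i j k * x$1 ^ i * x$2 ^ j * x$3 ^ k))"

definition laplacian :: "(real^3 \<Rightarrow> real) \<Rightarrow> real^3 \<Rightarrow> real" where
  "laplacian p x = (\<Sum>b\<in>Basis. (deriv ^^ 2) (\<lambda>t. p (x + t *\<^sub>R b)) 0)"

text \<open>
  A spherical harmonic of degree \<open>l\<close> is the restriction to the sphere of a harmonic homogeneous
  polynomial of degree \<open>l\<close>. No particular orthonormal system is singled out;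
  \<open>Y l m\<close> is constrained only for \<open>-l \<le> m \<le> l\<close> and only on the sphere.
\<close>

definition real_spherical_harmonics :: "(nat \<Rightarrow> int \<Rightarrow> real^3 \<Rightarrow> real) \<Rightarrow> bool" where
  "real_spherical_harmonics Y \<longleftrightarrow>
     (\<forall>l. \<forall>m\<in>{-int l..int l}.
        \<exists>p. homogeneous_poly l p \<and> (\<forall>x. laplacian p x = 0) \<and> (\<forall>s\<in>S2. Y l m s = p s)) \<and>
     (\<forall>l l'. \<forall>m\<in>{-int l..int l}. \<forall>m'\<in>{-int l'..int l'}.
        L2_inner (Y l m) (Y l' m') = (if l = l' \<and> m = m' then 1 else 0))"

fun legendre :: "nat \<Rightarrow> real \<Rightarrow> real" where
  "legendre 0 t = 1"
| "legendre (Suc 0) t = t"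
| "legendre (Suc (Suc n)) t =
     ((2 * real n + 3) * t * legendre (Suc n) t - (real n + 1) * legendre n t) / (real n + 2)"

lemma legendre_1: "legendre n 1 = 1"
  by (induction n "1::real" rule: legendre.induct) (auto simp: field_simps)


section \<open>Quadratures, cutoff functions and modified needlets\<close>

definition mesh_norm :: "(nat \<Rightarrow> nat) \<Rightarrow> (nat \<Rightarrow> nat \<Rightarrow> real^3) \<Rightarrow> nat \<Rightarrow> real" where
  "mesh_norm N \<xi> j = (SUP s\<in>S2. Min ((\<lambda>k. geodesic_dist s (\<xi> j k)) ` {1..N j}))"

definition quadrature_assumption ::
  "(nat \<Rightarrow> nat) \<Rightarrow> (nat \<Rightarrow> nat \<Rightarrow> real) \<Rightarrow> (nat \<Rightarrow> nat \<Rightarrow> real^3) \<Rightarrow> bool" where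
  "quadrature_assumption N wt \<xi> \<longleftrightarrow>
     (\<forall>j. N j \<ge> 1) \<and>
     (\<forall>j. \<forall>k\<in>{1..N j}. wt j k > 0 \<and> \<xi> j k \<in> S2) \<and>
     (\<forall>j p. poly_degree_le (2 * (2 ^ j - 1)) p \<longrightarrow>
        (\<integral>s. p s \<partial>sphere_measure) = (\<Sum>k=1..N j. wt j k * p (\<xi> j k))) \<and>
     (\<exists>C>0. \<forall>j. real (N j) \<le> C * 2 ^ (2 * j)) \<and>
     (\<forall>j. mesh_norm N \<xi> j / 4 \<le> mesh_norm N \<xi> (Suc j) \<and>
          mesh_norm N \<xi> (Suc j) \<le> mesh_norm N \<xi> j / 2) \<and>
     (\<forall>j. \<forall>k\<in>{1..N j}. \<forall>k'\<in>{1..N j}. k \<noteq> k' \<longrightarrow>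
        mesh_norm N \<xi> j \<le> geodesic_dist (\<xi> j k) (\<xi> j k')) \<and>
     (\<exists>c>0. \<forall>j. \<forall>k\<in>{1..N j}. wt j k \<le> c / 2 ^ (2 * j))"

definition cutoff_assumption :: "nat \<Rightarrow> (real \<Rightarrow> real) \<Rightarrow> bool" where
  "cutoff_assumption r \<kappa> \<longleftrightarrow>
     r > 2 \<and>
     (\<forall>i<r. \<forall>t. (deriv ^^ i) \<kappa> differentiable (at t)) \<and>
     continuous_on UNIV ((deriv ^^ r) \<kappa>) \<and>
     closure {t. \<kappa> t \<noteq> 0} = {1/2..2} \<and>
     (\<forall>t\<in>{1/2..1}. \<bar>\<kappa> t\<bar>\<^sup>2 + \<bar>\<kappa> (2 * t)\<bar>\<^sup>2 = 1)"

definition modified_needlet ::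
  "(real \<Rightarrow> real) \<Rightarrow> (nat \<Rightarrow> real) \<Rightarrow> (nat \<Rightarrow> nat \<Rightarrow> real) \<Rightarrow> (nat \<Rightarrow> nat \<Rightarrow> real^3)
     \<Rightarrow> nat \<Rightarrow> nat \<Rightarrow> real^3 \<Rightarrow> real" where
  "modified_needlet \<kappa> A wt \<xi> j k s = sqrt (wt j k) *
     (\<Sum>l. \<kappa> ((2 * real l + 1) / 2 ^ j) * sqrt (A l) * ((2 * real l + 1) / (4 * pi)) *
          legendre l (s \<bullet> \<xi> j k))"


section \<open>Isotropic Gaussian random fields\<close>

text \<open>
  The series defining \<open>u s\<close> converges in mean square, for every point \<open>s\<close> of the sphere.
\<close>

definition isotropic_gaussian_field ::
  "'w measure \<Rightarrow> (nat \<Rightarrow> real) \<Rightarrow> (nat \<Rightarrow> int \<Rightarrow> real^3 \<Rightarrow> real) \<Rightarrow> (nat \<Rightarrow> int \<Rightarrow> 'w \<Rightarrow> real)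
     \<Rightarrow> (real^3 \<Rightarrow> 'w \<Rightarrow> real) \<Rightarrow> bool" where
  "isotropic_gaussian_field M A Y y u \<longleftrightarrow>
     prob_space M \<and>
     (\<forall>l. \<forall>m\<in>{-int l..int l}. distributed M lborel (y l m) std_normal_density) \<and>
     prob_space.indep_vars M (\<lambda>_. borel) (\<lambda>(l, m). y l m) (SIGMA l:UNIV. {-int l..int l}) \<and>
     (\<forall>s\<in>S2. u s \<in> borel_measurable M \<and>
        (\<lambda>L. \<integral>\<^sup>+\<omega>. ennreal ((u s \<omega> - (\<Sum>l\<le>L. sqrt (A l) *
              (\<Sum>m=-int l..int l. y l m \<omega> * Y l m s)))\<^sup>2) \<partial>M) \<longlonglongrightarrow> 0)"

definition covariance_kernel :: "'w measure \<Rightarrow> ('s \<Rightarrow> 'w \<Rightarrow> real) \<Rightarrow> 's \<Rightarrow> 's \<Rightarrow> real" where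
  "covariance_kernel M u s t = (\<integral>\<omega>. u s \<omega> * u t \<omega> \<partial>M)"


section \<open>Reproducing kernel Hilbert spaces\<close>

text \<open>
  Finite linear combinations of kernel sections are given by finitely supported coefficient
  functions. An element of the completion is identified with the pointwise limit on \<open>S\<close>
  of a Cauchy sequence of such combinations; the inner product is the limit of the inner products
  along the sequences. Values of the functions outside \<open>S\<close> play no role. For positive
  semidefinite kernels, the inner product does not depend on the chosen sequences
  (\<open>rkhs_inner_tendsto\<close>) and it reproduces (\<open>rkhs_reproducing\<close>).
\<close>

definition fin_coeffs :: "'s set \<Rightarrow> ('s \<Rightarrow> real) set" where
  "fin_coeffs S = {c. finite {s. c s \<noteq> 0} \<and> {s. c s \<noteq> 0} \<subseteq> S}"

definition kernel_comb :: "('s \<Rightarrow> 's \<Rightarrow> real) \<Rightarrow> ('s \<Rightarrow> real) \<Rightarrow> 's \<Rightarrow> real" where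
  "kernel_comb K c t = (\<Sum>s | c s \<noteq> 0. c s * K s t)"

definition kernel_form :: "('s \<Rightarrow> 's \<Rightarrow> real) \<Rightarrow> ('s \<Rightarrow> real) \<Rightarrow> ('s \<Rightarrow> real) \<Rightarrow> real" where
  "kernel_form K c d = (\<Sum>s | c s \<noteq> 0. \<Sum>t | d t \<noteq> 0. c s * d t * K s t)"

definition rkhs_approx ::
  "'s set \<Rightarrow> ('s \<Rightarrow> 's \<Rightarrow> real) \<Rightarrow> (nat \<Rightarrow> 's \<Rightarrow> real) \<Rightarrow> ('s \<Rightarrow> real) \<Rightarrow> bool" where
  "rkhs_approx S K c f \<longleftrightarrow>
     (\<forall>n. c n \<in> fin_coeffs S) \<and>
     (\<forall>e>0. \<exists>n0. \<forall>m\<ge>n0. \<forall>n\<ge>n0.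
        sqrt (kernel_form K (\<lambda>s. c m s - c n s) (\<lambda>s. c m s - c n s)) < e) \<and>
     (\<forall>t\<in>S. (\<lambda>n. kernel_comb K (c n) t) \<longlonglongrightarrow> f t)"

definition rkhs :: "'s set \<Rightarrow> ('s \<Rightarrow> 's \<Rightarrow> real) \<Rightarrow> ('s \<Rightarrow> real) set" where
  "rkhs S K = {f. \<exists>c. rkhs_approx S K c f}"

definition rkhs_inner ::
  "'s set \<Rightarrow> ('s \<Rightarrow> 's \<Rightarrow> real) \<Rightarrow> ('s \<Rightarrow> real) \<Rightarrow> ('s \<Rightarrow> real) \<Rightarrow> real" where
  "rkhs_inner S K f g = (THE r. \<forall>c d. rkhs_approx S K c f \<longrightarrow> rkhs_approx S K d g \<longrightarrow>
     (\<lambda>n. kernel_form K (c n) (d n)) \<longlonglongrightarrow> r)"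

definition psd_kernel_on :: "'s set \<Rightarrow> ('s \<Rightarrow> 's \<Rightarrow> real) \<Rightarrow> bool" where
  "psd_kernel_on S K \<longleftrightarrow>
     (\<forall>s\<in>S. \<forall>t\<in>S. K s t = K t s) \<and> (\<forall>c\<in>fin_coeffs S. kernel_form K c c \<ge> 0)"

lemma kernel_form_superset:
  assumes "finite F" "{s. c s \<noteq> 0} \<subseteq> F" "{s. d s \<noteq> 0} \<subseteq> F"
  shows "kernel_form K c d = (\<Sum>s\<in>F. \<Sum>t\<in>F. c s * d t * K s t)"
proof -
  have "kernel_form K c d = (\<Sum>s | c s \<noteq> 0. \<Sum>t\<in>F. c s * d t * K s t)"
    unfolding kernel_form_def using assms
    by (intro sum.cong refl sum.mono_neutral_left) auto
  also have "\<dots> = (\<Sum>s\<in>F. \<Sum>t\<in>F. c s * d t * K s t)"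
    using assms by (intro sum.mono_neutral_left) auto
  finally show ?thesis .
qed

lemma fin_coeffs_add_scaled:
  assumes "c \<in> fin_coeffs S" "d \<in> fin_coeffs S"
  shows "(\<lambda>s. c s + x * d s) \<in> fin_coeffs S"
proof -
  have "{s. c s + x * d s \<noteq> 0} \<subseteq> {s. c s \<noteq> 0} \<union> {s. d s \<noteq> 0}" by auto
  then show ?thesis
    using assms unfolding fin_coeffs_def by (auto dest: finite_subset)
qed

lemma kernel_form_add_scaled:
  assumes c: "c \<in> fin_coeffs S" and d: "d \<in> fin_coeffs S" and e: "e \<in> fin_coeffs S"
  shows "kernel_form K (\<lambda>s. c s + x * d s) e = kernel_form K c e + x * kernel_form K d e"
    and "kernel_form K e (\<lambda>s. c s + x * d s) = kernel_form K e c + x * kernel_form K e d"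
proof -
  define F where "F = {s. c s \<noteq> 0} \<union> {s. d s \<noteq> 0} \<union> {s. e s \<noteq> 0}"
  have F: "finite F" "{s. c s \<noteq> 0} \<subseteq> F" "{s. d s \<noteq> 0} \<subseteq> F" "{s. e s \<noteq> 0} \<subseteq> F"
    "{s. c s + x * d s \<noteq> 0} \<subseteq> F"
    using assms by (auto simp: F_def fin_coeffs_def)
  show "kernel_form K (\<lambda>s. c s + x * d s) e = kernel_form K c e + x * kernel_form K d e"
    by (simp add: kernel_form_superset[OF F(1)] F sum_distrib_left flip: sum.distrib)
       (simp add: algebra_simps)
  show "kernel_form K e (\<lambda>s. c s + x * d s) = kernel_form K e c + x * kernel_form K e d"
    by (simp add: kernel_form_superset[OF F(1)] F sum_distrib_left flip: sum.distrib)
       (simp add: algebra_simps)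
qed

lemma fin_coeffs_diff:
  assumes "c \<in> fin_coeffs S" "d \<in> fin_coeffs S"
  shows "(\<lambda>s. c s - d s) \<in> fin_coeffs S"
  using fin_coeffs_add_scaled[OF assms, of "-1"] by simp

lemma kernel_form_diff:
  assumes "c \<in> fin_coeffs S" "d \<in> fin_coeffs S" "e \<in> fin_coeffs S"
  shows "kernel_form K (\<lambda>s. c s - d s) e = kernel_form K c e - kernel_form K d e"
    and "kernel_form K e (\<lambda>s. c s - d s) = kernel_form K e c - kernel_form K e d"
  using kernel_form_add_scaled[OF assms, of K "-1"] by simp_all

lemma kernel_form_commute:
  assumes "psd_kernel_on S K" and c: "c \<in> fin_coeffs S" and d: "d \<in> fin_coeffs S"
  shows "kernel_form K c d = kernel_form K d c"
proof -
  have "kernel_form K d c = (\<Sum>s | c s \<noteq> 0. \<Sum>t | d t \<noteq> 0. d t * c s * K t s)"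
    unfolding kernel_form_def by (rule sum.swap)
  also have "\<dots> = kernel_form K c d"
    unfolding kernel_form_def using assms
    by (intro sum.cong refl) (auto simp: psd_kernel_on_def fin_coeffs_def)
  finally show ?thesis ..
qed

lemma kernel_form_comb:
  "kernel_form K c d = (\<Sum>t | d t \<noteq> 0. d t * kernel_comb K c t)"
proof -
  have "kernel_form K c d = (\<Sum>t | d t \<noteq> 0. \<Sum>s | c s \<noteq> 0. c s * d t * K s t)"
    unfolding kernel_form_def by (rule sum.swap)
  then show ?thesis
    by (simp add: kernel_comb_def sum_distrib_left mult_ac)
qed

lemma kernel_form_Cauchy_Schwarz:
  assumes K: "psd_kernel_on S K" and c: "c \<in> fin_coeffs S" and d: "d \<in> fin_coeffs S"
  shows "\<bar>kernel_form K c d\<bar> \<le> sqrt (kernel_form K c c) * sqrt (kernel_form K d d)"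
proof -
  let ?a = "kernel_form K c c" and ?b = "kernel_form K c d" and ?e = "kernel_form K d d"
  have quad: "0 \<le> ?a + 2 * x * ?b + x^2 * ?e" for x
  proof -
    have "0 \<le> kernel_form K (\<lambda>s. c s + x * d s) (\<lambda>s. c s + x * d s)"
      using K fin_coeffs_add_scaled[OF c d] by (auto simp: psd_kernel_on_def)
    also have "\<dots> = ?a + 2 * x * ?b + x^2 * ?e"
      using kernel_form_commute[OF K c d]
      by (simp add: kernel_form_add_scaled[OF c d] fin_coeffs_add_scaled[OF c d] c d
            kernel_form_add_scaled[OF c d c] kernel_form_add_scaled[OF c d d]
            kernel_form_add_scaled(1)[OF c d fin_coeffs_add_scaled[OF c d]]
            power2_eq_square algebra_simps)
    finally show ?thesis .
  qed
  have e: "?e \<ge> 0" and a: "?a \<ge> 0" using K c d by (auto simp: psd_kernel_on_def)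
  have "?b^2 \<le> ?a * ?e"
  proof (cases "?e = 0")
    case True
    have "?b = 0"
    proof (rule ccontr)
      assume "?b \<noteq> 0"
      then show False using quad[of "- (?a + 1) / (2 * ?b)"] True a by (simp add: field_simps)
    qed
    then show ?thesis using a e by simp
  next
    case False
    then have "0 \<le> ?a - ?b^2 / ?e"
      using quad[of "- ?b / ?e"] by (simp add: power2_eq_square field_simps)
    then show ?thesis using False e by (simp add: field_simps)
  qed
  then have "sqrt (?b^2) \<le> sqrt (?a * ?e)" by (rule real_sqrt_le_mono)
  then show ?thesis by (simp add: real_sqrt_mult)
qed

lemma kernel_norm_diff_triangle:
  assumes K: "psd_kernel_on S K" and c: "c \<in> fin_coeffs S" and d: "d \<in> fin_coeffs S"
  shows "sqrt (kernel_form K (\<lambda>s. c s - d s) (\<lambda>s. c s - d s))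
           \<le> sqrt (kernel_form K c c) + sqrt (kernel_form K d d)" (is "sqrt ?l \<le> ?x + ?y")
proof -
  have nn: "kernel_form K c c \<ge> 0" "kernel_form K d d \<ge> 0"
    using K c d by (auto simp: psd_kernel_on_def)
  have "?l = kernel_form K c c - 2 * kernel_form K c d + kernel_form K d d"
    using kernel_form_commute[OF K c d]
    by (simp add: kernel_form_diff[OF c d c] kernel_form_diff[OF c d d]
          kernel_form_diff(1)[OF c d fin_coeffs_diff[OF c d]])
  also have "\<dots> \<le> ?x^2 + 2 * (?x * ?y) + ?y^2"
    using kernel_form_Cauchy_Schwarz[OF K c d] nn by simp
  also have "\<dots> = (?x + ?y)^2" by (simp add: power2_sum)
  finally show ?thesis
    using nn by (intro real_le_lsqrt) auto
qed

lemma rkhs_approxD: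
  assumes "rkhs_approx S K c f"
  shows "c n \<in> fin_coeffs S"
    and "e > 0 \<Longrightarrow> \<exists>n0. \<forall>m\<ge>n0. \<forall>n\<ge>n0.
           sqrt (kernel_form K (\<lambda>s. c m s - c n s) (\<lambda>s. c m s - c n s)) < e"
    and "t \<in> S \<Longrightarrow> (\<lambda>n. kernel_comb K (c n) t) \<longlonglongrightarrow> f t"
  using assms by (simp_all add: rkhs_approx_def)

lemma rkhs_approx_bounded:
  assumes K: "psd_kernel_on S K" and c: "rkhs_approx S K c f"
  shows "\<exists>B. \<forall>n. sqrt (kernel_form K (c n) (c n)) \<le> B"
proof -
  have fc: "c n \<in> fin_coeffs S" for n by (rule rkhs_approxD(1)[OF c])
  obtain n0 where n0: "sqrt (kernel_form K (\<lambda>s. c m s - c n s) (\<lambda>s. c m s - c n s)) < 1"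
    if "m \<ge> n0" "n \<ge> n0" for m n
    using rkhs_approxD(2)[OF c zero_less_one] by blast
  define B where "B = Max ((\<lambda>n. sqrt (kernel_form K (c n) (c n))) ` {..n0})"
  have B: "sqrt (kernel_form K (c n) (c n)) \<le> B" if "n \<le> n0" for n
    unfolding B_def using that by (intro Max_ge) auto
  have "sqrt (kernel_form K (c n) (c n)) \<le> B + 1" for n
  proof (cases "n \<le> n0")
    case True
    then show ?thesis using B[of n] by simp
  next
    case False
    have "sqrt (kernel_form K (c n) (c n)) \<le> sqrt (kernel_form K (c n0) (c n0)) +
        sqrt (kernel_form K (\<lambda>s. c n0 s - c n s) (\<lambda>s. c n0 s - c n s))"
      using kernel_norm_diff_triangle[OF K fc[of n0] fin_coeffs_diff[OF fc[of n0] fc[of n]]]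
      by simp
    moreover have "sqrt (kernel_form K (\<lambda>s. c n0 s - c n s) (\<lambda>s. c n0 s - c n s)) < 1"
      using n0[of n0 n] False by simp
    ultimately show ?thesis using B[of n0] by linarith
  qed
  then show ?thesis by blast
qed

lemma rkhs_approx_diff:
  assumes K: "psd_kernel_on S K" and c: "rkhs_approx S K c f" and d: "rkhs_approx S K d g"
  shows "rkhs_approx S K (\<lambda>n s. c n s - d n s) (\<lambda>t. f t - g t)"
proof -
  have fc: "c n \<in> fin_coeffs S" "d n \<in> fin_coeffs S" for n
    by (rule rkhs_approxD(1)[OF c] rkhs_approxD(1)[OF d])+
  have "\<exists>n0. \<forall>m\<ge>n0. \<forall>n\<ge>n0. sqrt (kernel_form K (\<lambda>s. c m s - d m s - (c n s - d n s))
      (\<lambda>s. c m s - d m s - (c n s - d n s))) < e" if "e > 0" for e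
  proof -
    obtain n1 where n1: "\<forall>m\<ge>n1. \<forall>n\<ge>n1.
        sqrt (kernel_form K (\<lambda>s. c m s - c n s) (\<lambda>s. c m s - c n s)) < e / 2"
      using rkhs_approxD(2)[OF c half_gt_zero[OF \<open>e > 0\<close>]] by blast
    obtain n2 where n2: "\<forall>m\<ge>n2. \<forall>n\<ge>n2.
        sqrt (kernel_form K (\<lambda>s. d m s - d n s) (\<lambda>s. d m s - d n s)) < e / 2"
      using rkhs_approxD(2)[OF d half_gt_zero[OF \<open>e > 0\<close>]] by blast
    have "sqrt (kernel_form K (\<lambda>s. c m s - d m s - (c n s - d n s))
      (\<lambda>s. c m s - d m s - (c n s - d n s))) < e" if "m \<ge> max n1 n2" "n \<ge> max n1 n2" for m n
    proof -
      have eq: "(\<lambda>s. c m s - c n s - (d m s - d n s)) = (\<lambda>s. c m s - d m s - (c n s - d n s))"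
        by auto
      have "sqrt (kernel_form K (\<lambda>s. c m s - c n s) (\<lambda>s. c m s - c n s)) < e / 2"
        using n1 that by (meson max.boundedE)
      moreover have "sqrt (kernel_form K (\<lambda>s. d m s - d n s) (\<lambda>s. d m s - d n s)) < e / 2"
        using n2 that by (meson max.boundedE)
      ultimately show ?thesis
        using kernel_norm_diff_triangle[OF K fin_coeffs_diff[OF fc(1)[of m] fc(1)[of n]]
            fin_coeffs_diff[OF fc(2)[of m] fc(2)[of n]], unfolded eq] by linarith
    qed
    then show ?thesis by blast
  qed
  moreover have comb: "kernel_comb K (\<lambda>s. c n s - d n s) t =
      kernel_comb K (c n) t - kernel_comb K (d n) t" for n t
  proof -
    define F where "F = {s. c n s \<noteq> 0} \<union> {s. d n s \<noteq> 0}"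
    have F: "finite F" using fc[of n] by (auto simp: F_def fin_coeffs_def)
    have sup: "kernel_comb K e t = (\<Sum>s\<in>F. e s * K s t)" if "{s. e s \<noteq> 0} \<subseteq> F" for e
      unfolding kernel_comb_def using F that by (intro sum.mono_neutral_left) auto
    have "{s. c n s - d n s \<noteq> 0} \<subseteq> F" "{s. c n s \<noteq> 0} \<subseteq> F" "{s. d n s \<noteq> 0} \<subseteq> F"
      by (auto simp: F_def)
    then show ?thesis by (simp add: sup left_diff_distrib sum_subtractf)
  qed
  moreover have "(\<lambda>n. kernel_comb K (\<lambda>s. c n s - d n s) t) \<longlonglongrightarrow> f t - g t" if "t \<in> S" for t
    unfolding comb by (intro tendsto_diff rkhs_approxD(3)[OF c that] rkhs_approxD(3)[OF d that])
  ultimately show ?thesis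
    unfolding rkhs_approx_def using fin_coeffs_diff[OF fc(1) fc(2)] by blast
qed

lemma rkhs_approx_zero:
  assumes K: "psd_kernel_on S K" and c: "rkhs_approx S K c f" and f: "\<And>t. t \<in> S \<Longrightarrow> f t = 0"
  shows "(\<lambda>n. sqrt (kernel_form K (c n) (c n))) \<longlonglongrightarrow> 0"
proof -
  have fc: "c n \<in> fin_coeffs S" for n by (rule rkhs_approxD(1)[OF c])
  obtain B where B: "\<And>n. sqrt (kernel_form K (c n) (c n)) \<le> B"
    using rkhs_approx_bounded[OF K c] by blast
  have nn: "kernel_form K (c n) (c n) \<ge> 0" for n
    using K fc by (auto simp: psd_kernel_on_def)
  have B0: "B \<ge> 0" using B[of 0] nn[of 0] by (meson order_trans real_sqrt_ge_zero)
  have lim: "(\<lambda>n. kernel_form K (c n) (c m)) \<longlonglongrightarrow> 0" for m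
  proof -
    have "(\<lambda>n. \<Sum>t | c m t \<noteq> 0. c m t * kernel_comb K (c n) t) \<longlonglongrightarrow> (\<Sum>t | c m t \<noteq> 0. c m t * 0)"
    proof (intro tendsto_sum tendsto_mult tendsto_const)
      fix t assume "t \<in> {t. c m t \<noteq> 0}"
      then have "t \<in> S" using fc[of m] by (auto simp: fin_coeffs_def)
      then show "(\<lambda>n. kernel_comb K (c n) t) \<longlonglongrightarrow> 0"
        using rkhs_approxD(3)[OF c, of t] f[of t] by simp
    qed
    then show ?thesis by (simp add: kernel_form_comb[of K _ "c m"])
  qed
  have "(\<lambda>n. kernel_form K (c n) (c n)) \<longlonglongrightarrow> 0"
  proof (rule LIMSEQ_I)
    fix e :: real assume e: "e > 0"
    define \<delta> where "\<delta> = e / (2 * (B + 1))"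
    have \<delta>: "\<delta> > 0" using e B0 by (simp add: \<delta>_def)
    obtain n0 where n0: "\<forall>m\<ge>n0. \<forall>n\<ge>n0.
        sqrt (kernel_form K (\<lambda>s. c m s - c n s) (\<lambda>s. c m s - c n s)) < \<delta>"
      using rkhs_approxD(2)[OF c \<delta>] by blast
    have "kernel_form K (c m) (c m) \<le> e / 2" if m: "m \<ge> n0" for m
    proof (rule LIMSEQ_le_const)
      have "(\<lambda>n. kernel_form K (c n) (c m) + e / 2) \<longlonglongrightarrow> 0 + e / 2"
        by (intro tendsto_add lim tendsto_const)
      then show "(\<lambda>n. kernel_form K (c n) (c m) + e / 2) \<longlonglongrightarrow> e / 2" by simp
      have "kernel_form K (c m) (c m) \<le> kernel_form K (c n) (c m) + e / 2" if n: "n \<ge> n0" for n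
      proof -
        have "kernel_form K (c m) (c m) - kernel_form K (c n) (c m)
            = kernel_form K (\<lambda>s. c m s - c n s) (c m)"
          by (simp add: kernel_form_diff(1)[OF fc[of m] fc[of n] fc[of m]])
        also have "\<dots> \<le> \<delta> * (B + 1)"
        proof -
          have "sqrt (kernel_form K (\<lambda>s. c m s - c n s) (\<lambda>s. c m s - c n s)) *
              sqrt (kernel_form K (c m) (c m)) \<le> \<delta> * (B + 1)"
            using n0 m n B[of m] \<delta> B0 nn[of m] by (intro mult_mono) (auto intro: less_imp_le)
          then show ?thesis
            using kernel_form_Cauchy_Schwarz[OF K fin_coeffs_diff[OF fc[of m] fc[of n]] fc[of m]]
            by linarith
        qed
        also have "\<dots> = e / 2" using B0 by (simp add: \<delta>_def field_simps add_nonneg_eq_0_iff)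
        finally show ?thesis by simp
      qed
      then show "\<exists>N. \<forall>n\<ge>N. kernel_form K (c m) (c m) \<le> kernel_form K (c n) (c m) + e / 2"
        by blast
    qed
    then show "\<exists>N. \<forall>n\<ge>N. norm (kernel_form K (c n) (c n) - 0) < e"
      using nn e by (intro exI[of _ n0] allI impI) (fastforce intro: le_less_trans)
  qed
  then show ?thesis using tendsto_real_sqrt by fastforce
qed

lemma rkhs_form_Cauchy:
  assumes K: "psd_kernel_on S K" and c: "rkhs_approx S K c f" and d: "rkhs_approx S K d g"
  shows "convergent (\<lambda>n. kernel_form K (c n) (d n))"
proof -
  have fc: "c n \<in> fin_coeffs S" "d n \<in> fin_coeffs S" for n
    by (rule rkhs_approxD(1)[OF c] rkhs_approxD(1)[OF d])+
  obtain B where B: "\<And>n. sqrt (kernel_form K (c n) (c n)) \<le> B"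
    using rkhs_approx_bounded[OF K c] by blast
  obtain B' where B': "\<And>n. sqrt (kernel_form K (d n) (d n)) \<le> B'"
    using rkhs_approx_bounded[OF K d] by blast
  define D where "D = max B B' + 1"
  have nn: "sqrt (kernel_form K (c n) (c n)) \<ge> 0" "sqrt (kernel_form K (d n) (d n)) \<ge> 0" for n
    using K fc by (auto simp: psd_kernel_on_def)
  have D: "D > 0" "sqrt (kernel_form K (c n) (c n)) \<le> D" "sqrt (kernel_form K (d n) (d n)) \<le> D" for n
    unfolding D_def using B[of n] B'[of n] nn[of n] by linarith+
  have "Cauchy (\<lambda>n. kernel_form K (c n) (d n))"
  proof (rule CauchyI)
    fix e :: real assume e: "e > 0"
    define \<delta> where "\<delta> = e / (2 * D)"
    have \<delta>: "\<delta> > 0" using e D by (simp add: \<delta>_def)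
    obtain n1 where n1: "\<forall>m\<ge>n1. \<forall>n\<ge>n1.
        sqrt (kernel_form K (\<lambda>s. c m s - c n s) (\<lambda>s. c m s - c n s)) < \<delta>"
      using rkhs_approxD(2)[OF c \<delta>] by blast
    obtain n2 where n2: "\<forall>m\<ge>n2. \<forall>n\<ge>n2.
        sqrt (kernel_form K (\<lambda>s. d m s - d n s) (\<lambda>s. d m s - d n s)) < \<delta>"
      using rkhs_approxD(2)[OF d \<delta>] by blast
    have "norm (kernel_form K (c m) (d m) - kernel_form K (c n) (d n)) < e"
      if m: "m \<ge> max n1 n2" and n: "n \<ge> max n1 n2" for m n
    proof -
      note dc = fin_coeffs_diff[OF fc(1)[of m] fc(1)[of n]]
      note dd = fin_coeffs_diff[OF fc(2)[of m] fc(2)[of n]]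
      have "kernel_form K (c m) (d m) - kernel_form K (c n) (d n) =
          kernel_form K (\<lambda>s. c m s - c n s) (d m) + kernel_form K (c n) (\<lambda>s. d m s - d n s)"
        by (simp add: kernel_form_diff(1)[OF fc(1) fc(1) fc(2)] kernel_form_diff(2)[OF fc(2) fc(2) fc(1)])
      moreover have "\<bar>kernel_form K (\<lambda>s. c m s - c n s) (d m)\<bar> < \<delta> * D"
      proof -
        have "sqrt (kernel_form K (\<lambda>s. c m s - c n s) (\<lambda>s. c m s - c n s)) *
            sqrt (kernel_form K (d m) (d m)) < \<delta> * D"
          using n1 m n D(1) \<delta> nn(2)[of m] K dc
          by (intro le_less_trans[OF mult_left_mono[OF D(3)] mult_strict_right_mono])
             (auto simp: psd_kernel_on_def)
        then show ?thesis
          using kernel_form_Cauchy_Schwarz[OF K dc fc(2)[of m]] by linarith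
      qed
      moreover have "\<bar>kernel_form K (c n) (\<lambda>s. d m s - d n s)\<bar> < D * \<delta>"
      proof -
        have "sqrt (kernel_form K (c n) (c n)) *
            sqrt (kernel_form K (\<lambda>s. d m s - d n s) (\<lambda>s. d m s - d n s)) < D * \<delta>"
          using n2 m n D \<delta> nn[of n] K dd
          by (intro le_less_trans[OF mult_right_mono[OF D(2)] mult_strict_left_mono])
             (auto simp: psd_kernel_on_def)
        then show ?thesis
          using kernel_form_Cauchy_Schwarz[OF K fc(1)[of n] dd] by linarith
      qed
      moreover have "\<delta> * D + D * \<delta> = e" using D(1) by (simp add: \<delta>_def)
      ultimately show ?thesis unfolding real_norm_def by linarith
    qed
    then show "\<exists>M. \<forall>m\<ge>M. \<forall>n\<ge>M. norm (kernel_form K (c m) (d m) - kernel_form K (c n) (d n)) < e"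
      by blast
  qed
  then show ?thesis by (simp add: Cauchy_convergent_iff)
qed

lemma rkhs_form_unique:
  assumes K: "psd_kernel_on S K"
    and c: "rkhs_approx S K c f" "rkhs_approx S K c' f"
    and d: "rkhs_approx S K d g" "rkhs_approx S K d' g"
  shows "(\<lambda>n. kernel_form K (c n) (d n) - kernel_form K (c' n) (d' n)) \<longlonglongrightarrow> 0"
proof -
  have fc: "c n \<in> fin_coeffs S" "d n \<in> fin_coeffs S" "c' n \<in> fin_coeffs S" "d' n \<in> fin_coeffs S" for n
    by (rule rkhs_approxD(1)[OF c(1)] rkhs_approxD(1)[OF d(1)]
        rkhs_approxD(1)[OF c(2)] rkhs_approxD(1)[OF d(2)])+
  let ?dc = "\<lambda>n s. c n s - c' n s" and ?dd = "\<lambda>n s. d n s - d' n s"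
  have prod: "(\<lambda>n. kernel_form K (x n) (y n)) \<longlonglongrightarrow> 0"
    if x: "(\<lambda>n. sqrt (kernel_form K (x n) (x n))) \<longlonglongrightarrow> 0"
      and y: "\<And>n. sqrt (kernel_form K (y n) (y n)) \<le> B"
      and xy: "\<And>n. x n \<in> fin_coeffs S" "\<And>n. y n \<in> fin_coeffs S" for x y B
  proof (rule tendsto_rabs_zero_cancel, rule tendsto_sandwich[of "\<lambda>_. 0"])
    show "\<forall>\<^sub>F n in sequentially. \<bar>kernel_form K (x n) (y n)\<bar> \<le> sqrt (kernel_form K (x n) (x n)) * B"
    proof (intro always_eventually allI)
      fix n
      have "0 \<le> sqrt (kernel_form K (x n) (x n))" using K xy by (simp add: psd_kernel_on_def)
      then show "\<bar>kernel_form K (x n) (y n)\<bar> \<le> sqrt (kernel_form K (x n) (x n)) * B"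
        using kernel_form_Cauchy_Schwarz[OF K xy(1)[of n] xy(2)[of n]] y[of n]
        by (meson mult_left_mono order_trans)
    qed
    show "(\<lambda>n. sqrt (kernel_form K (x n) (x n)) * B) \<longlonglongrightarrow> 0"
      using tendsto_mult_right[OF x, of B] by simp
  qed auto
  obtain B where B: "\<And>n. sqrt (kernel_form K (d n) (d n)) \<le> B"
    using rkhs_approx_bounded[OF K d(1)] by blast
  obtain B' where B': "\<And>n. sqrt (kernel_form K (c' n) (c' n)) \<le> B'"
    using rkhs_approx_bounded[OF K c(2)] by blast
  have "(\<lambda>n. kernel_form K (?dc n) (d n)) \<longlonglongrightarrow> 0"
    using rkhs_approx_zero[OF K rkhs_approx_diff[OF K c]] fc
    by (intro prod[OF _ B]) (auto intro: fin_coeffs_diff)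
  moreover have "(\<lambda>n. kernel_form K (?dd n) (c' n)) \<longlonglongrightarrow> 0"
    using rkhs_approx_zero[OF K rkhs_approx_diff[OF K d]] fc
    by (intro prod[OF _ B']) (auto intro: fin_coeffs_diff)
  ultimately have lim: "(\<lambda>n. kernel_form K (?dc n) (d n) + kernel_form K (?dd n) (c' n)) \<longlonglongrightarrow> 0 + 0"
    by (rule tendsto_add)
  have "kernel_form K (?dc n) (d n) + kernel_form K (?dd n) (c' n) =
      kernel_form K (c n) (d n) - kernel_form K (c' n) (d' n)" for n
    using kernel_form_commute[OF K fc(2)[of n] fc(3)[of n]]
      kernel_form_commute[OF K fc(4)[of n] fc(3)[of n]]
      kernel_form_diff(1)[OF fc(1)[of n] fc(3)[of n] fc(2)[of n], of K]
      kernel_form_diff(1)[OF fc(2)[of n] fc(4)[of n] fc(3)[of n], of K] by linarith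
  from lim[unfolded this add_0_left] show ?thesis .
qed

lemma rkhs_inner_tendsto:
  assumes K: "psd_kernel_on S K" and c: "rkhs_approx S K c f" and d: "rkhs_approx S K d g"
  shows "(\<lambda>n. kernel_form K (c n) (d n)) \<longlonglongrightarrow> rkhs_inner S K f g"
proof -
  obtain r where r: "(\<lambda>n. kernel_form K (c n) (d n)) \<longlonglongrightarrow> r"
    using rkhs_form_Cauchy[OF K c d] by (auto simp: convergent_def)
  have "rkhs_inner S K f g = r"
    unfolding rkhs_inner_def
  proof (rule the_equality)
    show "\<forall>c' d'. rkhs_approx S K c' f \<longrightarrow> rkhs_approx S K d' g \<longrightarrow>
        (\<lambda>n. kernel_form K (c' n) (d' n)) \<longlonglongrightarrow> r"
    proof (intro allI impI)
      fix c' d' assume "rkhs_approx S K c' f" "rkhs_approx S K d' g"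
      then show "(\<lambda>n. kernel_form K (c' n) (d' n)) \<longlonglongrightarrow> r"
        using tendsto_diff[OF r rkhs_form_unique[OF K c _ d, of c' d']] by simp
    qed
  qed (use c d r LIMSEQ_unique in blast)
  with r show ?thesis by simp
qed

lemma rkhs_reproducing:
  assumes K: "psd_kernel_on S K" and f: "f \<in> rkhs S K" and t: "t \<in> S"
  shows "K t \<in> rkhs S K" and "rkhs_inner S K f (K t) = f t"
proof -
  let ?d = "\<lambda>n::nat. \<lambda>s. if s = t then 1 else (0::real)"
  have "{s. ?d 0 s \<noteq> 0} = {t}" by auto
  then have d: "rkhs_approx S K ?d (K t)"
    using t by (auto simp: rkhs_approx_def fin_coeffs_def kernel_comb_def kernel_form_def)
  then show "K t \<in> rkhs S K" by (auto simp: rkhs_def)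
  obtain c where c: "rkhs_approx S K c f" using f by (auto simp: rkhs_def)
  have "kernel_form K (c n) (?d n) = kernel_comb K (c n) t" for n
    by (simp add: kernel_form_comb)
  then have "(\<lambda>n. kernel_comb K (c n) t) \<longlonglongrightarrow> rkhs_inner S K f (K t)"
    using rkhs_inner_tendsto[OF K c d] by simp
  moreover have "(\<lambda>n. kernel_comb K (c n) t) \<longlonglongrightarrow> f t"
    by (rule rkhs_approxD(3)[OF c t])
  ultimately show "rkhs_inner S K f (K t) = f t"
    by (rule LIMSEQ_unique)
qed

definition parseval_frame ::
  "'f set \<Rightarrow> ('f \<Rightarrow> 'f \<Rightarrow> real) \<Rightarrow> 'i set \<Rightarrow> ('i \<Rightarrow> 'f) \<Rightarrow> bool" where
  "parseval_frame H ip I \<phi> \<longleftrightarrow>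
     countable I \<and> (\<forall>i\<in>I. \<phi> i \<in> H) \<and>
     (\<forall>f\<in>H. ((\<lambda>i. \<bar>ip f (\<phi> i)\<bar>\<^sup>2) has_sum ip f f) I)"

end

theory Submission
  imports Defs
begin

text \<open>
  Everything is expressed through the zonal kernels
  \<open>Z\<^sub>l(s,t) = (2l+1)/(4\<pi>) P\<^sub>l(s \<bullet> t)\<close>, the reproducing kernels of the spaces of spherical
  harmonics of degree \<open>l\<close>. Two facts about them carry the proof: the product formula
  \<open>\<integral> Z\<^sub>l(x,s) Z\<^sub>m(x,t) d\<sigma>(x) = \<delta>\<^sub>l\<^sub>m Z\<^sub>l(s,t)\<close> (\<open>L2_inner_zonal_kernels\<close>) and the addition theorem
  \<open>\<Sum>\<^sub>m Y\<^sub>l\<^sub>m(s) Y\<^sub>l\<^sub>m(t) = Z\<^sub>l(s,t)\<close>.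
  
  For the frame property, the addition theorem shows that the covariance function of the field is
  \<open>K = \<Sum>\<^sub>l A\<^sub>l Z\<^sub>l\<close> (\<open>covariance_kernel_sums\<close>). As a function of the node, the product of two
  needlets of level \<open>j\<close> is a polynomial of degree at most \<open>2(2\<^sup>j - 1)\<close>, so the quadrature is exact
  for it, and the product formula gives
  \<open>\<Sum>\<^sub>k \<psi>\<^sub>j\<^sub>k(s) \<psi>\<^sub>j\<^sub>k(t) = \<Sum>\<^sub>l \<kappa>((2l+1)/2\<^sup>j)\<^sup>2 A\<^sub>l Z\<^sub>l(s,t)\<close> (\<open>needlet_level_product\<close>). For each \<open>l\<close> the
  squares of \<open>\<kappa>\<close> sum to 1 over the levels, hence
  \<open>\<Sum>\<^sub>j\<^sub>k \<psi>\<^sub>j\<^sub>k(s) \<psi>\<^sub>j\<^sub>k(t) = K(s,t)\<close> (\<open>needlet_kernel_expansion\<close>). For a finite combination \<open>f\<close> of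
  kernel sections this expansion says \<open>\<Sum> \<langle>f,\<psi>\<^sub>j\<^sub>k\<rangle>\<^sup>2 = \<parallel>f\<parallel>\<^sup>2\<close>, because \<open>\<langle>K\<^sub>s,\<psi>\<rangle> = \<psi>(s)\<close>; the
  identity passes to limits (\<open>parseval_frame_rkhs\<close>). That the needlets lie in the Hilbert space is
  again a consequence of the quadratures: \<open>A\<^sub>l Z\<^sub>l(\<cdot>,x)\<close> is the limit of the combinations
  \<open>\<Sum>\<^sub>k \<lambda>\<^sub>J\<^sub>k Z\<^sub>l(\<xi>\<^sub>J\<^sub>k,x) K(\<xi>\<^sub>J\<^sub>k,\<cdot>)\<close> of kernel sections as \<open>J \<rightarrow> \<infinity>\<close> (\<open>zonal_sum_in_rkhs\<close>).
  
  The orthogonality relations hold because level \<open>j\<close> only involves degrees with \<open>2\<^sup>j\<^sup>-\<^sup>1 < 2l+1 < 2\<^sup>j\<^sup>+\<^sup>1\<close>. Levels that are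
  not adjacent therefore share no degree, and a polynomial of degree less than \<open>(2\<^sup>j\<^sup>-\<^sup>1 - 1)/2\<close> is
  orthogonal to every harmonic that occurs in level \<open>j\<close>.
  
  Both facts about zonal kernels come from symmetry. The surface measure is invariant under rotations, so an infinitesimal
  rotation \<open>x\<^sub>a \<partial>\<^sub>b - x\<^sub>b \<partial>\<^sub>a\<close> maps polynomials to polynomials of integral zero and is
  skew-adjoint. The sum of the squares of the three rotations is then self-adjoint, and it has solid
  harmonics of degree \<open>l\<close> as eigenfunctions for \<open>-l(l+1)\<close>; so different degrees are orthogonal
  (\<open>solid_harmonics_orthogonal\<close>). The reproducing property of \<open>Z\<^sub>l\<close> follows by induction along the
  Legendre recurrence (\<open>L2_inner_solid_zonal\<close>), and it implies the addition theorem without a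
  dimension count: the defect \<open>(2l+1)/(4\<pi>) - \<Sum>\<^sub>m Y\<^sub>l\<^sub>m(t)\<^sup>2\<close> is the squared norm of a harmonic, hence
  nonnegative, and its integral is \<open>(2l+1) - (2l+1) = 0\<close>.
\<close>

section \<open>Rotation invariance of the surface measure\<close>

definition unit_cone :: "(real^3) set \<Rightarrow> (real^3) set" where
  "unit_cone B = {x \<in> ball 0 1 - {0}. x /\<^sub>R norm x \<in> B}"

lemma space_sphere_measure [simp]: "space sphere_measure = S2"
  by (simp add: sphere_measure_def space_scale_measure space_restrict_space)

lemma sets_sphere_measure [measurable_cong]: "sets sphere_measure = sets (restrict_space borel S2)"
  by (simp add: sphere_measure_def)

lemma measurable_radial_projection:
  "(\<lambda>x::real^3. x /\<^sub>R norm x) \<in>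
     restrict_space lborel (ball 0 1 - {0}) \<rightarrow>\<^sub>M restrict_space borel S2"
  by (intro measurable_restrict_space2 measurable_restrict_space1)
     (auto simp: space_restrict_space)

text \<open>
  In this form the surface measure inherits its symmetries from Lebesgue measure: the cone over a
  rotated set is the rotated cone.
\<close>

lemma emeasure_sphere_measure_cone:
  assumes B: "B \<in> sets sphere_measure"
  shows "unit_cone B \<in> sets borel"
    and "emeasure sphere_measure B = 3 * emeasure lborel (unit_cone B)"
proof -
  have B': "B \<in> sets (restrict_space borel S2)" using B by (simp add: sets_sphere_measure)
  have C: "(\<lambda>x::real^3. x /\<^sub>R norm x) -` B \<inter> space (restrict_space lborel (ball 0 1 - {0})) = unit_cone B"
    by (auto simp: unit_cone_def space_restrict_space)
  have m: "unit_cone B \<in> sets (restrict_space lborel (ball 0 1 - {0}))"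
    using measurable_sets[OF measurable_radial_projection B'] unfolding C .
  show "unit_cone B \<in> sets borel"
    using m by (subst (asm) sets_restrict_space_iff) auto
  show "emeasure sphere_measure B = 3 * emeasure lborel (unit_cone B)"
    unfolding sphere_measure_def
    unfolding emeasure_scale_measure emeasure_distr[OF measurable_radial_projection B'] C
    by (subst emeasure_restrict_space) (auto simp: unit_cone_def)
qed

lemma measurable_sphere_orthogonal:
  assumes R: "orthogonal_transformation R"
  shows "R \<in> sphere_measure \<rightarrow>\<^sub>M sphere_measure"
proof -
  have "bounded_linear R" and nR: "norm (R x) = norm x" for x
    using R by (auto simp: orthogonal_transformation linear_linear)
  then have "R \<in> restrict_space borel S2 \<rightarrow>\<^sub>M restrict_space borel S2"
    by (intro measurable_restrict_space2 measurable_restrict_space1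
          borel_measurable_continuous_onI linear_continuous_on)
      (auto simp: space_restrict_space)
  then show ?thesis
    by (simp only: measurable_cong_sets[OF sets_sphere_measure sets_sphere_measure])
qed

lemma sphere_measure_orthogonal_invariant:
  assumes R: "orthogonal_transformation R"
  shows "distr sphere_measure sphere_measure R = sphere_measure"
proof (rule measure_eqI)
  have lin: "linear R" and nR: "norm (R x) = norm x" for x
    using R by (auto simp: orthogonal_transformation)
  note Rm = measurable_sphere_orthogonal[OF R]
  fix B assume "B \<in> sets (distr sphere_measure sphere_measure R)"
  then have B: "B \<in> sets sphere_measure" by simp
  let ?B = "R -` B \<inter> space sphere_measure"
  have B2: "?B \<in> sets sphere_measure" by (rule measurable_sets[OF Rm B])
  have R0: "R x = 0 \<longleftrightarrow> x = 0" for x using nR[of x] by (metis norm_eq_zero)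
  have proj: "R x /\<^sub>R norm x = R (x /\<^sub>R norm x)" for x
    by (simp only: linear_cmul[OF lin])
  have cone: "R x \<in> unit_cone B \<longleftrightarrow> x \<in> unit_cone ?B" for x
  proof -
    have "x /\<^sub>R norm x \<in> S2" if "x \<noteq> 0"
      using that by simp
    then show ?thesis
      unfolding unit_cone_def mem_Collect_eq proj Diff_iff mem_ball_0 nR singleton_iff R0
        proj vimage_eq Int_iff space_sphere_measure by blast
  qed
  have im: "R ` unit_cone ?B = unit_cone B"
  proof -
    have "unit_cone ?B = R -` unit_cone B" using cone by blast
    then show ?thesis
      using orthogonal_transformation_surj[OF R] by (simp only: surj_image_vimage_eq)
  qed
  have bd: "C \<in> lmeasurable" if "C = unit_cone D" "D \<in> sets sphere_measure" for C D
  proof (rule bounded_set_imp_lmeasurable)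
    show "bounded C" unfolding that
      by (rule bounded_subset[OF bounded_ball[of 0 1]]) (auto simp: unit_cone_def)
    show "C \<in> sets lebesgue"
      using emeasure_sphere_measure_cone(1)[OF that(2)] that(1) by auto
  qed
  have "measure lebesgue (R ` unit_cone ?B) = measure lebesgue (unit_cone ?B)"
    by (rule measure_orthogonal_image[OF R bd[OF refl B2]])
  then have "emeasure lebesgue (unit_cone ?B) = emeasure lebesgue (unit_cone B)"
    unfolding im using emeasure_eq_measure2[OF bd[OF refl B2]] emeasure_eq_measure2[OF bd[OF refl B]]
    by simp
  then have "emeasure lborel (unit_cone ?B) = emeasure lborel (unit_cone B)"
    using emeasure_sphere_measure_cone(1)[OF B2] emeasure_sphere_measure_cone(1)[OF B]
    by simp
  then show "emeasure (distr sphere_measure sphere_measure R) B = emeasure sphere_measure B"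
    unfolding emeasure_distr[OF Rm B] emeasure_sphere_measure_cone(2)[OF B2]
      emeasure_sphere_measure_cone(2)[OF B] by simp
qed simp

lemma finite_measure_sphere_measure: "finite_measure sphere_measure"
  by (rule finite_measureI) (simp add: emeasure_sphere_measure)

lemma measure_sphere_measure: "measure sphere_measure S2 = 4 * pi"
  by (simp add: measure_def emeasure_sphere_measure)

lemma integrable_sphere_continuous:
  fixes f :: "real^3 \<Rightarrow> real"
  assumes "continuous_on S2 f"
  shows "integrable sphere_measure f"
proof -
  interpret finite_measure sphere_measure by (rule finite_measure_sphere_measure)
  have "compact (f ` S2)"
    using assms by (intro compact_continuous_image compact_sphere)
  then have "bounded (f ` S2)" by (rule compact_imp_bounded)
  then obtain B where "\<forall>y\<in>f ` S2. norm y \<le> B" unfolding bounded_iff ..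
  then have B: "norm (f x) \<le> B" if "x \<in> S2" for x using that by blast
  have "f \<in> borel_measurable (restrict_space borel S2)"
    using assms by (rule borel_measurable_continuous_on_restrict)
  then have "f \<in> borel_measurable sphere_measure"
    by (simp only: measurable_cong_sets[OF sets_sphere_measure refl])
  then show ?thesis
    using B by (intro integrable_const_bound[where B=B]) auto
qed


section \<open>Directional derivatives of polynomial functions\<close>

text \<open>
  The derivative is taken in a direction that is an arbitrary vector, so that with the direction
  \<open>x\<close> at the point \<open>x\<close> it is the Euler operator \<open>\<Sum>\<^sub>i x\<^sub>i \<partial>\<^sub>i\<close>.
\<close>

definition dir_deriv :: "'a::real_normed_vector \<Rightarrow> ('a \<Rightarrow> real) \<Rightarrow> 'a \<Rightarrow> real" where
  "dir_deriv a f x = frechet_derivative f (at x) a"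

lemma has_derivative_dir_deriv:
  assumes "real_polynomial_function f"
  shows "(f has_derivative (\<lambda>h. dir_deriv h f x)) (at x)"
  unfolding dir_deriv_def
  using differentiable_at_real_polynomial_function[OF assms] frechet_derivative_works
  by (simp add: frechet_derivative_works)

lemma dir_deriv_eqI:
  assumes "(f has_derivative f') (at x)"
  shows "dir_deriv a f x = f' a"
  using frechet_derivative_at[OF assms] by (simp add: dir_deriv_def)

lemma dir_deriv_linear:
  assumes "real_polynomial_function f"
  shows "linear (\<lambda>a. dir_deriv a f x)"
  using has_derivative_dir_deriv[OF assms] by (rule has_derivative_linear)

lemma dir_deriv_bounded_linear: "bounded_linear f \<Longrightarrow> dir_deriv a f = (\<lambda>x. f a)"
  by (rule ext, rule dir_deriv_eqI) (rule bounded_linear_imp_has_derivative)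

lemma dir_deriv_const [simp]: "dir_deriv a (\<lambda>x. c) = (\<lambda>x. 0)"
  by (rule ext) (rule dir_deriv_eqI, rule has_derivative_const)

lemma dir_deriv_inner [simp]:
  fixes a :: "'a::real_inner"
  shows "dir_deriv a (\<lambda>x. x \<bullet> b) = (\<lambda>x. a \<bullet> b)"
  by (rule dir_deriv_bounded_linear) (rule bounded_linear_inner_left)

lemma dir_deriv_add:
  assumes "real_polynomial_function f" "real_polynomial_function g"
  shows "dir_deriv a (\<lambda>x. f x + g x) = (\<lambda>x. dir_deriv a f x + dir_deriv a g x)"
  by (rule ext, rule dir_deriv_eqI) (intro has_derivative_add has_derivative_dir_deriv assms)

lemma dir_deriv_diff:
  assumes "real_polynomial_function f" "real_polynomial_function g"
  shows "dir_deriv a (\<lambda>x. f x - g x) = (\<lambda>x. dir_deriv a f x - dir_deriv a g x)"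
  by (rule ext, rule dir_deriv_eqI) (intro has_derivative_diff has_derivative_dir_deriv assms)

lemma dir_deriv_mult:
  assumes "real_polynomial_function f" "real_polynomial_function g"
  shows "dir_deriv a (\<lambda>x. f x * g x) = (\<lambda>x. f x * dir_deriv a g x + dir_deriv a f x * g x)"
  by (rule ext, rule dir_deriv_eqI) (intro has_derivative_mult has_derivative_dir_deriv assms)

lemma dir_deriv_divide:
  assumes "real_polynomial_function f"
  shows "dir_deriv a (\<lambda>x. f x / c) = (\<lambda>x. dir_deriv a f x / c)"
  using dir_deriv_mult[OF assms, of "\<lambda>x. 1 / c" a] by auto

lemma dir_deriv_sum:
  assumes "finite I" "\<And>i. i \<in> I \<Longrightarrow> real_polynomial_function (f i)"
  shows "dir_deriv a (\<lambda>x. \<Sum>i\<in>I. f i x) = (\<lambda>x. \<Sum>i\<in>I. dir_deriv a (f i) x)"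
  by (rule ext, rule dir_deriv_eqI) (intro has_derivative_sum has_derivative_dir_deriv assms)

lemma real_polynomial_function_inner:
  fixes b :: "'a::real_inner"
  shows "real_polynomial_function (\<lambda>x. x \<bullet> b)"
  by (rule real_polynomial_function.intros(1)) (rule bounded_linear_inner_left)

lemma real_polynomial_function_norm_sq:
  "real_polynomial_function (\<lambda>x::'a::euclidean_space. x \<bullet> x)"
proof -
  have "real_polynomial_function (\<lambda>x::'a. \<Sum>b\<in>Basis. (x \<bullet> b) * (x \<bullet> b))"
    by (intro real_polynomial_function_sum real_polynomial_function.intros(4)
          real_polynomial_function_inner) auto
  then show ?thesis by (simp add: euclidean_inner[symmetric])
qed

lemma dir_deriv_norm_sq [simp]:
  fixes a :: "'a::real_inner"
  shows "dir_deriv a (\<lambda>x. x \<bullet> x) = (\<lambda>x. 2 * (x \<bullet> a))"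
  by (rule ext, rule dir_deriv_eqI[THEN trans])
     (rule has_derivative_inner[OF has_derivative_ident has_derivative_ident], simp add: inner_commute)

lemma real_polynomial_function_dir_deriv:
  assumes "real_polynomial_function f"
  shows "real_polynomial_function (dir_deriv a f)"
  using assms
proof induction
  case (linear f)
  then show ?case by (simp add: dir_deriv_bounded_linear real_polynomial_function.intros(2))
qed (auto simp: dir_deriv_add dir_deriv_mult real_polynomial_function.intros(2))

lemmas polynomial_intros [simp] = real_polynomial_function.intros(2) real_polynomial_function.intros(3)
  real_polynomial_function.intros(4) real_polynomial_function_diff real_polynomial_function_divide
  real_polynomial_function_dir_deriv real_polynomial_function_inner real_polynomial_function_norm_sq

lemmas dir_deriv_simps = dir_deriv_add dir_deriv_diff dir_deriv_mult dir_deriv_divide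

lemma dir_deriv_commute:
  assumes "real_polynomial_function f"
  shows "dir_deriv a (dir_deriv b f) = dir_deriv b (dir_deriv a f)"
  using assms
proof induction
  case (linear f)
  then show ?case by (simp add: dir_deriv_bounded_linear)
qed (simp_all add: dir_deriv_simps polynomial_intros fun_eq_iff algebra_simps)

text \<open>
  Used both ways: with \<open>a = x\<close> it writes the Euler operator in coordinates, and from right to left it
  collects first-order terms.
\<close>

lemma dir_deriv_Basis:
  fixes a :: "'a::euclidean_space"
  assumes "real_polynomial_function f"
  shows "dir_deriv a f x = (\<Sum>b\<in>Basis. (a \<bullet> b) * dir_deriv b f x)"
proof -
  interpret linear "\<lambda>a. dir_deriv a f x" by (rule dir_deriv_linear[OF assms])
  have "dir_deriv (\<Sum>b\<in>Basis. (a \<bullet> b) *\<^sub>R b) f x = (\<Sum>b\<in>Basis. (a \<bullet> b) * dir_deriv b f x)"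
    by (simp add: sum scaleR)
  then show ?thesis by (simp add: euclidean_representation)
qed

lemma continuous_on_polynomial:
  "real_polynomial_function f \<Longrightarrow> continuous_on S f"
  by (meson continuous_at_imp_continuous_on continuous_real_polymonial_function)

lemma integrable_sphere_polynomial:
  "real_polynomial_function f \<Longrightarrow> integrable sphere_measure f"
  by (intro integrable_sphere_continuous continuous_on_polynomial)

section \<open>Infinitesimal rotations and the Casimir operator\<close>

definition plane_rotation :: "'a::real_inner \<Rightarrow> 'a \<Rightarrow> real \<Rightarrow> 'a \<Rightarrow> 'a" where
  "plane_rotation a b t x = x + ((cos t - 1) * (x \<bullet> a) - sin t * (x \<bullet> b)) *\<^sub>R a
     + (sin t * (x \<bullet> a) + (cos t - 1) * (x \<bullet> b)) *\<^sub>R b"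

text \<open>
  The generator of \<^const>\<open>plane_rotation\<close>, the rotation in the plane of \<open>a\<close> and \<open>b\<close>.
\<close>

definition rot_deriv :: "'a::real_inner \<Rightarrow> 'a \<Rightarrow> ('a \<Rightarrow> real) \<Rightarrow> 'a \<Rightarrow> real" where
  "rot_deriv a b f x = (x \<bullet> a) * dir_deriv b f x - (x \<bullet> b) * dir_deriv a f x"

lemma orthogonal_plane_rotation:
  assumes "a \<bullet> a = 1" "b \<bullet> b = 1" "a \<bullet> b = 0"
  shows "orthogonal_transformation (plane_rotation a b t)"
proof -
  have ba: "b \<bullet> a = 0" using assms by (simp add: inner_commute)
  have "linear (plane_rotation a b t)"
    by (rule linearI) (auto simp: plane_rotation_def algebra_simps)
  moreover have "plane_rotation a b t x \<bullet> plane_rotation a b t y = x \<bullet> y" for x y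
  proof -
    define c d where "c = cos t" and "d = sin t"
    have cd: "c\<^sup>2 + d\<^sup>2 = 1" by (simp add: c_def d_def)
    have "plane_rotation a b t x \<bullet> plane_rotation a b t y
      = x \<bullet> y + (c\<^sup>2 + d\<^sup>2 - 1) * ((x \<bullet> a) * (y \<bullet> a) + (x \<bullet> b) * (y \<bullet> b))"
      by (simp add: plane_rotation_def inner_add_left inner_add_right assms ba
            inner_commute[of a y] inner_commute[of b y] flip: c_def d_def)
         (simp add: algebra_simps power2_eq_square)
    then show ?thesis by (simp add: cd)
  qed
  ultimately show ?thesis by (simp add: orthogonal_transformation_def)
qed

lemma has_derivative_along_rotation:
  fixes f :: "'a::euclidean_space \<Rightarrow> real"
  assumes "a \<bullet> a = 1" "b \<bullet> b = 1" "a \<bullet> b = 0" and f: "real_polynomial_function f"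
  shows "((\<lambda>t. f (plane_rotation a b t x)) has_real_derivative
           rot_deriv a b f (plane_rotation a b t x)) (at t)"
proof -
  have ba: "b \<bullet> a = 0" using assms by (simp add: inner_commute)
  define y where "y = plane_rotation a b t x"
  define v where "v = (y \<bullet> a) *\<^sub>R b - (y \<bullet> b) *\<^sub>R a"
  have v: "v = (- sin t * (x \<bullet> a) - cos t * (x \<bullet> b)) *\<^sub>R a + (cos t * (x \<bullet> a) - sin t * (x \<bullet> b)) *\<^sub>R b"
    by (simp add: v_def y_def plane_rotation_def assms ba algebra_simps)
  have "((\<lambda>t. plane_rotation a b t x) has_vector_derivative v) (at t)"
    unfolding v plane_rotation_def
    by (rule derivative_eq_intros refl | simp)+
  then have "((\<lambda>t. plane_rotation a b t x) has_derivative (\<lambda>h. h *\<^sub>R v)) (at t)"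
    by (simp add: has_vector_derivative_def)
  from has_derivative_compose[OF this has_derivative_dir_deriv[OF f]]
  have "((\<lambda>t. f (plane_rotation a b t x)) has_derivative (\<lambda>h. dir_deriv (h *\<^sub>R v) f y)) (at t)"
    by (simp add: y_def)
  moreover have "dir_deriv (h *\<^sub>R v) f y = rot_deriv a b f y * h" for h
  proof -
    interpret linear "\<lambda>a. dir_deriv a f y" by (rule dir_deriv_linear[OF f])
    show ?thesis by (simp add: scaleR v_def diff rot_deriv_def)
  qed
  ultimately show ?thesis by (simp add: has_field_derivative_def y_def)
qed

lemma real_polynomial_function_rot_deriv [simp]:
  "real_polynomial_function f \<Longrightarrow> real_polynomial_function (rot_deriv a b f)"
  unfolding rot_deriv_def by (intro polynomial_intros)

text \<open>
  The integral of \<open>f\<close> over the rotated sphere does not depend on the angle, so its derivative, which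
  is the integral of the infinitesimal rotation of \<open>f\<close>, vanishes. Dominated convergence along the
  difference quotients for the angles \<open>1/(n+1)\<close> justifies differentiating under the integral; the
  mean value theorem bounds the quotients by the maximum of \<^term>\<open>rot_deriv a b f\<close> on the sphere.
\<close>

lemma integral_rot_deriv:
  assumes ab: "a \<bullet> a = 1" "b \<bullet> b = 1" "a \<bullet> b = 0" and f: "real_polynomial_function f"
  shows "(\<integral>x. rot_deriv a b f x \<partial>sphere_measure) = 0"
proof -
  note orth = orthogonal_plane_rotation[OF ab]
  interpret finite_measure sphere_measure by (rule finite_measure_sphere_measure)
  have Rm: "plane_rotation a b t \<in> sphere_measure \<rightarrow>\<^sub>M sphere_measure" for t
    using orth[of t] by (rule measurable_sphere_orthogonal)
  have R0: "plane_rotation a b 0 x = x" for x by (simp add: plane_rotation_def)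
  have RS: "plane_rotation a b t x \<in> S2" if "x \<in> S2" for t x
    using orthogonal_transformation_norm[OF orth[of t], of x] that by simp
  have "compact (rot_deriv a b f ` S2)"
    by (intro compact_continuous_image compact_sphere continuous_on_polynomial
          real_polynomial_function_rot_deriv f)
  then have "bounded (rot_deriv a b f ` S2)" by (rule compact_imp_bounded)
  then obtain B where "\<forall>y\<in>rot_deriv a b f ` S2. norm y \<le> B" unfolding bounded_iff ..
  then have B: "\<bar>rot_deriv a b f x\<bar> \<le> B" if "x \<in> S2" for x using that by auto
  define h where "h n = 1 / real (Suc n)" for n
  have h: "h n > 0" for n by (simp add: h_def)
  define s where "s n x = (f (plane_rotation a b (h n) x) - f x) / h n" for n x
  have fm: "f \<in> borel_measurable sphere_measure"
    using integrable_sphere_polynomial[OF f] by (rule borel_measurable_integrable)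
  have intR: "integrable sphere_measure (\<lambda>x. f (plane_rotation a b t x))" for t
  proof -
    have "integrable (distr sphere_measure sphere_measure (plane_rotation a b t)) f"
      using integrable_sphere_polynomial[OF f]
      by (simp only: sphere_measure_orthogonal_invariant[OF orth])
    then show ?thesis by (simp only: integrable_distr_eq[OF Rm fm])
  qed
  have inv: "(\<integral>x. f (plane_rotation a b t x) \<partial>sphere_measure) = (\<integral>x. f x \<partial>sphere_measure)" for t
    using integral_distr[OF Rm[of t] fm]
    by (simp only: sphere_measure_orthogonal_invariant[OF orth])
  have zero: "(\<integral>x. s n x \<partial>sphere_measure) = 0" for n
    unfolding s_def
    by (simp add: Bochner_Integration.integral_diff[OF intR integrable_sphere_polynomial[OF f]] inv)
  have "(\<lambda>n. \<integral>x. s n x \<partial>sphere_measure) \<longlonglongrightarrow> (\<integral>x. rot_deriv a b f x \<partial>sphere_measure)"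
  proof (rule integral_dominated_convergence[where w = "\<lambda>_. B"])
    show "rot_deriv a b f \<in> borel_measurable sphere_measure"
      by (intro borel_measurable_integrable integrable_sphere_polynomial
            real_polynomial_function_rot_deriv f)
    show "s n \<in> borel_measurable sphere_measure" for n
      unfolding s_def using intR fm by (intro borel_measurable_divide borel_measurable_diff) auto
    show "integrable sphere_measure (\<lambda>_. B)" by simp
    have h0: "filterlim h (at 0) sequentially"
      unfolding filterlim_at using h LIMSEQ_inverse_real_of_nat
      by (auto simp: h_def[abs_def] inverse_eq_divide)
    have "(\<lambda>n. s n x) \<longlonglongrightarrow> rot_deriv a b f x" for x
    proof -
      have "((\<lambda>t. (f (plane_rotation a b (0 + t) x) - f (plane_rotation a b 0 x)) / t)
          \<longlongrightarrow> rot_deriv a b f (plane_rotation a b 0 x)) (at 0)"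
        using has_derivative_along_rotation[OF ab f, of x 0] by (simp add: DERIV_def)
      from filterlim_compose[OF this h0] show ?thesis by (simp add: s_def R0)
    qed
    then show "AE x in sphere_measure. (\<lambda>n. s n x) \<longlonglongrightarrow> rot_deriv a b f x" by simp
    have "norm (s n x) \<le> B" if x: "x \<in> S2" for n x
    proof -
      obtain z where "f (plane_rotation a b (h n) x) - f (plane_rotation a b 0 x)
          = (h n - 0) * rot_deriv a b f (plane_rotation a b z x)"
        using MVT2[OF h, of n "\<lambda>t. f (plane_rotation a b t x)"
            "\<lambda>t. rot_deriv a b f (plane_rotation a b t x)"]
          has_derivative_along_rotation[OF ab f, of x] by blast
      then have "s n x = rot_deriv a b f (plane_rotation a b z x)"
        using h[of n] by (simp add: s_def R0)
      then show ?thesis using B[OF RS[OF x]] by simp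
    qed
    then show "AE x in sphere_measure. norm (s n x) \<le> B" for n by (intro AE_I2) simp
  qed
  then show ?thesis by (simp add: zero LIMSEQ_const_iff)
qed

lemma rot_deriv_mult:
  assumes "real_polynomial_function f" "real_polynomial_function g"
  shows "rot_deriv a b (\<lambda>x. f x * g x) x = f x * rot_deriv a b g x + rot_deriv a b f x * g x"
  by (simp add: rot_deriv_def dir_deriv_mult[OF assms] algebra_simps)

text \<open>
  A derivation whose values have integral zero satisfies integration by parts; two integrations by
  parts make its square symmetric.
\<close>

lemma rot_deriv_selfadjoint:
  assumes ab: "a \<bullet> a = 1" "b \<bullet> b = 1" "a \<bullet> b = 0"
    and f: "real_polynomial_function f" and g: "real_polynomial_function g"
  shows "L2_inner f (rot_deriv a b (rot_deriv a b g)) = L2_inner g (rot_deriv a b (rot_deriv a b f))"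
proof -
  have parts: "L2_inner u (rot_deriv a b v) = - L2_inner (rot_deriv a b u) v"
    if u: "real_polynomial_function u" and v: "real_polynomial_function v" for u v
  proof -
    have "0 = (\<integral>x. u x * rot_deriv a b v x + rot_deriv a b u x * v x \<partial>sphere_measure)"
      using integral_rot_deriv[OF ab real_polynomial_function.intros(4)[OF u v]]
      by (simp add: rot_deriv_mult[OF u v])
    also have "\<dots> = L2_inner u (rot_deriv a b v) + L2_inner (rot_deriv a b u) v"
      unfolding L2_inner_def
      by (intro Bochner_Integration.integral_add integrable_sphere_polynomial
            real_polynomial_function.intros(4) real_polynomial_function_rot_deriv u v)
    finally show ?thesis by simp
  qed
  have "L2_inner f (rot_deriv a b (rot_deriv a b g)) = - L2_inner (rot_deriv a b f) (rot_deriv a b g)"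
    by (rule parts[OF f]) (simp add: g)
  also have "\<dots> = - L2_inner (rot_deriv a b g) (rot_deriv a b f)"
    by (simp add: L2_inner_def mult.commute)
  also have "\<dots> = L2_inner g (rot_deriv a b (rot_deriv a b f))"
    using parts[OF g, of "rot_deriv a b f"] f by simp
  finally show ?thesis .
qed

section \<open>Solid harmonics\<close>

abbreviation e1 :: "real^3" where "e1 \<equiv> axis 1 1"
abbreviation e2 :: "real^3" where "e2 \<equiv> axis 2 1"
abbreviation e3 :: "real^3" where "e3 \<equiv> axis 3 1"

lemma Basis_real3: "(Basis :: (real^3) set) = {e1, e2, e3}"
  by (auto simp: Basis_vec_def UNIV_3)

lemma axes_orthonormal:
  "e1 \<bullet> e1 = 1" "e2 \<bullet> e2 = 1" "e3 \<bullet> e3 = 1" "e1 \<bullet> e2 = 0" "e2 \<bullet> e3 = 0" "e3 \<bullet> e1 = 0"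
  "e2 \<bullet> e1 = 0" "e3 \<bullet> e2 = 0" "e1 \<bullet> e3 = 0"
  by (simp_all add: inner_axis_axis)

lemma axes_distinct: "e1 \<noteq> e2" "e2 \<noteq> e3" "e1 \<noteq> e3"
  by (simp_all add: axis_eq_axis)

lemma sum_Basis_real3: "(\<Sum>b\<in>Basis. f (b :: real^3)) = f e1 + f e2 + f e3" for f :: "_ \<Rightarrow> real"
  using axes_distinct by (simp add: Basis_real3)

lemma laplacian_eq_dir_deriv:
  assumes p: "real_polynomial_function p"
  shows "laplacian p x = (\<Sum>b\<in>Basis. dir_deriv b (dir_deriv b p) x)"
proof -
  have "deriv (\<lambda>t. q (x + t *\<^sub>R b)) = (\<lambda>t. dir_deriv b q (x + t *\<^sub>R b))"
    if q: "real_polynomial_function q" for q b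
  proof
    fix t
    have "((\<lambda>t. x + t *\<^sub>R b) has_derivative (\<lambda>h. h *\<^sub>R b)) (at t)"
      by (auto intro!: derivative_eq_intros)
    from has_derivative_compose[OF this has_derivative_dir_deriv[OF q]]
    have "((\<lambda>t. q (x + t *\<^sub>R b)) has_real_derivative dir_deriv b q (x + t *\<^sub>R b)) (at t)"
      using linear_cmul[OF dir_deriv_linear[OF q]]
      by (simp add: has_field_derivative_def mult.commute[of _ "dir_deriv b q _"])
    then show "deriv (\<lambda>t. q (x + t *\<^sub>R b)) t = dir_deriv b q (x + t *\<^sub>R b)"
      by (rule DERIV_imp_deriv)
  qed
  then show ?thesis
    using p by (simp add: laplacian_def numeral_2_eq_2)
qed

text \<open>
  Homogeneity is expressed by Euler's identity, which is linear and stable under directional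
  derivatives. It is equivalent to homogeneity for polynomials.
\<close>

definition solid_harmonic :: "nat \<Rightarrow> (real^3 \<Rightarrow> real) \<Rightarrow> bool" where
  "solid_harmonic n f \<longleftrightarrow> real_polynomial_function f \<and>
     (\<forall>x. dir_deriv x f x = real n * f x) \<and>
     (\<forall>x. (\<Sum>b\<in>Basis. dir_deriv b (dir_deriv b f) x) = 0)"

lemma solid_harmonicD:
  assumes "solid_harmonic n f"
  shows "real_polynomial_function f" "dir_deriv x f x = real n * f x"
    "(\<Sum>b\<in>Basis. dir_deriv b (dir_deriv b f) x) = 0"
  using assms by (auto simp: solid_harmonic_def)

text \<open>
  Differentiate Euler's identity in the direction \<open>a\<close>; the product rule on the coefficients
  \<open>x \<bullet> b\<close> produces the extra term that lowers the degree by one.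
\<close>

lemma euler_dir_deriv:
  fixes f :: "'a::euclidean_space \<Rightarrow> real"
  assumes f: "real_polynomial_function f" and e: "\<And>x. dir_deriv x f x = c * f x"
  shows "dir_deriv x (dir_deriv a f) x = (c - 1) * dir_deriv a f x"
proof -
  have "(\<lambda>x. \<Sum>b\<in>Basis. (x \<bullet> b) * dir_deriv b f x) = (\<lambda>x. c * f x)"
    by (simp add: e flip: dir_deriv_Basis[OF f])
  then have "dir_deriv a (\<lambda>x. \<Sum>b\<in>Basis. (x \<bullet> b) * dir_deriv b f x) x = dir_deriv a (\<lambda>x. c * f x) x"
    by simp
  also have "\<dots> = c * dir_deriv a f x"
    using f by (simp add: dir_deriv_simps)
  also have "dir_deriv a (\<lambda>x. \<Sum>b\<in>Basis. (x \<bullet> b) * dir_deriv b f x) x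
      = (\<Sum>b\<in>Basis. (x \<bullet> b) * dir_deriv b (dir_deriv a f) x) + (\<Sum>b\<in>Basis. (a \<bullet> b) * dir_deriv b f x)"
    using f by (simp add: dir_deriv_sum dir_deriv_simps sum.distrib dir_deriv_commute[of f a])
  also have "\<dots> = dir_deriv x (dir_deriv a f) x + dir_deriv a f x"
    using f by (simp flip: dir_deriv_Basis)
  finally show ?thesis by (simp add: algebra_simps)
qed

lemma solid_harmonic_dir_deriv:
  assumes "solid_harmonic (Suc n) f"
  shows "solid_harmonic n (dir_deriv a f)"
proof -
  note f = solid_harmonicD[OF assms]
  have "(\<Sum>b\<in>Basis. dir_deriv b (dir_deriv b (dir_deriv a f)) x) =
      dir_deriv a (\<lambda>x. \<Sum>b\<in>Basis. dir_deriv b (dir_deriv b f) x) x" for x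
  proof -
    have "dir_deriv a (dir_deriv b (dir_deriv b f)) = dir_deriv b (dir_deriv b (dir_deriv a f))" for b
      using dir_deriv_commute[of "dir_deriv b f" a b] dir_deriv_commute[OF f(1), of a b] f(1) by simp
    then show ?thesis using f(1) by (simp add: dir_deriv_sum)
  qed
  also have "\<dots> x = 0" for x by (simp add: f(3))
  finally show ?thesis
    using f(1) euler_dir_deriv[OF f(1) f(2)] by (simp add: solid_harmonic_def)
qed

lemma rot_deriv_twice:
  assumes ab: "a \<bullet> a = 1" "b \<bullet> b = 1" "a \<bullet> b = 0" and f: "real_polynomial_function f"
  shows "rot_deriv a b (rot_deriv a b f) x =
    (x \<bullet> a)\<^sup>2 * dir_deriv b (dir_deriv b f) x + (x \<bullet> b)\<^sup>2 * dir_deriv a (dir_deriv a f) x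
    - 2 * (x \<bullet> a) * (x \<bullet> b) * dir_deriv a (dir_deriv b f) x
    - (x \<bullet> a) * dir_deriv a f x - (x \<bullet> b) * dir_deriv b f x"
proof -
  have ba: "b \<bullet> a = 0" using ab by (simp add: inner_commute)
  have r: "rot_deriv a b f = (\<lambda>x. (x \<bullet> a) * dir_deriv b f x - (x \<bullet> b) * dir_deriv a f x)"
    by (rule ext) (simp add: rot_deriv_def)
  show ?thesis
    unfolding r using f by (simp add: rot_deriv_def dir_deriv_simps ab ba dir_deriv_commute[of f b a])
       (simp add: algebra_simps power2_eq_square)
qed

text \<open>
  On functions on the sphere this is the Laplace-Beltrami operator.
\<close>

definition casimir :: "(real^3 \<Rightarrow> real) \<Rightarrow> real^3 \<Rightarrow> real" where
  "casimir f x = rot_deriv e1 e2 (rot_deriv e1 e2 f) x + rot_deriv e2 e3 (rot_deriv e2 e3 f) x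
     + rot_deriv e3 e1 (rot_deriv e3 e1 f) x"

text \<open>
  On polynomials the Casimir operator equals \<open>|x|\<^sup>2 \<Delta> - E\<^sup>2 - E\<close> with the Euler operator \<open>E\<close>. For a
  solid harmonic of degree \<open>n\<close> the first term vanishes and \<open>E\<close> acts as multiplication by \<open>n\<close>.
\<close>

lemma casimir_solid_harmonic:
  assumes "solid_harmonic n f"
  shows "casimir f x = - real (n * (n + 1)) * f x"
proof -
  note f = solid_harmonicD[OF assms]
  define d where "d a = dir_deriv a f x" for a
  define dd where "dd a b = dir_deriv a (dir_deriv b f) x" for a b
  define x1 x2 x3 where "x1 = x \<bullet> e1" and "x2 = x \<bullet> e2" and "x3 = x \<bullet> e3"
  have sym: "dd b a = dd a b" for a b by (simp add: dd_def dir_deriv_commute[OF f(1)])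
  have lap: "dd e1 e1 + dd e2 e2 + dd e3 e3 = 0"
    using f(3)[of x] by (simp add: sum_Basis_real3 dd_def)
  have eul: "x1 * d e1 + x2 * d e2 + x3 * d e3 = real n * f x"
    using f(2)[of x] dir_deriv_Basis[OF f(1), of x x] by (simp add: sum_Basis_real3 d_def x1_def x2_def x3_def)
  have eul2: "x1 * dd e1 a + x2 * dd e2 a + x3 * dd e3 a = (real n - 1) * d a" for a
    using euler_dir_deriv[OF f(1) f(2), of x a] dir_deriv_Basis[of "dir_deriv a f" x x] f(1)
    by (simp add: sum_Basis_real3 dd_def d_def x1_def x2_def x3_def)
  have "casimir f x = (x1\<^sup>2 * dd e2 e2 + x2\<^sup>2 * dd e1 e1 - 2 * x1 * x2 * dd e1 e2 - x1 * d e1 - x2 * d e2)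
     + (x2\<^sup>2 * dd e3 e3 + x3\<^sup>2 * dd e2 e2 - 2 * x2 * x3 * dd e2 e3 - x2 * d e2 - x3 * d e3)
     + (x3\<^sup>2 * dd e1 e1 + x1\<^sup>2 * dd e3 e3 - 2 * x3 * x1 * dd e3 e1 - x3 * d e3 - x1 * d e1)"
    unfolding casimir_def by (simp add: rot_deriv_twice axes_orthonormal f(1) d_def dd_def x1_def x2_def x3_def)
  also have "\<dots> = (x1\<^sup>2 + x2\<^sup>2 + x3\<^sup>2) * (dd e1 e1 + dd e2 e2 + dd e3 e3)
     - (x1 * (x1 * dd e1 e1 + x2 * dd e2 e1 + x3 * dd e3 e1)
       + x2 * (x1 * dd e1 e2 + x2 * dd e2 e2 + x3 * dd e3 e2)
       + x3 * (x1 * dd e1 e3 + x2 * dd e2 e3 + x3 * dd e3 e3))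
     - 2 * (x1 * d e1 + x2 * d e2 + x3 * d e3)"
    by (simp add: sym[of e2 e1] sym[of e3 e2] sym[of e1 e3]) (simp add: algebra_simps power2_eq_square)
  also have "\<dots> = - ((real n - 1) * (x1 * d e1 + x2 * d e2 + x3 * d e3)) - 2 * (x1 * d e1 + x2 * d e2 + x3 * d e3)"
    by (simp add: eul2 lap) (simp add: algebra_simps)
  also have "\<dots> = - real (n * (n + 1)) * f x"
    unfolding eul by (simp add: algebra_simps)
  finally show ?thesis .
qed

text \<open>
  Eigenfunctions of a symmetric operator for distinct eigenvalues are orthogonal.
\<close>

lemma solid_harmonics_orthogonal:
  assumes f: "solid_harmonic m f" and g: "solid_harmonic n g" and mn: "m \<noteq> n"
  shows "L2_inner f g = 0"
proof -
  note pf = solid_harmonicD(1)[OF f] and pg = solid_harmonicD(1)[OF g]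
  have int: "integrable sphere_measure (\<lambda>x. u x * v x)"
    if "real_polynomial_function u" "real_polynomial_function v" for u v
    using that by (intro integrable_sphere_polynomial) simp
  have cas: "L2_inner u (casimir v) = L2_inner u (rot_deriv e1 e2 (rot_deriv e1 e2 v))
       + L2_inner u (rot_deriv e2 e3 (rot_deriv e2 e3 v)) + L2_inner u (rot_deriv e3 e1 (rot_deriv e3 e1 v))"
    if "real_polynomial_function u" "real_polynomial_function v" for u v
    using that by (simp add: L2_inner_def casimir_def distrib_left int)
  have "L2_inner f (casimir g) = L2_inner g (casimir f)"
    unfolding cas[OF pf pg] cas[OF pg pf] using pf pg
    by (simp add: rot_deriv_selfadjoint[of _ _ f g] axes_orthonormal)
  moreover have eigen: "L2_inner u (casimir v) = - (real (k * (k + 1)) * L2_inner u v)"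
    if v: "solid_harmonic k v" for u v k
  proof -
    define c where "c = - real (k * (k + 1))"
    have "casimir v x = c * v x" for x using casimir_solid_harmonic[OF v] by (simp only: c_def)
    then have "L2_inner u (casimir v) = c * L2_inner u v"
      by (simp add: L2_inner_def mult.left_commute)
    then show ?thesis by (simp only: c_def minus_mult_left)
  qed
  moreover have "L2_inner g f = L2_inner f g" by (simp add: L2_inner_def mult.commute)
  ultimately have "real (n * (n + 1)) * L2_inner f g = real (m * (m + 1)) * L2_inner f g"
    unfolding eigen[OF f] eigen[OF g] by (simp only: neg_equal_iff_equal)
  moreover
  have "n * (n + 1) \<noteq> m * (m + 1)"
  proof -
    have lt: "a * (a + 1) < b * (b + 1)" if "a < b" for a b :: nat
      using that by (intro mult_strict_mono) auto
    from mn have "m < n \<or> n < m" by auto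
    then show ?thesis using lt by (metis less_irrefl)
  qed
  then have "real (n * (n + 1)) \<noteq> real (m * (m + 1))" by (simp only: of_nat_eq_iff not_False_eq_True)
  ultimately show ?thesis by (simp only: mult_cancel_right simp_thms)
qed

text \<open>
  This is the decomposition of \<open>(x \<bullet> a) h\<close> into harmonics: \<open>\<Delta>((x \<bullet> a) h) = 2 \<partial>\<^sub>a h\<close>, while
  \<open>\<Delta>(|x|\<^sup>2 g) = (4n + 6) g\<close> for \<open>g = \<partial>\<^sub>a h\<close> of degree \<open>n\<close>, so subtracting \<open>|x|\<^sup>2 g/(2n+3)\<close> removes the
  Laplacian. On the sphere, multiplication by a coordinate thus only changes the degree of a harmonic
  by one, up or down. It drives both the induction for Legendre polynomials and the orthogonality to
  polynomials of lower degree.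
\<close>

lemma solid_harmonic_times_coordinate:
  assumes h: "solid_harmonic (Suc n) h"
  shows "solid_harmonic (Suc (Suc n)) (\<lambda>x. (x \<bullet> a) * h x - (x \<bullet> x) * dir_deriv a h x / (2 * real n + 3))"
proof -
  note p = solid_harmonicD[OF h]
  let ?g = "dir_deriv a h"
  note q = solid_harmonicD[OF solid_harmonic_dir_deriv[OF h, of a]]
  have "dir_deriv x (\<lambda>x. (x \<bullet> a) * h x - (x \<bullet> x) * ?g x / (2 * real n + 3)) x
     = real (Suc (Suc n)) * ((x \<bullet> a) * h x - (x \<bullet> x) * ?g x / (2 * real n + 3))" for x
    by (simp add: dir_deriv_simps p q) (simp add: algebra_simps diff_divide_distrib add_divide_distrib)
  moreover have "(\<Sum>b\<in>Basis. dir_deriv b (dir_deriv b (\<lambda>x. (x \<bullet> a) * h x - (x \<bullet> x) * ?g x / (2 * real n + 3))) x) = 0" for x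
  proof -
    have dd: "dir_deriv b (dir_deriv b (\<lambda>x. (x \<bullet> a) * h x - (x \<bullet> x) * ?g x / (2 * real n + 3))) x
       = (x \<bullet> a) * dir_deriv b (dir_deriv b h) x + 2 * ((a \<bullet> b) * dir_deriv b h x)
         - ((x \<bullet> x) * dir_deriv b (dir_deriv b ?g) x + 4 * ((x \<bullet> b) * dir_deriv b ?g x) + 2 * (b \<bullet> b) * ?g x) / (2 * real n + 3)" for b
      using p(1) q(1)
      by (simp add: dir_deriv_simps inner_commute[of b a] algebra_simps)
    have bb: "(\<Sum>b::real^3\<in>Basis. b \<bullet> b) = 3"
      by (simp add: sum_Basis_real3 axes_orthonormal)
    have "(\<Sum>b\<in>Basis. dir_deriv b (dir_deriv b (\<lambda>x. (x \<bullet> a) * h x - (x \<bullet> x) * ?g x / (2 * real n + 3))) x)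
      = (x \<bullet> a) * (\<Sum>b\<in>Basis. dir_deriv b (dir_deriv b h) x) + 2 * (\<Sum>b\<in>Basis. (a \<bullet> b) * dir_deriv b h x)
       - ((x \<bullet> x) * (\<Sum>b\<in>Basis. dir_deriv b (dir_deriv b ?g) x) + 4 * (\<Sum>b\<in>Basis. (x \<bullet> b) * dir_deriv b ?g x)
          + 2 * (\<Sum>b::real^3\<in>Basis. b \<bullet> b) * ?g x) / (2 * real n + 3)"
      unfolding dd sum_Basis_real3 by (simp add: algebra_simps add_divide_distrib diff_divide_distrib)
    also have "\<dots> = 2 * ?g x - (4 * (real n * ?g x) + 6 * ?g x) / (2 * real n + 3)"
      unfolding bb p(3) q(3) dir_deriv_Basis[OF p(1), of a, symmetric]
        dir_deriv_Basis[OF q(1), of x, symmetric] q(2) by simp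
    also have "\<dots> = 0" by (simp add: field_simps)
    finally show ?thesis .
  qed
  ultimately show ?thesis using p(1) by (simp add: solid_harmonic_def)
qed

lemma solid_harmonic_const: "solid_harmonic 0 (\<lambda>x. c)"
  by (simp add: solid_harmonic_def)

lemma solid_harmonic_cmult:
  assumes "solid_harmonic n f"
  shows "solid_harmonic n (\<lambda>x. c * f x)"
  using solid_harmonicD[OF assms]
  by (simp add: solid_harmonic_def dir_deriv_simps flip: sum_distrib_left)

lemma solid_harmonic_add:
  assumes "solid_harmonic n f" "solid_harmonic n g"
  shows "solid_harmonic n (\<lambda>x. f x + g x)"
  using solid_harmonicD[OF assms(1)] solid_harmonicD[OF assms(2)]
  by (simp add: solid_harmonic_def dir_deriv_simps sum.distrib distrib_left)

lemma solid_harmonic_diff: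
  assumes "solid_harmonic n f" "solid_harmonic n g"
  shows "solid_harmonic n (\<lambda>x. f x - g x)"
  using solid_harmonic_add[OF assms(1) solid_harmonic_cmult[OF assms(2), of "-1"]] by simp

lemma solid_harmonic_zero: "solid_harmonic n (\<lambda>x. 0)"
  by (simp add: solid_harmonic_def)

lemma solid_harmonic_sum:
  assumes "\<And>i. i \<in> I \<Longrightarrow> solid_harmonic n (f i)"
  shows "solid_harmonic n (\<lambda>x. \<Sum>i\<in>I. f i x)"
  using assms by (induction I rule: infinite_finite_induct)
    (simp_all add: solid_harmonic_zero solid_harmonic_add)

lemma euler_homogeneous:
  assumes p: "real_polynomial_function p" and hom: "\<And>c x. p (c *\<^sub>R x) = c ^ n * p x"
  shows "dir_deriv x p x = real n * p x"
proof -
  have "((\<lambda>t. t *\<^sub>R x) has_derivative (\<lambda>h. h *\<^sub>R x)) (at 1)"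
    by (auto intro!: derivative_eq_intros)
  from has_derivative_compose[OF this has_derivative_dir_deriv[OF p]]
  have "((\<lambda>t. p (t *\<^sub>R x)) has_real_derivative dir_deriv x p x) (at 1)"
    using linear_cmul[OF dir_deriv_linear[OF p]]
    by (simp add: has_field_derivative_def mult.commute[of _ "dir_deriv _ p _"])
  moreover have "((\<lambda>t. p (t *\<^sub>R x)) has_real_derivative real n * p x) (at 1)"
    unfolding hom by (auto intro!: derivative_eq_intros)
  ultimately show ?thesis by (rule DERIV_unique)
qed

lemma real_polynomial_function_component: "real_polynomial_function (\<lambda>x::real^3. x $ i)"
  using real_polynomial_function_inner[of "axis i 1 :: real^3"] by (simp add: inner_axis)

lemma finite_exponents:
  "finite {(i, j, k). i + j + k \<le> (n::nat)}" "finite {(i, j, k). i + j + k = (n::nat)}"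
proof -
  have "{(i, j, k). i + j + k \<le> n} \<subseteq> {..n} \<times> {..n} \<times> {..n}" by auto
  then show le: "finite {(i, j, k). i + j + k \<le> n}" by (rule finite_subset) simp
  have "{(i, j, k). i + j + k = n} \<subseteq> {(i, j, k). i + j + k \<le> n}" by auto
  then show "finite {(i, j, k). i + j + k = n}" using le by (rule finite_subset)
qed

lemma real_polynomial_function_monomial:
  "real_polynomial_function (\<lambda>x::real^3. c * x$1 ^ i * x$2 ^ j * x$3 ^ k)"
  by (intro real_polynomial_function.intros(2,4) real_polynomial_function_power
        real_polynomial_function_component)

lemma solid_harmonic_homogeneous_poly:
  assumes hp: "homogeneous_poly n p" and lap: "\<And>x. laplacian p x = 0"
  shows "solid_harmonic n p"
proof -
  obtain c where c: "\<And>x. p x = (\<Sum>(i, j, k) \<in> {(i, j, k). i + j + k = n}.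
      c i j k * x$1 ^ i * x$2 ^ j * x$3 ^ k)"
    using hp unfolding homogeneous_poly_def by blast
  have p: "real_polynomial_function p"
    unfolding c[abs_def] case_prod_unfold
    by (intro real_polynomial_function_sum real_polynomial_function_monomial
          finite_exponents(2)[unfolded case_prod_unfold])
  have "p (a *\<^sub>R x) = a ^ n * p x" for a x
    unfolding c sum_distrib_left
    by (intro sum.cong refl) (auto simp: power_mult_distrib power_add)
  then show ?thesis
    using p lap euler_homogeneous[OF p] by (simp add: solid_harmonic_def laplacian_eq_dir_deriv)
qed

text \<open>
  Euler's identity for degree 0 says that \<open>h\<close> is constant along every ray, including its end point by
  continuity.
\<close>

lemma solid_harmonic_0_const:
  assumes "solid_harmonic 0 h"
  shows "h x = h 0"
proof -
  note h = solid_harmonicD[OF assms]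
  have d: "((\<lambda>t. h (t *\<^sub>R x)) has_real_derivative dir_deriv x h (t *\<^sub>R x)) (at t)" for t
  proof -
    have "((\<lambda>t. t *\<^sub>R x) has_derivative (\<lambda>h. h *\<^sub>R x)) (at t)"
      by (auto intro!: derivative_eq_intros)
    from has_derivative_compose[OF this has_derivative_dir_deriv[OF h(1)]] show ?thesis
      using linear_cmul[OF dir_deriv_linear[OF h(1)]]
      by (simp add: has_field_derivative_def mult.commute[of _ "dir_deriv _ h _"])
  qed
  have "dir_deriv x h (t *\<^sub>R x) = 0" if "t > 0" for t
    using h(2)[of "t *\<^sub>R x"] linear_cmul[OF dir_deriv_linear[OF h(1), of "t *\<^sub>R x"], of t x] that by simp
  then have "((\<lambda>t. h (t *\<^sub>R x)) has_real_derivative 0) (at t)" if "t > 0" for t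
    using d[of t] that by simp
  then have "h (1 *\<^sub>R x) = h (0 *\<^sub>R x)"
    using d by (intro DERIV_isconst_end[of 0 1 "\<lambda>t. h (t *\<^sub>R x)"]
        DERIV_continuous_on[where D = "\<lambda>t. dir_deriv x h (t *\<^sub>R x)"])
      (auto intro: has_field_derivative_at_within)
  then show ?thesis by simp
qed

section \<open>Zonal harmonics\<close>

text \<open>
  The homogeneous extension \<open>|x|\<^sup>n P\<^sub>n(x \<bullet> t / |x|)\<close> of a Legendre polynomial. In the Legendre
  recurrence the factor \<open>x \<bullet> x\<close> in the last term keeps it homogeneous.
\<close>

fun solid_zonal :: "real^3 \<Rightarrow> nat \<Rightarrow> real^3 \<Rightarrow> real" where
  "solid_zonal t 0 x = 1"
| "solid_zonal t (Suc 0) x = x \<bullet> t"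
| "solid_zonal t (Suc (Suc n)) x = ((2 * real n + 3) * ((x \<bullet> t) * solid_zonal t (Suc n) x)
     - (real n + 1) * ((x \<bullet> x) * solid_zonal t n x)) / (real n + 2)"

lemma solid_zonal_legendre: "s \<in> S2 \<Longrightarrow> solid_zonal t l s = legendre l (s \<bullet> t)"
  by (induction t l s rule: solid_zonal.induct) (simp_all add: norm_eq_1 mult.assoc)

lemma solid_zonal_fun:
  "solid_zonal t 0 = (\<lambda>x. 1)"
  "solid_zonal t (Suc 0) = (\<lambda>x. x \<bullet> t)"
  "solid_zonal t (Suc (Suc n)) = (\<lambda>x. ((2 * real n + 3) * ((x \<bullet> t) * solid_zonal t (Suc n) x)
     - (real n + 1) * ((x \<bullet> x) * solid_zonal t n x)) / (real n + 2))"
  by auto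

lemma polynomial_solid_zonal [simp]: "real_polynomial_function (solid_zonal t n)"
  by (induction n rule: induct_nat_012) (simp_all add: solid_zonal_fun)

text \<open>
  For \<open>n = 0\<close> the last factor \<open>solid_zonal t (0 - 1) x\<close> is multiplied by 0, so this single formula
  covers the start of the recurrence as well.
\<close>

lemma solid_zonal_recurrence:
  "real (Suc n) * solid_zonal t (Suc n) x =
     real (2 * n + 1) * ((x \<bullet> t) * solid_zonal t n x) - real n * ((x \<bullet> x) * solid_zonal t (n - 1) x)"
  by (cases n) (auto simp: field_simps)

text \<open>
  Differentiating the recurrence and using the formula for smaller degrees leaves the recurrence one
  step lower, multiplied by \<open>n\<close>. The formula identifies the correction term of
  \<open>solid_harmonic_times_coordinate\<close>, which is why zonal functions are harmonic.
\<close>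

lemma dir_deriv_solid_zonal:
  assumes t: "t \<bullet> t = 1"
  shows "dir_deriv t (solid_zonal t (Suc n)) x = real (Suc n) * solid_zonal t n x"
proof (induction n rule: less_induct)
  case (less n)
  have eq: "(\<lambda>x. real (Suc n) * solid_zonal t (Suc n) x) = (\<lambda>x.
     real (2 * n + 1) * ((x \<bullet> t) * solid_zonal t n x) - real n * ((x \<bullet> x) * solid_zonal t (n - 1) x))"
    by (rule ext) (rule solid_zonal_recurrence)
  have "real (Suc n) * dir_deriv t (solid_zonal t (Suc n)) x = dir_deriv t (\<lambda>x. real (Suc n) * solid_zonal t (Suc n) x) x"
    by (simp add: dir_deriv_simps)
  also have "\<dots> = real (2 * n + 1) * (solid_zonal t n x + (x \<bullet> t) * dir_deriv t (solid_zonal t n) x)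
     - real n * (2 * (x \<bullet> t) * solid_zonal t (n - 1) x + (x \<bullet> x) * dir_deriv t (solid_zonal t (n - 1)) x)"
  proof -
    have "dir_deriv t (\<lambda>x. c * ((x \<bullet> t) * u x) - d * ((x \<bullet> x) * v x)) x
      = c * (u x + (x \<bullet> t) * dir_deriv t u x) - d * (2 * (x \<bullet> t) * v x + (x \<bullet> x) * dir_deriv t v x)"
      if "real_polynomial_function u" "real_polynomial_function v" for c d u v
      using that by (simp add: dir_deriv_simps t add.commute)
    then show ?thesis unfolding eq by simp
  qed
  also have "\<dots> = real (Suc n) * (real (Suc n) * solid_zonal t n x)"
  proof (cases n)
    case 0
    then show ?thesis by (simp add: solid_zonal_fun)
  next
    case (Suc m)
    have nm: "n - 1 = m" using Suc by simp
    have 1: "dir_deriv t (solid_zonal t n) x = real n * solid_zonal t m x"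
      using less.IH[of m] Suc by simp
    have 2: "dir_deriv t (solid_zonal t m) x = real m * solid_zonal t (m - 1) x"
    proof (cases m)
      case 0
      then show ?thesis by (simp add: solid_zonal_fun)
    next
      case (Suc k)
      then show ?thesis using less.IH[of k] \<open>n = Suc m\<close> by simp
    qed
    have 3: "real n * solid_zonal t n x =
       real (2 * m + 1) * ((x \<bullet> t) * solid_zonal t m x) - real m * ((x \<bullet> x) * solid_zonal t (m - 1) x)"
      using solid_zonal_recurrence[of m t x] Suc by simp
    have "real (2 * n + 1) * (solid_zonal t n x + (x \<bullet> t) * (real n * solid_zonal t m x))
       - real n * (2 * (x \<bullet> t) * solid_zonal t m x + (x \<bullet> x) * (real m * solid_zonal t (m - 1) x))
      = real (2 * n + 1) * solid_zonal t n x + real n * (real (2 * m + 1) * ((x \<bullet> t) * solid_zonal t m x)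
          - real m * ((x \<bullet> x) * solid_zonal t (m - 1) x))"
      using Suc by (simp add: algebra_simps)
    also have "\<dots> = real (Suc n) * (real (Suc n) * solid_zonal t n x)"
      unfolding 3[symmetric] by (simp add: algebra_simps)
    finally show ?thesis unfolding nm 1 2 .
  qed
  finally show ?case by (simp only: mult_cancel_left of_nat_eq_0_iff) simp
qed

lemma solid_harmonic_solid_zonal:
  assumes t: "t \<bullet> t = 1"
  shows "solid_harmonic n (solid_zonal t n)"
proof (induction n rule: induct_nat_012)
  case 0 then show ?case by (simp add: solid_zonal_fun solid_harmonic_const)
next
  case 1 then show ?case by (simp add: solid_zonal_fun solid_harmonic_def)
next
  case (ge2 n)
  have "solid_harmonic (Suc (Suc n)) (\<lambda>x. (2 * real n + 3) / (real n + 2) *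
     ((x \<bullet> t) * solid_zonal t (Suc n) x
       - (x \<bullet> x) * dir_deriv t (solid_zonal t (Suc n)) x / (2 * real n + 3)))"
    by (intro solid_harmonic_cmult solid_harmonic_times_coordinate ge2)
  moreover have "(2 * real n + 3) / (real n + 2) * ((x \<bullet> t) * solid_zonal t (Suc n) x
       - (x \<bullet> x) * dir_deriv t (solid_zonal t (Suc n)) x / (2 * real n + 3)) = solid_zonal t (Suc (Suc n)) x" for x
  proof -
    (* solve the recurrence for the harmonic combination of the two preceding zonal functions *)
    have "a / b * (u - v / a) = (a * u - v) / b" if "a \<noteq> 0" for a b u v :: real
      using that by (simp add: right_diff_distrib diff_divide_distrib)
    from this[of "2 * real n + 3" "real n + 2" "(x \<bullet> t) * solid_zonal t (Suc n) x"
        "(x \<bullet> x) * (real (Suc n) * solid_zonal t n x)"]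
    show ?thesis
      unfolding dir_deriv_solid_zonal[OF t] by (simp add: add_nonneg_eq_0_iff mult_ac add_ac)
  qed
  ultimately show ?case by simp
qed

lemma L2_inner_cong:
  assumes "\<And>s. s \<in> S2 \<Longrightarrow> f s * g s = f' s * g' s"
  shows "L2_inner f g = L2_inner f' g'"
  unfolding L2_inner_def using assms by (intro Bochner_Integration.integral_cong) auto

lemma L2_inner_commute: "L2_inner f g = L2_inner g f"
  by (simp add: L2_inner_def mult.commute)

lemma L2_inner_polynomial_linear:
  assumes "real_polynomial_function f" "real_polynomial_function g" "real_polynomial_function h"
  shows "L2_inner (\<lambda>x. f x + g x) h = L2_inner f h + L2_inner g h"
    and "L2_inner (\<lambda>x. f x - g x) h = L2_inner f h - L2_inner g h"
  unfolding L2_inner_def using assms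
  by (simp_all add: algebra_simps integrable_sphere_polynomial)

lemma L2_inner_cmult: "L2_inner (\<lambda>x. c * f x) h = c * L2_inner f h"
  by (simp add: L2_inner_def mult.assoc)

text \<open>
  The reproducing property of the zonal functions \<open>Z\<^sub>n\<close> with axis \<open>t\<close>, up to normalisation. Expand
  \<open>Z\<^sub>n\<^sub>+\<^sub>1\<close> by its recurrence and move the factor \<open>x \<bullet> t\<close> to \<open>h\<close>. The term with \<open>Z\<^sub>n\<^sub>-\<^sub>1\<close> is orthogonal to \<open>h\<close>; of the two harmonic components of
  \<open>(x \<bullet> t) h\<close> only the one of degree \<open>n\<close> survives against \<open>Z\<^sub>n\<close>. It is a multiple of \<open>\<partial>\<^sub>t h\<close>, whose
  value at \<open>t\<close> is \<open>(n+1) h(t)\<close> by Euler's identity.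
\<close>

lemma L2_inner_solid_zonal:
  assumes t: "t \<bullet> t = 1" and h: "solid_harmonic n h"
  shows "L2_inner h (solid_zonal t n) = 4 * pi / (2 * real n + 1) * h t"
  using h
proof (induction n arbitrary: h)
  case 0
  have "h = (\<lambda>x. h t)" using solid_harmonic_0_const[OF 0] by (metis ext)
  then have "L2_inner h (solid_zonal t 0) = L2_inner (\<lambda>x. h t) (\<lambda>x. 1)"
    by (intro L2_inner_cong) (metis solid_zonal.simps(1))
  then show ?case
    by (simp add: L2_inner_def measure_sphere_measure)
next
  case (Suc n)
  note ph = solid_harmonicD(1)[OF Suc.prems]
  let ?g = "dir_deriv t h"
  let ?H = "\<lambda>x. (x \<bullet> t) * h x - (x \<bullet> x) * ?g x / (2 * real n + 3)"
  have zz: "solid_harmonic k (solid_zonal t k)" for k by (rule solid_harmonic_solid_zonal[OF t])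
  have "real (Suc n) * L2_inner h (solid_zonal t (Suc n))
     = L2_inner (\<lambda>x. real (2 * n + 1) * ((x \<bullet> t) * h x)) (solid_zonal t n)
       - L2_inner (\<lambda>x. real n * h x) (solid_zonal t (n - 1))"
  proof -
    have "real (Suc n) * L2_inner h (solid_zonal t (Suc n)) = (\<integral>x. h x * (real (Suc n) * solid_zonal t (Suc n) x) \<partial>sphere_measure)"
      by (simp only: L2_inner_def mult.left_commute[of "h _" "real (Suc n)"] integral_mult_right_zero)
    also have "\<dots> = (\<integral>x. real (2 * n + 1) * ((x \<bullet> t) * h x) * solid_zonal t n x
        - (real n * h x) * ((x \<bullet> x) * solid_zonal t (n - 1) x) \<partial>sphere_measure)"
      unfolding solid_zonal_recurrence by (simp add: algebra_simps)
    also have "\<dots> = (\<integral>x. real (2 * n + 1) * ((x \<bullet> t) * h x) * solid_zonal t n x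
        - (real n * h x) * solid_zonal t (n - 1) x \<partial>sphere_measure)"
      by (intro Bochner_Integration.integral_cong) (auto simp: norm_eq_1)
    also have "\<dots> = L2_inner (\<lambda>x. real (2 * n + 1) * ((x \<bullet> t) * h x)) (solid_zonal t n)
       - L2_inner (\<lambda>x. real n * h x) (solid_zonal t (n - 1))"
      unfolding L2_inner_def
      by (intro Bochner_Integration.integral_diff integrable_sphere_polynomial) (simp_all add: ph)
    finally show ?thesis .
  qed
  also have "L2_inner (\<lambda>x. real n * h x) (solid_zonal t (n - 1)) = 0"
    unfolding L2_inner_cmult using solid_harmonics_orthogonal[OF Suc.prems zz[of "n - 1"]] by (cases n) auto
  also have "L2_inner (\<lambda>x. real (2 * n + 1) * ((x \<bullet> t) * h x)) (solid_zonal t n)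
     = real (2 * n + 1) * L2_inner (\<lambda>x. ?H x + 1 / (2 * real n + 3) * ?g x) (solid_zonal t n)"
    unfolding L2_inner_cmult by (intro arg_cong2[of _ _ _ _ times] refl L2_inner_cong) (simp add: norm_eq_1)
  also have "L2_inner (\<lambda>x. ?H x + 1 / (2 * real n + 3) * ?g x) (solid_zonal t n)
     = L2_inner ?H (solid_zonal t n) + 1 / (2 * real n + 3) * L2_inner ?g (solid_zonal t n)"
    unfolding L2_inner_cmult[symmetric] by (intro L2_inner_polynomial_linear) (simp_all add: ph)
  also have "L2_inner ?H (solid_zonal t n) = 0"
    by (rule solid_harmonics_orthogonal[OF solid_harmonic_times_coordinate[OF Suc.prems] zz]) simp
  also have "L2_inner ?g (solid_zonal t n) = 4 * pi / (2 * real n + 1) * ?g t"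
    by (rule Suc.IH) (rule solid_harmonic_dir_deriv[OF Suc.prems])
  also have "?g t = real (Suc n) * h t" by (rule solid_harmonicD(2)[OF Suc.prems])
  finally have "real (Suc n) * L2_inner h (solid_zonal t (Suc n)) = real (2 * n + 1) *
    (0 + 1 / (2 * real n + 3) * (4 * pi / (2 * real n + 1) * (real (Suc n) * h t))) - 0" .
  also have "\<dots> = real (Suc n) * (4 * pi / (2 * real (Suc n) + 1) * h t)"
  proof -
    have "a * (0 + 1 / b * (4 * pi / a * (s * y))) - 0 = s * (4 * pi / b * y)" if "a \<noteq> 0" for a b s y :: real
      using that by simp
    from this[of "real (2 * n + 1)" "2 * real n + 3"] show ?thesis by (simp add: add.commute)
  qed
  finally have "real (Suc n) * L2_inner h (solid_zonal t (Suc n))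
      = real (Suc n) * (4 * pi / (2 * real (Suc n) + 1) * h t)" .
  then show ?case by (simp only: mult_cancel_left of_nat_eq_0_iff) simp
qed

text \<open>
  Each linear form that is moved to \<open>h\<close> splits it into harmonics whose degree differs by one. With
  fewer factors than the degree of \<open>h\<close>, degree 0 is never reached, and harmonics of positive degree
  have integral zero. Monomials are products of the linear forms \<open>x \<bullet> e\<^sub>i\<close>.
\<close>

lemma L2_inner_linear_forms_solid_harmonic:
  assumes "solid_harmonic n h" "length as < n"
  shows "L2_inner (\<lambda>x. \<Prod>a\<leftarrow>as. x \<bullet> a) h = 0"
  using assms
proof (induction as arbitrary: h n)
  case Nil
  have "L2_inner (\<lambda>x. 1) h = 0"
    using Nil by (intro solid_harmonics_orthogonal[OF solid_harmonic_const Nil(1)]) auto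
  then show ?case by simp
next
  case (Cons a as)
  obtain m where n: "n = Suc m" using Cons.prems by (cases n) auto
  note h = Cons.prems(1)[unfolded n]
  let ?p = "\<lambda>x. \<Prod>a\<leftarrow>as. x \<bullet> a"
  let ?g = "dir_deriv a h"
  let ?H = "\<lambda>x. (x \<bullet> a) * h x - (x \<bullet> x) * ?g x / (2 * real m + 3)"
  have pp: "real_polynomial_function (\<lambda>x. \<Prod>a\<leftarrow>bs. x \<bullet> a)" for bs :: "(real^3) list"
    by (induction bs) auto
  have ph: "real_polynomial_function h" by (rule solid_harmonicD(1)[OF h])
  have "L2_inner (\<lambda>x. \<Prod>a\<leftarrow>a # as. x \<bullet> a) h = L2_inner (\<lambda>x. ?H x + 1 / (2 * real m + 3) * ?g x) ?p"
    by (intro L2_inner_cong) (simp add: norm_eq_1)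
  also have "\<dots> = L2_inner ?H ?p + 1 / (2 * real m + 3) * L2_inner ?g ?p"
    unfolding L2_inner_cmult[symmetric] by (intro L2_inner_polynomial_linear) (simp_all add: ph pp)
  also have "L2_inner ?H ?p = 0"
    using Cons.IH[OF solid_harmonic_times_coordinate[OF h, of a]] Cons.prems n by (simp add: L2_inner_commute)
  also have "L2_inner ?g ?p = 0"
    using Cons.IH[OF solid_harmonic_dir_deriv[OF h, of a]] Cons.prems n by (simp add: L2_inner_commute)
  finally show ?case by simp
qed

lemma L2_inner_poly_degree_le:
  assumes h: "solid_harmonic l h" and p: "poly_degree_le n p" and "n < l"
  shows "L2_inner h p = 0"
proof -
  obtain c where c: "\<And>x. p x = (\<Sum>(i, j, k) \<in> {(i, j, k). i + j + k \<le> n}.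
      c i j k * x$1 ^ i * x$2 ^ j * x$3 ^ k)"
    using p unfolding poly_degree_le_def by blast
  let ?m = "\<lambda>(i, j, k) x. c i j k * x$1 ^ i * x$2 ^ j * x$3 ^ k"
  have pr: "prod_list (replicate i (a::real)) = a ^ i" for i a by (induction i) auto
  have "L2_inner h p = (\<integral>x. (\<Sum>m\<in>{(i, j, k). i + j + k \<le> n}. ?m m x * h x) \<partial>sphere_measure)"
    unfolding L2_inner_def c sum_distrib_right[symmetric] by (simp add: mult.commute case_prod_unfold)
  also have "\<dots> = (\<Sum>m\<in>{(i, j, k). i + j + k \<le> n}. \<integral>x. ?m m x * h x \<partial>sphere_measure)"
    using solid_harmonicD(1)[OF h]
    by (intro Bochner_Integration.integral_sum integrable_sphere_polynomial)
       (auto intro!: real_polynomial_function_monomial real_polynomial_function.intros(4) simp: case_prod_unfold)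
  also have "\<dots> = 0"
  proof (intro sum.neutral ballI, clarify)
    fix i j k assume le: "i + j + k \<le> n"
    have "(\<integral>x. c i j k * x$1 ^ i * x$2 ^ j * x$3 ^ k * h x \<partial>sphere_measure)
      = c i j k * L2_inner (\<lambda>x. \<Prod>a\<leftarrow>replicate i e1 @ replicate j e2 @ replicate k e3. x \<bullet> a) h"
      by (simp add: L2_inner_def map_replicate pr inner_axis mult.assoc)
    also have "\<dots> = 0"
      using le \<open>n < l\<close> by (subst L2_inner_linear_forms_solid_harmonic[OF h]) auto
    finally show "(\<integral>x. c i j k * x$1 ^ i * x$2 ^ j * x$3 ^ k * h x \<partial>sphere_measure) = 0" .
  qed
  finally show ?thesis .
qed

section \<open>The addition theorem\<close>

text \<open>
  The difference \<open>g\<^sub>t\<close> between the zonal kernel at \<open>t\<close> and \<open>\<Sum>\<^sub>m Y\<^sub>l\<^sub>m(t) Y\<^sub>l\<^sub>m\<close> is a harmonic that is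
  orthogonal to all \<open>Y\<^sub>l\<^sub>m\<close>, so \<open>\<langle>g\<^sub>t, g\<^sub>s\<rangle> = g\<^sub>t(s)\<close> by the reproducing property. In particular
  \<open>g\<^sub>t(t) = \<parallel>g\<^sub>t\<parallel>\<^sup>2 \<ge> 0\<close>. Since \<open>g\<^sub>t(t) = (2l+1)/(4\<pi>) - \<Sum>\<^sub>m Y\<^sub>l\<^sub>m(t)\<^sup>2\<close>, the integral of the diagonal is
  \<open>(2l+1) - (2l+1)\<close>, because there are \<open>2l+1\<close> normalised functions. So \<open>g\<^sub>s = 0\<close> for almost every
  \<open>s\<close>; then \<open>g\<^sub>t(s) = \<langle>g\<^sub>t, g\<^sub>s\<rangle> = 0\<close> for almost every \<open>s\<close>, and the reproducing property extends this to
  every \<open>s\<close>.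
\<close>

lemma spherical_harmonics_addition_theorem:
  assumes Y: "real_spherical_harmonics Y" and s: "s \<in> S2" and t: "t \<in> S2"
  shows "(\<Sum>m=-int l..int l. Y l m s * Y l m t) = (2 * real l + 1) / (4 * pi) * legendre l (s \<bullet> t)"
proof -
  define I where "I = {-int l..int l}"
  have I: "finite I" "card I = 2 * l + 1" by (simp_all add: I_def)
  define c where "c = (2 * real l + 1) / (4 * pi)"
  have "\<forall>m\<in>I. \<exists>p. solid_harmonic l p \<and> (\<forall>s\<in>S2. Y l m s = p s)"
    using Y solid_harmonic_homogeneous_poly unfolding real_spherical_harmonics_def I_def by blast
  then obtain p where "\<forall>m\<in>I. solid_harmonic l (p m) \<and> (\<forall>s\<in>S2. Y l m s = p m s)"
    by (rule bchoice[THEN exE])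
  then have p: "m \<in> I \<Longrightarrow> solid_harmonic l (p m)" "m \<in> I \<Longrightarrow> s \<in> S2 \<Longrightarrow> Y l m s = p m s" for m s
    by auto
  have orth: "L2_inner (p m) (p m') = (if m = m' then 1 else 0)" if "m \<in> I" "m' \<in> I" for m m'
  proof -
    have "L2_inner (p m) (p m') = L2_inner (Y l m) (Y l m')"
      using that by (intro L2_inner_cong) (simp add: p(2))
    then show ?thesis using Y that by (simp add: real_spherical_harmonics_def I_def)
  qed
  define K where "K t x = c * solid_zonal t l x" for t x
  have norm1: "t \<bullet> t = 1" if "t \<in> S2" for t :: "real^3" using that by (simp add: norm_eq_1)
  have K: "solid_harmonic l (K t)" if "t \<in> S2" for t
    unfolding K_def[abs_def] by (intro solid_harmonic_cmult solid_harmonic_solid_zonal norm1 that)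
  have repr: "L2_inner h (K t) = h t" if "solid_harmonic l h" "t \<in> S2" for h t
  proof -
    have "L2_inner h (K t) = c * L2_inner h (solid_zonal t l)"
      by (simp add: L2_inner_def K_def mult.left_commute)
    then show ?thesis
      using L2_inner_solid_zonal[OF norm1[OF that(2)] that(1)] by (simp add: c_def add_nonneg_eq_0_iff)
  qed
  (* the part of the zonal kernel that the given harmonics do not capture *)
  define g where "g t x = K t x - (\<Sum>m\<in>I. p m t * p m x)" for t x
  have gh: "solid_harmonic l (g t)" if "t \<in> S2" for t
    unfolding g_def[abs_def]
    by (intro solid_harmonic_diff solid_harmonic_sum solid_harmonic_cmult K that p(1))
  have sumh: "solid_harmonic l (\<lambda>x. \<Sum>m\<in>I. p m t * p m x)" for t
    by (intro solid_harmonic_sum solid_harmonic_cmult p(1))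
  have int: "integrable sphere_measure (\<lambda>x. f x * h x)" if "solid_harmonic l f" "solid_harmonic l h" for f h
    using that by (intro integrable_sphere_polynomial) (simp add: solid_harmonicD(1))
  have inner_g: "L2_inner h (g t) = h t - (\<Sum>m\<in>I. p m t * L2_inner h (p m))"
    if h: "solid_harmonic l h" and t: "t \<in> S2" for h t
  proof -
    have "L2_inner h (g t) = L2_inner h (K t) - L2_inner h (\<lambda>x. \<Sum>m\<in>I. p m t * p m x)"
      unfolding L2_inner_def g_def right_diff_distrib
      by (intro Bochner_Integration.integral_diff int h K t sumh)
    also have "L2_inner h (\<lambda>x. \<Sum>m\<in>I. p m t * p m x) = (\<Sum>m\<in>I. L2_inner h (\<lambda>x. p m t * p m x))"
      unfolding L2_inner_def sum_distrib_left
      by (intro Bochner_Integration.integral_sum int h solid_harmonic_cmult p(1))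
    also have "\<dots> = (\<Sum>m\<in>I. p m t * L2_inner h (p m))"
      by (simp add: L2_inner_def mult.left_commute[of "h _"])
    finally show ?thesis by (simp only: repr[OF h t])
  qed
  have gp: "L2_inner (g t) (p m) = 0" if "t \<in> S2" "m \<in> I" for t m
  proof -
    have "L2_inner (p m) (g t) = p m t - (\<Sum>m'\<in>I. p m' t * (if m = m' then 1 else 0))"
      using that by (simp add: inner_g p(1) orth cong: sum.cong)
    also have "\<dots> = 0" using that by (simp add: I if_distrib[of "(*) _"] cong: if_cong)
    finally show ?thesis by (simp add: L2_inner_commute)
  qed
  have gg: "L2_inner (g t) (g s) = g t s" if "t \<in> S2" "s \<in> S2" for s t
    using that by (simp add: inner_g[OF gh] gp)
  have diag: "g t t = c - (\<Sum>m\<in>I. p m t * p m t)" if "t \<in> S2" for t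
    using that solid_zonal_legendre[of t t l] by (simp add: g_def K_def norm1 legendre_1)
  have nonneg: "0 \<le> g t t" if "t \<in> S2" for t
    unfolding gg[OF that that, symmetric] L2_inner_def by simp
  have intd: "integrable sphere_measure (\<lambda>t. c - (\<Sum>m\<in>I. p m t * p m t))"
  proof -
    interpret finite_measure sphere_measure by (rule finite_measure_sphere_measure)
    show ?thesis by (intro Bochner_Integration.integrable_diff Bochner_Integration.integrable_sum int p(1)) auto
  qed
  have "(\<integral>t. c - (\<Sum>m\<in>I. p m t * p m t) \<partial>sphere_measure) = c * (4 * pi) - (\<Sum>m\<in>I. L2_inner (p m) (p m))"
  proof -
    interpret finite_measure sphere_measure by (rule finite_measure_sphere_measure)
    have "(\<integral>t. c - (\<Sum>m\<in>I. p m t * p m t) \<partial>sphere_measure)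
        = (\<integral>t. c \<partial>sphere_measure) - (\<integral>t. (\<Sum>m\<in>I. p m t * p m t) \<partial>sphere_measure)"
      by (intro Bochner_Integration.integral_diff Bochner_Integration.integrable_sum int p(1)) auto
    also have "(\<integral>t. (\<Sum>m\<in>I. p m t * p m t) \<partial>sphere_measure) = (\<Sum>m\<in>I. L2_inner (p m) (p m))"
      unfolding L2_inner_def by (intro Bochner_Integration.integral_sum int p(1))
    finally show ?thesis by (simp add: measure_sphere_measure mult.commute)
  qed
  also have "\<dots> = 0" by (simp add: orth c_def I)
  finally have "AE t in sphere_measure. c - (\<Sum>m\<in>I. p m t * p m t) = 0"
    using nonneg diag by (subst (asm) integral_nonneg_eq_0_iff_AE[OF intd]) auto
  then have ae: "AE t in sphere_measure. g t t = 0"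
    by (rule AE_mp) (intro AE_I2, simp add: diag)
  have ae0: "AE s in sphere_measure. g t s = 0" if t: "t \<in> S2" for t
  proof (rule AE_mp[OF ae], rule AE_I2, rule impI)
    fix s assume "s \<in> space sphere_measure" and gs: "g s s = 0"
    then have s: "s \<in> S2" by simp
    have "(\<integral>x. g s x * g s x \<partial>sphere_measure) = 0"
      using gg[OF s s] gs by (simp add: L2_inner_def)
    then have "AE x in sphere_measure. g s x * g s x = 0"
      by (subst (asm) integral_nonneg_eq_0_iff_AE[OF int[OF gh[OF s] gh[OF s]]]) auto
    then have "AE x in sphere_measure. g t x * g s x = 0" by (rule AE_mp) simp
    then have "L2_inner (g t) (g s) = 0" unfolding L2_inner_def by (rule integral_eq_zero_AE)
    then show "g t s = 0" using gg[OF t s] by simp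
  qed
  have "AE x in sphere_measure. g t x * K s x = 0"
    using ae0[OF t] by (rule AE_mp) simp
  then have "L2_inner (g t) (K s) = 0" unfolding L2_inner_def by (rule integral_eq_zero_AE)
  then have "g t s = 0" using repr[OF gh[OF t] s] by simp
  then show ?thesis
    using s t solid_zonal_legendre[OF s, of t l]
    by (simp add: g_def K_def c_def p(2) mult.commute flip: I_def)
qed

text \<open>
  The values of an orthonormal basis at \<open>s\<close> and at \<open>t\<close> form two vectors of the same length, so their
  inner product is at most that squared length.
\<close>

lemma abs_legendre_le_1:
  assumes Y: "real_spherical_harmonics Y" and s: "s \<in> S2" and t: "t \<in> S2"
  shows "\<bar>legendre l (s \<bullet> t)\<bar> \<le> 1"
proof -
  let ?I = "{-int l..int l}"
  define c where "c = (2 * real l + 1) / (4 * pi)"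
  have c: "c > 0" by (simp add: c_def add_nonneg_pos)
  have sq: "(\<Sum>m\<in>?I. (Y l m x)\<^sup>2) = c" if "x \<in> S2" for x
    using spherical_harmonics_addition_theorem[OF Y that that, of l] that
    by (simp add: c_def power2_eq_square norm_eq_1 legendre_1)
  have "\<bar>c * legendre l (s \<bullet> t)\<bar> = \<bar>\<Sum>m\<in>?I. Y l m s * Y l m t\<bar>"
    using spherical_harmonics_addition_theorem[OF Y s t, of l] by (simp add: c_def)
  also have "\<dots> \<le> (\<Sum>m\<in>?I. \<bar>Y l m s * Y l m t\<bar>)" by (rule sum_abs)
  also have "\<dots> \<le> (\<Sum>m\<in>?I. ((Y l m s)\<^sup>2 + (Y l m t)\<^sup>2) / 2)"
  proof (rule sum_mono)
    fix m
    show "\<bar>Y l m s * Y l m t\<bar> \<le> ((Y l m s)\<^sup>2 + (Y l m t)\<^sup>2) / 2"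
      using sum_squares_bound[of "\<bar>Y l m s\<bar>" "\<bar>Y l m t\<bar>"] by (simp add: abs_mult)
  qed
  also have "\<dots> = c" by (simp add: sq[OF s] sq[OF t] sum.distrib flip: sum_divide_distrib)
  finally show ?thesis using c by (simp add: abs_mult)
qed

section \<open>Parseval frames from kernel expansions\<close>

text \<open>
  If \<open>g\<close> lies in the reproducing kernel Hilbert space, this is its inner product with the finite
  combination of kernel sections that has the coefficients \<open>c\<close>.
\<close>

definition analysis_coeff :: "('s \<Rightarrow> real) \<Rightarrow> ('s \<Rightarrow> real) \<Rightarrow> real" where
  "analysis_coeff c g = (\<Sum>s | c s \<noteq> 0. c s * g s)"

lemma has_sum_finite_sum:
  fixes f :: "'b \<Rightarrow> 'a \<Rightarrow> real"
  assumes "finite F" "\<And>x. x \<in> F \<Longrightarrow> (f x has_sum s x) I"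
  shows "((\<lambda>i. \<Sum>x\<in>F. f x i) has_sum (\<Sum>x\<in>F. s x)) I"
  using assms by (induction F rule: finite_induct) (auto intro: has_sum_add)

text \<open>
  An expansion of the kernel on the product of \<open>S\<close> with itself is Parseval's identity for the kernel
  sections, polarised. Positive semidefiniteness of the kernel is part of this identity.
\<close>

locale kernel_expansion =
  fixes S :: "'s set" and K :: "'s \<Rightarrow> 's \<Rightarrow> real" and I :: "'i set" and \<phi> :: "'i \<Rightarrow> 's \<Rightarrow> real"
  assumes expansion: "\<And>s t. s \<in> S \<Longrightarrow> t \<in> S \<Longrightarrow> ((\<lambda>i. \<phi> i s * \<phi> i t) has_sum K s t) I"
begin

lemma analysis_parseval:
  assumes c: "c \<in> fin_coeffs S" and d: "d \<in> fin_coeffs S"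
  shows "((\<lambda>i. analysis_coeff c (\<phi> i) * analysis_coeff d (\<phi> i)) has_sum kernel_form K c d) I"
proof -
  have "((\<lambda>i. \<Sum>s | c s \<noteq> 0. \<Sum>t | d t \<noteq> 0. c s * d t * (\<phi> i s * \<phi> i t)) has_sum kernel_form K c d) I"
    unfolding kernel_form_def using c d
    by (intro has_sum_finite_sum has_sum_cmult_right expansion) (auto simp: fin_coeffs_def)
  moreover have "(\<Sum>s | c s \<noteq> 0. \<Sum>t | d t \<noteq> 0. c s * d t * (\<phi> i s * \<phi> i t))
      = analysis_coeff c (\<phi> i) * analysis_coeff d (\<phi> i)" for i
    by (simp add: analysis_coeff_def sum_product mult_ac)
  ultimately show ?thesis by simp
qed

lemma psd_kernel: "psd_kernel_on S K"
  unfolding psd_kernel_on_def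
proof (intro conjI ballI)
  show "K s t = K t s" if "s \<in> S" "t \<in> S" for s t
    using has_sum_unique[OF expansion[OF that] expansion[OF that(2,1), unfolded mult.commute[of "\<phi> _ t"]]] .
  show "0 \<le> kernel_form K c c" if "c \<in> fin_coeffs S" for c
    using analysis_parseval[OF that that] by (rule has_sum_nonneg) simp
qed

lemma kernel_form_tendsto_analysis:
  assumes d: "rkhs_approx S K d (\<phi> i)" and c: "c \<in> fin_coeffs S"
  shows "(\<lambda>n. kernel_form K c (d n)) \<longlonglongrightarrow> analysis_coeff c (\<phi> i)"
proof -
  have "(\<lambda>n. kernel_form K (d n) c) \<longlonglongrightarrow> analysis_coeff c (\<phi> i)"
    unfolding kernel_form_comb analysis_coeff_def using c
    by (intro tendsto_sum tendsto_mult tendsto_const rkhs_approxD(3)[OF d]) (auto simp: fin_coeffs_def)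
  then show ?thesis
    by (simp add: kernel_form_commute[OF psd_kernel c rkhs_approxD(1)[OF d]])
qed

text \<open>
  Both limits are limits of \<open>kernel_form K (c n) (d m)\<close>: for fixed \<open>n\<close> along \<open>m\<close>, and along the
  diagonal. They agree because, by the Cauchy-Schwarz inequality, the form varies little in \<open>n\<close>,
  uniformly in \<open>m\<close>.
\<close>

lemma analysis_tendsto_inner:
  assumes f: "rkhs_approx S K c f" and \<phi>: "\<phi> i \<in> rkhs S K"
  shows "(\<lambda>n. analysis_coeff (c n) (\<phi> i)) \<longlonglongrightarrow> rkhs_inner S K f (\<phi> i)"
proof -
  obtain d where d: "rkhs_approx S K d (\<phi> i)" using \<phi> by (auto simp: rkhs_def)
  note fc = rkhs_approxD(1)[OF f] and fd = rkhs_approxD(1)[OF d]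
  obtain B where B: "\<And>n. sqrt (kernel_form K (d n) (d n)) \<le> B"
    using rkhs_approx_bounded[OF psd_kernel d] by blast
  have "0 \<le> sqrt (kernel_form K (d 0) (d 0))"
    using psd_kernel fd by (simp add: psd_kernel_on_def)
  then have B0: "B \<ge> 0" using B[of 0] by linarith
  show ?thesis
  proof (rule LIMSEQ_I)
    fix e :: real assume e: "e > 0"
    define \<delta> where "\<delta> = e / (2 * (B + 1))"
    have \<delta>: "\<delta> > 0" using e B0 by (simp add: \<delta>_def)
    obtain n0 where n0: "\<forall>m\<ge>n0. \<forall>n\<ge>n0.
        sqrt (kernel_form K (\<lambda>s. c m s - c n s) (\<lambda>s. c m s - c n s)) < \<delta>"
      using rkhs_approxD(2)[OF f \<delta>] by blast
    have half: "\<bar>analysis_coeff (c n) (\<phi> i) - rkhs_inner S K f (\<phi> i)\<bar> \<le> e / 2" if n: "n \<ge> n0" for n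
    proof (rule tendsto_upperbound)
      show "(\<lambda>m. \<bar>kernel_form K (c n) (d m) - kernel_form K (c m) (d m)\<bar>)
          \<longlonglongrightarrow> \<bar>analysis_coeff (c n) (\<phi> i) - rkhs_inner S K f (\<phi> i)\<bar>"
        by (intro tendsto_rabs tendsto_diff kernel_form_tendsto_analysis[OF d fc]
              rkhs_inner_tendsto[OF psd_kernel f d])
      have "\<bar>kernel_form K (c n) (d m) - kernel_form K (c m) (d m)\<bar> \<le> e / 2" if m: "m \<ge> n0" for m
      proof -
        have "\<bar>kernel_form K (c n) (d m) - kernel_form K (c m) (d m)\<bar>
            = \<bar>kernel_form K (\<lambda>s. c n s - c m s) (d m)\<bar>"
          by (simp add: kernel_form_diff(1)[OF fc fc fd])
        also have "\<dots> \<le> sqrt (kernel_form K (\<lambda>s. c n s - c m s) (\<lambda>s. c n s - c m s)) *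
            sqrt (kernel_form K (d m) (d m))"
          by (rule kernel_form_Cauchy_Schwarz[OF psd_kernel fin_coeffs_diff[OF fc fc] fd])
        also have "\<dots> \<le> \<delta> * (B + 1)"
          using n0 m n B[of m] \<delta> B0 psd_kernel fd[of m]
          by (intro mult_mono) (auto simp: psd_kernel_on_def intro: less_imp_le)
        also have "\<dots> = e / 2" using B0 by (simp add: \<delta>_def field_simps add_nonneg_eq_0_iff)
        finally show ?thesis .
      qed
      then show "\<forall>\<^sub>F m in sequentially. \<bar>kernel_form K (c n) (d m) - kernel_form K (c m) (d m)\<bar> \<le> e / 2"
        unfolding eventually_sequentially by blast
    qed simp
    have "norm (analysis_coeff (c n) (\<phi> i) - rkhs_inner S K f (\<phi> i)) < e" if "n \<ge> n0" for n
      using half[OF that] e by simp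
    then show "\<exists>n0. \<forall>n\<ge>n0. norm (analysis_coeff (c n) (\<phi> i) - rkhs_inner S K f (\<phi> i)) < e"
      by blast
  qed
qed

lemma analysis_coeff_diff:
  assumes "c \<in> fin_coeffs S" "d \<in> fin_coeffs S"
  shows "analysis_coeff (\<lambda>s. c s - d s) g = analysis_coeff c g - analysis_coeff d g"
proof -
  define F where "F = {s. c s \<noteq> 0} \<union> {s. d s \<noteq> 0}"
  have F: "finite F" using assms by (auto simp: F_def fin_coeffs_def)
  have sup: "analysis_coeff e g = (\<Sum>s\<in>F. e s * g s)" if "{s. e s \<noteq> 0} \<subseteq> F" for e
    unfolding analysis_coeff_def using F that by (intro sum.mono_neutral_left) auto
  have "{s. c s - d s \<noteq> 0} \<subseteq> F" "{s. c s \<noteq> 0} \<subseteq> F" "{s. d s \<noteq> 0} \<subseteq> F"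
    by (auto simp: F_def)
  then show ?thesis by (simp add: sup left_diff_distrib sum_subtractf)
qed

lemma L2_set_analysis_tendsto:
  assumes c: "c \<in> fin_coeffs S"
  shows "(L2_set (\<lambda>i. analysis_coeff c (\<phi> i)) \<longlongrightarrow> sqrt (kernel_form K c c)) (finite_subsets_at_top I)"
  unfolding L2_set_def[abs_def] using analysis_parseval[OF c c]
  by (intro tendsto_real_sqrt) (simp add: has_sum_def power2_eq_square)

lemma L2_set_analysis_le:
  assumes c: "c \<in> fin_coeffs S" and F: "finite F" "F \<subseteq> I"
  shows "L2_set (\<lambda>i. analysis_coeff c (\<phi> i)) F \<le> sqrt (kernel_form K c c)"
  unfolding L2_set_def using finite_sum_le_has_sum[OF analysis_parseval[OF c c] F]
  by (simp add: power2_eq_square)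

text \<open>
  Let \<open>c n\<close> approximate \<open>f\<close>. For combinations of kernel sections the norms of the truncated coefficient
  sequences increase to the norm of the combination. The truncated norms of \<open>c n\<close> tend to those of
  \<open>f\<close> uniformly in the truncation, since the analysis map does not increase norms; so the limits over
  \<open>n\<close> and over the truncation may be interchanged.
\<close>

theorem parseval_frame_rkhs:
  assumes "countable I" and \<phi>: "\<And>i. i \<in> I \<Longrightarrow> \<phi> i \<in> rkhs S K"
  shows "parseval_frame (rkhs S K) (rkhs_inner S K) I \<phi>"
  unfolding parseval_frame_def
proof (intro conjI ballI)
  fix f assume "f \<in> rkhs S K"
  then obtain c where f: "rkhs_approx S K c f" by (auto simp: rkhs_def)
  note fc = rkhs_approxD(1)[OF f]
  define a where "a i = rkhs_inner S K f (\<phi> i)" for i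
  let ?A = "\<lambda>n i. analysis_coeff (c n) (\<phi> i)"
  let ?Q = "\<lambda>n. sqrt (kernel_form K (c n) (c n))"
  have lim: "(\<lambda>n. ?A n i) \<longlonglongrightarrow> a i" if "i \<in> I" for i
    unfolding a_def by (rule analysis_tendsto_inner[OF f \<phi>[OF that]])
  have Qlim: "?Q \<longlonglongrightarrow> sqrt (rkhs_inner S K f f)"
    by (intro tendsto_real_sqrt rkhs_inner_tendsto[OF psd_kernel f f])
  have unif: "uniform_limit {F. finite F \<and> F \<subseteq> I} (\<lambda>n. L2_set (?A n)) (L2_set a) sequentially"
  proof (rule uniform_limitI)
    fix e :: real assume e: "e > 0"
    then obtain n0 where n0: "\<forall>m\<ge>n0. \<forall>n\<ge>n0.
        sqrt (kernel_form K (\<lambda>s. c m s - c n s) (\<lambda>s. c m s - c n s)) < e / 2"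
      using rkhs_approxD(2)[OF f, of "e / 2"] by auto
    have "dist (L2_set (?A n) F) (L2_set a F) < e" if n: "n \<ge> n0" and F: "finite F" "F \<subseteq> I" for n F
    proof -
      have "L2_set (\<lambda>i. ?A n i - a i) F \<le> e / 2"
      proof (rule tendsto_upperbound)
        show "(\<lambda>m. L2_set (\<lambda>i. ?A n i - ?A m i) F) \<longlonglongrightarrow> L2_set (\<lambda>i. ?A n i - a i) F"
          unfolding L2_set_def using F
          by (intro tendsto_real_sqrt tendsto_sum tendsto_power tendsto_diff tendsto_const lim) auto
        have "L2_set (\<lambda>i. ?A n i - ?A m i) F \<le> e / 2" if "m \<ge> n0" for m
          using L2_set_analysis_le[OF fin_coeffs_diff[OF fc[of n] fc[of m]] F] n0 n that
          by (fastforce simp: analysis_coeff_diff[OF fc fc])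
        then show "\<forall>\<^sub>F m in sequentially. L2_set (\<lambda>i. ?A n i - ?A m i) F \<le> e / 2"
          unfolding eventually_sequentially by blast
      qed simp
      moreover have "L2_set (?A n) F \<le> L2_set a F + L2_set (\<lambda>i. ?A n i - a i) F"
        using L2_set_triangle_ineq[of a "\<lambda>i. ?A n i - a i" F] by simp
      moreover have "L2_set a F \<le> L2_set (?A n) F + L2_set (\<lambda>i. ?A n i - a i) F"
      proof -
        have "L2_set (\<lambda>i. a i - ?A n i) F = L2_set (\<lambda>i. ?A n i - a i) F"
          by (simp add: L2_set_def power2_commute)
        then show ?thesis using L2_set_triangle_ineq[of "?A n" "\<lambda>i. a i - ?A n i" F] by simp
      qed
      ultimately show ?thesis using e by (simp add: dist_real_def)
    qed
    then show "\<forall>\<^sub>F n in sequentially. \<forall>F\<in>{F. finite F \<and> F \<subseteq> I}. dist (L2_set (?A n) F) (L2_set a F) < e"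
      unfolding eventually_sequentially by blast
  qed
  have "(L2_set a \<longlongrightarrow> sqrt (rkhs_inner S K f f)) (finite_subsets_at_top I)"
  proof (rule swap_uniform_limit'[OF _ Qlim unif])
    show "\<forall>\<^sub>F n in sequentially. (L2_set (?A n) \<longlongrightarrow> ?Q n) (finite_subsets_at_top I)"
      by (intro always_eventually allI L2_set_analysis_tendsto fc)
    show "\<forall>\<^sub>F F in finite_subsets_at_top I. F \<in> {F. finite F \<and> F \<subseteq> I}"
      by (intro eventually_finite_subsets_at_top_weakI) auto
  qed simp
  then have "((\<lambda>F. (L2_set a F)\<^sup>2) \<longlongrightarrow> (sqrt (rkhs_inner S K f f))\<^sup>2) (finite_subsets_at_top I)"
    by (rule tendsto_power)
  moreover have "rkhs_inner S K f f \<ge> 0"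
  proof (rule LIMSEQ_le_const[OF rkhs_inner_tendsto[OF psd_kernel f f]])
    show "\<exists>N. \<forall>n\<ge>N. 0 \<le> kernel_form K (c n) (c n)"
      using psd_kernel fc by (auto simp: psd_kernel_on_def)
  qed
  ultimately have "((\<lambda>F. \<Sum>i\<in>F. (a i)\<^sup>2) \<longlongrightarrow> rkhs_inner S K f f) (finite_subsets_at_top I)"
    by (simp add: L2_set_def sum_nonneg)
  then show "((\<lambda>i. \<bar>rkhs_inner S K f (\<phi> i)\<bar>\<^sup>2) has_sum rkhs_inner S K f f) I"
    by (simp add: has_sum_def a_def)
qed (use assms in auto)

end

section \<open>The covariance kernel\<close>

lemma integrable_mult_of_squares:
  fixes f g :: "'a \<Rightarrow> real"
  assumes [measurable]: "f \<in> borel_measurable M" "g \<in> borel_measurable M"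
    and "integrable M (\<lambda>x. (f x)\<^sup>2)" "integrable M (\<lambda>x. (g x)\<^sup>2)"
  shows "integrable M (\<lambda>x. f x * g x)"
proof (rule Bochner_Integration.integrable_bound)
  show "integrable M (\<lambda>x. (f x)\<^sup>2 + (g x)\<^sup>2)" using assms by simp
  have "\<bar>f x * g x\<bar> \<le> (f x)\<^sup>2 + (g x)\<^sup>2" for x
  proof -
    have "0 \<le> \<bar>f x\<bar> * \<bar>g x\<bar>" by simp
    moreover have "2 * \<bar>f x\<bar> * \<bar>g x\<bar> \<le> (f x)\<^sup>2 + (g x)\<^sup>2"
      using sum_squares_bound[of "\<bar>f x\<bar>" "\<bar>g x\<bar>"] by simp
    ultimately show ?thesis unfolding abs_mult by linarith
  qed
  then show "AE x in M. norm (f x * g x) \<le> norm ((f x)\<^sup>2 + (g x)\<^sup>2)" by simp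
qed simp

lemma abs_integral_mult_le:
  fixes f g :: "'a \<Rightarrow> real"
  assumes [measurable]: "f \<in> borel_measurable M" "g \<in> borel_measurable M"
    and f: "integrable M (\<lambda>x. (f x)\<^sup>2)" and g: "integrable M (\<lambda>x. (g x)\<^sup>2)"
  shows "\<bar>\<integral>x. f x * g x \<partial>M\<bar> \<le> sqrt (\<integral>x. (f x)\<^sup>2 \<partial>M) * sqrt (\<integral>x. (g x)\<^sup>2 \<partial>M)"
proof -
  have fg: "integrable M (\<lambda>x. \<bar>f x\<bar> * \<bar>g x\<bar>)"
    using integrable_mult_of_squares[OF assms] by (simp flip: abs_mult)
  have "ennreal ((\<integral>x. \<bar>f x\<bar> * \<bar>g x\<bar> \<partial>M)\<^sup>2) = (\<integral>\<^sup>+x. ennreal \<bar>f x\<bar> * ennreal \<bar>g x\<bar> \<partial>M)\<^sup>2"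
    using nn_integral_eq_integral[OF fg] by (simp add: ennreal_mult ennreal_power)
  also have "\<dots> \<le> (\<integral>\<^sup>+x. (ennreal \<bar>f x\<bar>)\<^sup>2 \<partial>M) * (\<integral>\<^sup>+x. (ennreal \<bar>g x\<bar>)\<^sup>2 \<partial>M)"
    by (rule Cauchy_Schwarz_nn_integral) auto
  also have "\<dots> = ennreal ((\<integral>x. (f x)\<^sup>2 \<partial>M) * (\<integral>x. (g x)\<^sup>2 \<partial>M))"
    using nn_integral_eq_integral[OF f] nn_integral_eq_integral[OF g] by (simp add: ennreal_mult ennreal_power)
  finally have "(\<integral>x. \<bar>f x\<bar> * \<bar>g x\<bar> \<partial>M)\<^sup>2 \<le> (\<integral>x. (f x)\<^sup>2 \<partial>M) * (\<integral>x. (g x)\<^sup>2 \<partial>M)"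
    by (simp add: ennreal_le_iff)
  then have "(\<integral>x. \<bar>f x\<bar> * \<bar>g x\<bar> \<partial>M) \<le> sqrt ((\<integral>x. (f x)\<^sup>2 \<partial>M) * (\<integral>x. (g x)\<^sup>2 \<partial>M))"
    by (rule real_le_rsqrt)
  moreover have "\<bar>\<integral>x. f x * g x \<partial>M\<bar> \<le> (\<integral>x. \<bar>f x\<bar> * \<bar>g x\<bar> \<partial>M)"
    using integral_abs_bound[of M "\<lambda>x. f x * g x"] by (simp add: abs_mult)
  ultimately show ?thesis by (simp add: real_sqrt_mult)
qed

text \<open>
  Stated for nonnegative integrals, the hypothesis does not presuppose that the limit is square
  integrable: one index at which the distance is finite suffices for that.
\<close>

lemma L2_limit_square_integrable:
  fixes X :: "nat \<Rightarrow> 'a \<Rightarrow> real"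
  assumes X: "\<And>n. X n \<in> borel_measurable M" "\<And>n. integrable M (\<lambda>x. (X n x)\<^sup>2)"
    and Z: "Z \<in> borel_measurable M"
    and lim: "(\<lambda>n. \<integral>\<^sup>+x. ennreal ((Z x - X n x)\<^sup>2) \<partial>M) \<longlonglongrightarrow> 0"
  shows "integrable M (\<lambda>x. (Z x)\<^sup>2)"
    and "(\<lambda>n. \<integral>x. (Z x - X n x)\<^sup>2 \<partial>M) \<longlonglongrightarrow> 0"
proof -
  note [measurable] = X(1) Z
  have "\<forall>\<^sub>F n in sequentially. (\<integral>\<^sup>+x. ennreal ((Z x - X n x)\<^sup>2) \<partial>M) < 1"
    using order_tendstoD(2)[OF lim, of 1] by simp
  then obtain n where "(\<integral>\<^sup>+x. ennreal ((Z x - X n x)\<^sup>2) \<partial>M) < 1"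
    unfolding eventually_sequentially by blast
  then have D: "integrable M (\<lambda>x. (Z x - X n x)\<^sup>2)"
    by (intro integrableI_bounded) (auto intro: less_trans[OF _ ennreal_one_less_top])
  show "integrable M (\<lambda>x. (Z x)\<^sup>2)"
  proof (rule Bochner_Integration.integrable_bound)
    show "integrable M (\<lambda>x. 2 * ((Z x - X n x)\<^sup>2 + (X n x)\<^sup>2))" using D X(2) by simp
    have "(Z x)\<^sup>2 \<le> 2 * ((Z x - X n x)\<^sup>2 + (X n x)\<^sup>2)" for x
      using zero_le_power2[of "Z x - 2 * X n x"] by (simp add: power2_eq_square algebra_simps)
    then show "AE x in M. norm ((Z x)\<^sup>2) \<le> norm (2 * ((Z x - X n x)\<^sup>2 + (X n x)\<^sup>2))" by simp
  qed simp
  have "(\<lambda>n. enn2real (\<integral>\<^sup>+x. ennreal ((Z x - X n x)\<^sup>2) \<partial>M)) \<longlonglongrightarrow> 0"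
    using lim by (intro tendsto_enn2real) simp_all
  then show "(\<lambda>n. \<integral>x. (Z x - X n x)\<^sup>2 \<partial>M) \<longlonglongrightarrow> 0"
    by (simp add: integral_eq_nn_integral)
qed

text \<open>
  With \<open>D = Z - X\<^sub>n\<close> and \<open>D' = Z' - X'\<^sub>n\<close>, the product \<open>X\<^sub>n X'\<^sub>n\<close> is \<open>Z Z' - D Z' - Z D' + D D'\<close>, and the
  last three integrals vanish in the limit by the Cauchy-Schwarz inequality.
\<close>

lemma L2_limit_integral_mult:
  fixes X X' :: "nat \<Rightarrow> 'a \<Rightarrow> real"
  assumes X: "\<And>n. X n \<in> borel_measurable M" "\<And>n. integrable M (\<lambda>x. (X n x)\<^sup>2)"
    and Z: "Z \<in> borel_measurable M"
    and lim: "(\<lambda>n. \<integral>\<^sup>+x. ennreal ((Z x - X n x)\<^sup>2) \<partial>M) \<longlonglongrightarrow> 0"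
    and X': "\<And>n. X' n \<in> borel_measurable M" "\<And>n. integrable M (\<lambda>x. (X' n x)\<^sup>2)"
    and Z': "Z' \<in> borel_measurable M"
    and lim': "(\<lambda>n. \<integral>\<^sup>+x. ennreal ((Z' x - X' n x)\<^sup>2) \<partial>M) \<longlonglongrightarrow> 0"
  shows "(\<lambda>n. \<integral>x. X n x * X' n x \<partial>M) \<longlonglongrightarrow> (\<integral>x. Z x * Z' x \<partial>M)"
proof -
  note [measurable] = X(1) Z X'(1) Z'
  note L = L2_limit_square_integrable[OF X Z lim] and L' = L2_limit_square_integrable[OF X' Z' lim']
  have sqD: "integrable M (\<lambda>x. (Z x - X n x)\<^sup>2)" for n
  proof -
    have "integrable M (\<lambda>x. (Z x)\<^sup>2 - 2 * (Z x * X n x) + (X n x)\<^sup>2)"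
      using L(1) X(2) integrable_mult_of_squares[OF Z X(1) L(1) X(2)] by simp
    then show ?thesis by (simp add: power2_diff algebra_simps)
  qed
  have sqD': "integrable M (\<lambda>x. (Z' x - X' n x)\<^sup>2)" for n
  proof -
    have "integrable M (\<lambda>x. (Z' x)\<^sup>2 - 2 * (Z' x * X' n x) + (X' n x)\<^sup>2)"
      using L'(1) X'(2) integrable_mult_of_squares[OF Z' X'(1) L'(1) X'(2)] by simp
    then show ?thesis by (simp add: power2_diff algebra_simps)
  qed
  let ?D = "\<lambda>n x. Z x - X n x" and ?D' = "\<lambda>n x. Z' x - X' n x"
  have eq: "(\<integral>x. X n x * X' n x \<partial>M) = (\<integral>x. Z x * Z' x \<partial>M) - (\<integral>x. ?D n x * Z' x \<partial>M)
      - (\<integral>x. Z x * ?D' n x \<partial>M) + (\<integral>x. ?D n x * ?D' n x \<partial>M)" for n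
  proof -
    have "(\<integral>x. X n x * X' n x \<partial>M) = (\<integral>x. Z x * Z' x - ?D n x * Z' x - Z x * ?D' n x + ?D n x * ?D' n x \<partial>M)"
      by (intro Bochner_Integration.integral_cong refl) (simp add: algebra_simps)
    moreover have i: "integrable M (\<lambda>x. Z x * Z' x)" "integrable M (\<lambda>x. ?D n x * Z' x)"
       "integrable M (\<lambda>x. Z x * ?D' n x)" "integrable M (\<lambda>x. ?D n x * ?D' n x)"
      by (intro integrable_mult_of_squares L(1) L'(1) sqD sqD'; measurable)+
    ultimately show ?thesis
      by (simp only: Bochner_Integration.integral_add Bochner_Integration.integral_diff
            Bochner_Integration.integrable_diff)
  qed
  have bound0: "(\<lambda>n. \<integral>x. f n x * g n x \<partial>M) \<longlonglongrightarrow> 0"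
    if "\<And>n. f n \<in> borel_measurable M" "\<And>n. g n \<in> borel_measurable M"
      "\<And>n. integrable M (\<lambda>x. (f n x)\<^sup>2)" "\<And>n. integrable M (\<lambda>x. (g n x)\<^sup>2)"
      "(\<lambda>n. sqrt (\<integral>x. (f n x)\<^sup>2 \<partial>M) * sqrt (\<integral>x. (g n x)\<^sup>2 \<partial>M)) \<longlonglongrightarrow> 0" for f g
  proof (rule Lim_null_comparison[OF _ that(5)])
    show "\<forall>\<^sub>F n in sequentially. norm (\<integral>x. f n x * g n x \<partial>M)
        \<le> sqrt (\<integral>x. (f n x)\<^sup>2 \<partial>M) * sqrt (\<integral>x. (g n x)\<^sup>2 \<partial>M)"
      using abs_integral_mult_le[OF that(1-4)] by (intro always_eventually) simp
  qed
  have s: "(\<lambda>n. sqrt (\<integral>x. (?D n x)\<^sup>2 \<partial>M)) \<longlonglongrightarrow> 0" "(\<lambda>n. sqrt (\<integral>x. (?D' n x)\<^sup>2 \<partial>M)) \<longlonglongrightarrow> 0"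
    using tendsto_real_sqrt[OF L(2)] tendsto_real_sqrt[OF L'(2)] by simp_all
  have "(\<lambda>n. \<integral>x. ?D n x * Z' x \<partial>M) \<longlonglongrightarrow> 0"
    by (rule bound0) (use L'(1) sqD tendsto_mult_right[OF s(1)] in auto)
  moreover have "(\<lambda>n. \<integral>x. Z x * ?D' n x \<partial>M) \<longlonglongrightarrow> 0"
    by (rule bound0) (use L(1) sqD' tendsto_mult_left[OF s(2)] in auto)
  moreover have "(\<lambda>n. \<integral>x. ?D n x * ?D' n x \<partial>M) \<longlonglongrightarrow> 0"
    by (rule bound0) (use sqD sqD' tendsto_mult[OF s] in auto)
  ultimately have "(\<lambda>n. \<integral>x. X n x * X' n x \<partial>M) \<longlonglongrightarrow> (\<integral>x. Z x * Z' x \<partial>M) - 0 - 0 + 0"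
    unfolding eq by (intro tendsto_intros)
  then show ?thesis by simp
qed

lemma std_normal_moments:
  assumes M: "prob_space M" and X: "distributed M lborel X std_normal_density"
  shows "X \<in> borel_measurable M" "integrable M X" "integrable M (\<lambda>\<omega>. (X \<omega>)\<^sup>2)"
    "(\<integral>\<omega>. X \<omega> \<partial>M) = 0" "(\<integral>\<omega>. (X \<omega>)\<^sup>2 \<partial>M) = 1"
proof -
  interpret prob_space M by (rule M)
  show "X \<in> borel_measurable M" using distributed_measurable[OF X] by simp
  have m: "has_bochner_integral lborel (\<lambda>x. std_normal_density x * x ^ (2 * 1)) 1"
    "has_bochner_integral lborel (\<lambda>x. std_normal_density x * x ^ (2 * 0 + 1)) 0"
    using std_normal_moment_even[of 1] std_normal_moment_odd[of 0] by (simp_all add: fact_numeral)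
  show "integrable M X"
    using m(2) distributed_integrable[OF X, of "\<lambda>x. x"] by (auto simp: has_bochner_integral_iff)
  show "integrable M (\<lambda>\<omega>. (X \<omega>)\<^sup>2)"
    using m(1) distributed_integrable[OF X, of "\<lambda>x. x\<^sup>2"] by (auto simp: has_bochner_integral_iff)
  show "(\<integral>\<omega>. X \<omega> \<partial>M) = 0"
    using m(2) distributed_integral[OF X, of "\<lambda>x. x"] by (auto simp: has_bochner_integral_iff)
  show "(\<integral>\<omega>. (X \<omega>)\<^sup>2 \<partial>M) = 1"
    using m(1) distributed_integral[OF X, of "\<lambda>x. x\<^sup>2"] by (auto simp: has_bochner_integral_iff)
qed

text \<open>
  The coefficients of the partial sums are orthonormal in mean square, being independent and
  standardised, so the covariance of two partial sums is a sum over the common index set. Its degree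
  \<open>l\<close> part is evaluated by the addition theorem, and the limit is a limit of inner products along two
  sequences that converge in mean square.
\<close>

lemma covariance_kernel_sums:
  assumes field: "isotropic_gaussian_field M A Y y u" and Y: "real_spherical_harmonics Y"
    and A: "\<And>l. A l \<ge> 0" and s: "s \<in> S2" and t: "t \<in> S2"
  shows "(\<lambda>l. A l * ((2 * real l + 1) / (4 * pi)) * legendre l (s \<bullet> t)) sums covariance_kernel M u s t"
proof -
  have "prob_space M" using field by (simp add: isotropic_gaussian_field_def)
  then interpret prob_space M .
  (* single-index form of the field: u is the limit of the sums of b i s * x i over i in J L *)
  define J where "J L = (SIGMA l:{..L}. {-int l..int l})" for L :: nat
  define J' where "J' = (SIGMA l:(UNIV::nat set). {-int l..int l})"
  have J: "finite (J L)" "J L \<subseteq> J'" for L by (auto simp: J_def J'_def)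
  define b where "b i s = sqrt (A (fst i)) * Y (fst i) (snd i) s" for i s
  define x where "x i = y (fst i) (snd i)" for i
  have dist: "distributed M lborel (x i) std_normal_density" if "i \<in> J'" for i
    using field that by (auto simp: isotropic_gaussian_field_def x_def J'_def)
  have indep: "indep_vars (\<lambda>_. borel) x J'"
    using field by (auto simp: isotropic_gaussian_field_def x_def[abs_def] J'_def case_prod_unfold)
  note mom = std_normal_moments[OF \<open>prob_space M\<close> dist]
  have prod: "integrable M (\<lambda>\<omega>. x i \<omega> * x j \<omega>)" if "i \<in> J'" "j \<in> J'" for i j
    by (rule integrable_mult_of_squares[OF mom(1)[OF that(1)] mom(1)[OF that(2)] mom(3)[OF that(1)] mom(3)[OF that(2)]])
  have cov: "(\<integral>\<omega>. x i \<omega> * x j \<omega> \<partial>M) = (if i = j then 1 else 0)" if ij: "i \<in> J'" "j \<in> J'" for i j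
  proof (cases "i = j")
    case True
    then show ?thesis using mom(5)[OF ij(1)] by (simp add: power2_eq_square)
  next
    case False
    have "indep_vars (\<lambda>_. borel) x {i, j}"
      using ij by (intro indep_vars_subset[OF indep]) auto
    then have "(\<integral>\<omega>. (\<Prod>k\<in>{i, j}. x k \<omega>) \<partial>M) = (\<Prod>k\<in>{i, j}. \<integral>\<omega>. x k \<omega> \<partial>M)"
      by (intro indep_vars_lebesgue_integral) (use ij mom(2) in auto)
    then show ?thesis using False mom(4)[OF ij(1)] by simp
  qed
  define U where "U L s \<omega> = (\<Sum>i\<in>J L. b i s * x i \<omega>)" for L s \<omega>
  have U: "U L s \<omega> = (\<Sum>l\<le>L. sqrt (A l) * (\<Sum>m=-int l..int l. y l m \<omega> * Y l m s))" for L s \<omega>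
    by (simp add: U_def J_def b_def x_def sum_distrib_left sum.Sigma case_prod_unfold mult_ac)
  have prodJ: "integrable M (\<lambda>\<omega>. x i \<omega> * x j \<omega>)" if "i \<in> J L" "j \<in> J L" for i j L
    using that J(2)[of L] by (intro prod) blast+
  have Um: "U L s \<in> borel_measurable M" for L s
    unfolding U_def using J(2)[of L] mom(1) by (intro borel_measurable_sum borel_measurable_times) auto
  have Uexp: "U L s \<omega> * U L t \<omega> = (\<Sum>i\<in>J L. \<Sum>j\<in>J L. b i s * b j t * (x i \<omega> * x j \<omega>))" for L s t \<omega>
    by (simp add: U_def sum_product mult_ac)
  have Uint: "integrable M (\<lambda>\<omega>. U L s \<omega> * U L t \<omega>)" for L s t
    unfolding Uexp
    by (intro Bochner_Integration.integrable_sum Bochner_Integration.integrable_mult_right prodJ)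
  have Ucov: "(\<integral>\<omega>. U L s \<omega> * U L t \<omega> \<partial>M) = (\<Sum>l\<le>L. A l * ((2 * real l + 1) / (4 * pi)) * legendre l (s \<bullet> t))" for L
  proof -
    have "(\<integral>\<omega>. U L s \<omega> * U L t \<omega> \<partial>M) = (\<Sum>i\<in>J L. \<Sum>j\<in>J L. b i s * b j t * (\<integral>\<omega>. x i \<omega> * x j \<omega> \<partial>M))"
      unfolding Uexp
      by (simp add: prodJ Bochner_Integration.integral_sum Bochner_Integration.integrable_sum)
    also have "\<dots> = (\<Sum>i\<in>J L. \<Sum>j\<in>J L. if i = j then b i s * b j t else 0)"
      using J(2)[of L] by (intro sum.cong refl) (auto simp: cov subset_eq)
    also have "\<dots> = (\<Sum>i\<in>J L. b i s * b i t)" by (simp add: J(1))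
    also have "\<dots> = (\<Sum>i\<in>J L. A (fst i) * (Y (fst i) (snd i) s * Y (fst i) (snd i) t))"
    proof -
      have sq: "sqrt a * p * (sqrt a * q) = a * (p * q)" if "a \<ge> 0" for a p q :: real
      proof -
        have "sqrt a * p * (sqrt a * q) = (sqrt a * sqrt a) * (p * q)" by (simp only: mult_ac)
        then show ?thesis using that by simp
      qed
      show ?thesis by (intro sum.cong refl) (simp only: b_def sq[OF A])
    qed
    also have "\<dots> = (\<Sum>l\<le>L. \<Sum>m=-int l..int l. A l * (Y l m s * Y l m t))"
      by (simp add: J_def sum.Sigma case_prod_unfold)
    also have "\<dots> = (\<Sum>l\<le>L. A l * ((2 * real l + 1) / (4 * pi)) * legendre l (s \<bullet> t))"
      by (simp only: spherical_harmonics_addition_theorem[OF Y s t] mult.assoc flip: sum_distrib_left)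
    finally show ?thesis .
  qed
  have lim: "u s \<in> borel_measurable M" "(\<lambda>L. \<integral>\<^sup>+\<omega>. ennreal ((u s \<omega> - U L s \<omega>)\<^sup>2) \<partial>M) \<longlonglongrightarrow> 0" if "s \<in> S2" for s
    using field that unfolding isotropic_gaussian_field_def U by blast+
  have "(\<lambda>L. \<integral>\<omega>. U L s \<omega> * U L t \<omega> \<partial>M) \<longlonglongrightarrow> (\<integral>\<omega>. u s \<omega> * u t \<omega> \<partial>M)"
    using Uint[of _ s s] Uint[of _ t t]
    by (intro L2_limit_integral_mult Um lim s t) (simp_all add: power2_eq_square)
  then have "(\<lambda>L. \<Sum>l\<le>L. A l * ((2 * real l + 1) / (4 * pi)) * legendre l (s \<bullet> t)) \<longlonglongrightarrow> covariance_kernel M u s t"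
    by (simp add: Ucov covariance_kernel_def)
  then show ?thesis by (simp add: sums_def_le)
qed

section \<open>Polynomials of bounded degree\<close>

text \<open>
  A representation by monomials that may repeat an exponent, over an arbitrary finite index set.
  Collecting equal exponents here once makes sums and products of polynomials immediate.
\<close>

lemma poly_degree_le_sumI:
  fixes d :: "'t \<Rightarrow> real"
  assumes T: "finite T" and deg: "\<And>t. t \<in> T \<Longrightarrow> i t + j t + k t \<le> n"
    and p: "\<And>x. p x = (\<Sum>t\<in>T. d t * x$1 ^ i t * x$2 ^ j t * x$3 ^ k t)"
  shows "poly_degree_le n p"
  unfolding poly_degree_le_def
proof (intro exI allI)
  fix x :: "real^3"
  let ?g = "\<lambda>t. (i t, j t, k t)"
  let ?h = "\<lambda>t. d t * x$1 ^ i t * x$2 ^ j t * x$3 ^ k t"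
  have "p x = (\<Sum>y\<in>{(i, j, k). i + j + k \<le> n}. \<Sum>t\<in>{t\<in>T. ?g t = y}. ?h t)"
    unfolding p using deg by (intro sum.group[symmetric] T finite_exponents) auto
  also have "\<dots> = (\<Sum>(a, b, c)\<in>{(i, j, k). i + j + k \<le> n}.
      (\<Sum>t\<in>{t\<in>T. ?g t = (a, b, c)}. d t) * x$1 ^ a * x$2 ^ b * x$3 ^ c)"
    by (intro sum.cong refl) (auto simp: sum_distrib_right intro!: sum.cong)
  finally show "p x = (\<Sum>(a, b, c)\<in>{(i, j, k). i + j + k \<le> n}.
      (\<Sum>t\<in>{t\<in>T. ?g t = (a, b, c)}. d t) * x$1 ^ a * x$2 ^ b * x$3 ^ c)" .
qed

lemma poly_degree_le_coeffs:
  assumes "poly_degree_le n p"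
  shows "\<exists>c. \<forall>x. p x = (\<Sum>t\<in>{(i, j, k). i + j + k \<le> n}.
     c t * x$1 ^ fst t * x$2 ^ fst (snd t) * x$3 ^ snd (snd t))"
proof -
  obtain c where c: "\<And>x. p x = (\<Sum>(i, j, k) \<in> {(i, j, k). i + j + k \<le> n}. c i j k * x$1 ^ i * x$2 ^ j * x$3 ^ k)"
    using assms unfolding poly_degree_le_def by blast
  show ?thesis
    by (intro exI[of _ "\<lambda>t. c (fst t) (fst (snd t)) (snd (snd t))"]) (simp add: c case_prod_unfold)
qed

lemma poly_degree_le_mono:
  assumes "poly_degree_le m p" "m \<le> n"
  shows "poly_degree_le n p"
proof -
  obtain c where c: "\<And>x. p x = (\<Sum>t\<in>{(i, j, k). i + j + k \<le> m}.
     c t * x$1 ^ fst t * x$2 ^ fst (snd t) * x$3 ^ snd (snd t))"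
    using poly_degree_le_coeffs[OF assms(1)] by blast
  show ?thesis
    by (rule poly_degree_le_sumI[OF _ _ c]) (use assms(2) finite_exponents in auto)
qed

lemma poly_degree_le_mult:
  assumes "poly_degree_le m p" "poly_degree_le n q"
  shows "poly_degree_le (m + n) (\<lambda>x. p x * q x)"
proof -
  obtain c where c: "\<And>x. p x = (\<Sum>t\<in>{(i, j, k). i + j + k \<le> m}.
     c t * x$1 ^ fst t * x$2 ^ fst (snd t) * x$3 ^ snd (snd t))"
    using poly_degree_le_coeffs[OF assms(1)] by blast
  obtain d where d: "\<And>x. q x = (\<Sum>t\<in>{(i, j, k). i + j + k \<le> n}.
     d t * x$1 ^ fst t * x$2 ^ fst (snd t) * x$3 ^ snd (snd t))"
    using poly_degree_le_coeffs[OF assms(2)] by blast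
  let ?T = "{(i, j, k). i + j + k \<le> m} \<times> {(i, j, k). i + j + k \<le> n}"
  show ?thesis
  proof (rule poly_degree_le_sumI[where T = ?T and d = "\<lambda>(t, u). c t * d u"
        and i = "\<lambda>(t, u). fst t + fst u" and j = "\<lambda>(t, u). fst (snd t) + fst (snd u)"
        and k = "\<lambda>(t, u). snd (snd t) + snd (snd u)"])
    show "finite ?T" by (intro finite_cartesian_product finite_exponents)
    show "p x * q x = (\<Sum>t\<in>?T. (\<lambda>(t, u). c t * d u) t * x$1 ^ (\<lambda>(t, u). fst t + fst u) t *
        x$2 ^ (\<lambda>(t, u). fst (snd t) + fst (snd u)) t * x$3 ^ (\<lambda>(t, u). snd (snd t) + snd (snd u)) t)" for x
      unfolding c d sum_product sum.cartesian_product
      by (intro sum.cong refl) (simp add: case_prod_unfold power_add mult_ac)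
  qed auto
qed

lemma poly_degree_le_add:
  assumes "poly_degree_le n p" "poly_degree_le n q"
  shows "poly_degree_le n (\<lambda>x. p x + q x)"
proof -
  obtain c where c: "\<And>x. p x = (\<Sum>t\<in>{(i, j, k). i + j + k \<le> n}.
     c t * x$1 ^ fst t * x$2 ^ fst (snd t) * x$3 ^ snd (snd t))"
    using poly_degree_le_coeffs[OF assms(1)] by blast
  obtain d where d: "\<And>x. q x = (\<Sum>t\<in>{(i, j, k). i + j + k \<le> n}.
     d t * x$1 ^ fst t * x$2 ^ fst (snd t) * x$3 ^ snd (snd t))"
    using poly_degree_le_coeffs[OF assms(2)] by blast
  show ?thesis
    by (rule poly_degree_le_sumI[where T = "{(i, j, k). i + j + k \<le> n}" and d = "\<lambda>t. c t + d t"
        and i = fst and j = "\<lambda>t. fst (snd t)" and k = "\<lambda>t. snd (snd t)"])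
       (auto simp: c d finite_exponents distrib_right sum.distrib)
qed

lemma poly_degree_le_const: "poly_degree_le n (\<lambda>x. c)"
  by (rule poly_degree_le_sumI[where T = "{()}" and d = "\<lambda>_. c" and i = "\<lambda>_. 0" and j = "\<lambda>_. 0" and k = "\<lambda>_. 0"]) auto

lemma poly_degree_le_cmult: "poly_degree_le n p \<Longrightarrow> poly_degree_le n (\<lambda>x. c * p x)"
  using poly_degree_le_mult[OF poly_degree_le_const[of 0 c]] by simp

lemma poly_degree_le_inner: "poly_degree_le 1 (\<lambda>x. x \<bullet> a)"
proof -
  have "poly_degree_le 1 (\<lambda>x::real^3. x $ 1)"
    by (rule poly_degree_le_sumI[where T = "{()}" and d = "\<lambda>_. 1" and i = "\<lambda>_. 1" and j = "\<lambda>_. 0" and k = "\<lambda>_. 0"]) auto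
  moreover have "poly_degree_le 1 (\<lambda>x::real^3. x $ 2)"
    by (rule poly_degree_le_sumI[where T = "{()}" and d = "\<lambda>_. 1" and i = "\<lambda>_. 0" and j = "\<lambda>_. 1" and k = "\<lambda>_. 0"]) auto
  moreover have "poly_degree_le 1 (\<lambda>x::real^3. x $ 3)"
    by (rule poly_degree_le_sumI[where T = "{()}" and d = "\<lambda>_. 1" and i = "\<lambda>_. 0" and j = "\<lambda>_. 0" and k = "\<lambda>_. 1"]) auto
  ultimately have "poly_degree_le 1 (\<lambda>x::real^3. a $ 1 * x $ 1 + a $ 2 * x $ 2 + a $ 3 * x $ 3)"
    by (intro poly_degree_le_add poly_degree_le_cmult)
  then show ?thesis by (simp add: inner_vec_def sum_3 mult.commute)
qed

lemma poly_degree_le_legendre: "poly_degree_le l (\<lambda>x. legendre l (x \<bullet> a))"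
proof (induction l rule: induct_nat_012)
  case 0 then show ?case by (simp add: poly_degree_le_const)
next
  case 1 then show ?case using poly_degree_le_inner[of a] by simp
next
  case (ge2 n)
  have "poly_degree_le (Suc (Suc n)) (\<lambda>x. (2 * real n + 3) / (real n + 2) * ((x \<bullet> a) * legendre (Suc n) (x \<bullet> a))
      + (- (real n + 1) / (real n + 2)) * legendre n (x \<bullet> a))"
    using poly_degree_le_mult[OF poly_degree_le_inner[of a] ge2(2)] poly_degree_le_mono[OF ge2(1), of "Suc (Suc n)"]
    by (intro poly_degree_le_add poly_degree_le_cmult) simp_all
  moreover have "(2 * real n + 3) / (real n + 2) * ((x \<bullet> a) * legendre (Suc n) (x \<bullet> a))
      + (- (real n + 1) / (real n + 2)) * legendre n (x \<bullet> a) = legendre (Suc (Suc n)) (x \<bullet> a)" for x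
  proof -
    have "c / b * v + - d / b * w = (c * v - d * w) / b" for b c d v w :: real
      by (simp add: diff_divide_distrib)
    then show ?thesis by (simp only: legendre.simps mult.assoc)
  qed
  ultimately show ?case by simp
qed

lemma real_polynomial_function_poly_degree_le:
  assumes "poly_degree_le n p" shows "real_polynomial_function p"
proof -
  obtain c where c: "\<And>x. p x = (\<Sum>t\<in>{(i, j, k). i + j + k \<le> n}.
     c t * x$1 ^ fst t * x$2 ^ fst (snd t) * x$3 ^ snd (snd t))"
    using poly_degree_le_coeffs[OF assms] by blast
  show ?thesis unfolding c[abs_def]
    by (intro real_polynomial_function_sum finite_exponents real_polynomial_function_monomial)
qed

section \<open>Zonal kernels\<close>

definition zonal_kernel :: "nat \<Rightarrow> real^3 \<Rightarrow> real^3 \<Rightarrow> real" where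
  "zonal_kernel l s t = (2 * real l + 1) / (4 * pi) * legendre l (s \<bullet> t)"

lemma zonal_kernel_commute: "zonal_kernel l s t = zonal_kernel l t s"
  by (simp add: zonal_kernel_def inner_commute)

lemma poly_degree_le_zonal_kernel: "poly_degree_le l (\<lambda>s. zonal_kernel l s t)"
  unfolding zonal_kernel_def by (intro poly_degree_le_cmult poly_degree_le_legendre)

text \<open>
  The Funk-Hecke formula for zonal kernels: integration against \<open>Z\<^sub>l\<close> is the orthogonal projection onto
  the harmonics of degree \<open>l\<close>.
\<close>

lemma L2_inner_zonal_harmonic:
  assumes t: "t \<in> S2" and h: "solid_harmonic n h" and f: "\<And>s. s \<in> S2 \<Longrightarrow> f s = h s"
  shows "L2_inner (\<lambda>s. zonal_kernel l s t) f = (if l = n then f t else 0)"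
proof -
  have t1: "t \<bullet> t = 1" using t by (simp add: norm_eq_1)
  have "L2_inner (\<lambda>s. zonal_kernel l s t) f
      = L2_inner (\<lambda>s. (2 * real l + 1) / (4 * pi) * solid_zonal t l s) h"
    by (intro L2_inner_cong) (use solid_zonal_legendre[of _ t l] f in \<open>auto simp: zonal_kernel_def\<close>)
  also have "\<dots> = (2 * real l + 1) / (4 * pi) * L2_inner h (solid_zonal t l)"
    by (simp only: L2_inner_cmult L2_inner_commute[of h])
  also have "\<dots> = (if l = n then f t else 0)"
    using L2_inner_solid_zonal[OF t1 h] solid_harmonics_orthogonal[OF h solid_harmonic_solid_zonal[OF t1], of l] f[OF t]
    by (auto simp: add_nonneg_eq_0_iff)
  finally show ?thesis .
qed

lemma L2_inner_zonal_kernels: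
  assumes s: "s \<in> S2" and t: "t \<in> S2"
  shows "L2_inner (\<lambda>x. zonal_kernel l x s) (\<lambda>x. zonal_kernel l' x t) = (if l = l' then zonal_kernel l s t else 0)"
proof -
  have t1: "t \<bullet> t = 1" using t by (simp add: norm_eq_1)
  show ?thesis
    by (rule L2_inner_zonal_harmonic[OF s solid_harmonic_cmult[OF solid_harmonic_solid_zonal[OF t1],
            of _ "(2 * real l' + 1) / (4 * pi)"], THEN trans])
      (auto simp: zonal_kernel_def solid_zonal_legendre)
qed

lemma L2_inner_zonal_poly:
  assumes t: "t \<in> S2" and p: "poly_degree_le n p" and "n < l"
  shows "L2_inner (\<lambda>x. zonal_kernel l x t) p = 0"
proof -
  have t1: "t \<bullet> t = 1" using t by (simp add: norm_eq_1)
  have "L2_inner (\<lambda>x. zonal_kernel l x t) p = L2_inner (\<lambda>s. (2 * real l + 1) / (4 * pi) * solid_zonal t l s) p"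
    by (intro L2_inner_cong) (simp add: zonal_kernel_def solid_zonal_legendre)
  also have "\<dots> = 0"
    by (rule L2_inner_poly_degree_le[OF solid_harmonic_cmult[OF solid_harmonic_solid_zonal[OF t1]] p \<open>n < l\<close>])
  finally show ?thesis .
qed

lemma L2_inner_sum_left:
  assumes "finite I" "\<And>i. i \<in> I \<Longrightarrow> real_polynomial_function (f i)" "real_polynomial_function g"
  shows "L2_inner (\<lambda>x. \<Sum>i\<in>I. a i * f i x) g = (\<Sum>i\<in>I. a i * L2_inner (f i) g)"
proof -
  have "L2_inner (\<lambda>x. \<Sum>i\<in>I. a i * f i x) g = (\<integral>x. (\<Sum>i\<in>I. a i * (f i x * g x)) \<partial>sphere_measure)"
    by (simp add: L2_inner_def sum_distrib_right mult.assoc)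
  also have "\<dots> = (\<Sum>i\<in>I. \<integral>x. a i * (f i x * g x) \<partial>sphere_measure)"
    using assms by (intro Bochner_Integration.integral_sum integrable_sphere_polynomial) simp
  finally show ?thesis by (simp add: L2_inner_def)
qed

section \<open>The dyadic partition of the degrees\<close>

text \<open>
  The set on which a continuous function is nonzero is open, so it lies in the interior of its
  closure; in particular \<open>\<kappa>\<close> vanishes at both end points of its support.
\<close>

lemma cutoff_support:
  assumes "cutoff_assumption r \<kappa>" and "\<kappa> t \<noteq> 0"
  shows "1/2 < t" "t < 2"
proof -
  have "continuous_on UNIV \<kappa>"
  proof (rule continuous_at_imp_continuous_on, rule ballI)
    fix t
    have "0 < r \<and> (\<forall>i<r. \<forall>t. (deriv ^^ i) \<kappa> differentiable (at t))"
      using assms(1) by (auto simp: cutoff_assumption_def)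
    then have "(deriv ^^ 0) \<kappa> differentiable (at t)" by blast
    then show "isCont \<kappa> t" by (simp add: differentiable_imp_continuous_within)
  qed
  then have "open {t. \<kappa> t \<noteq> 0}"
    by (intro open_Collect_neq) (auto simp: continuous_on_const)
  moreover have "{t. \<kappa> t \<noteq> 0} \<subseteq> {1/2..2}"
    using assms(1) closure_subset[of "{t. \<kappa> t \<noteq> 0}"] by (simp add: cutoff_assumption_def)
  (* an open subset of the closed interval avoids its end points *)
  ultimately have "{t. \<kappa> t \<noteq> 0} \<subseteq> interior {1/2..2}" by (rule interior_maximal[rotated])
  then show "1/2 < t" "t < 2" using assms(2) by (auto simp: interior_atLeastAtMost_real)
qed

lemma cutoff_dyadic_support:
  assumes "cutoff_assumption r \<kappa>" and "\<kappa> ((2 * real l + 1) / 2 ^ j) \<noteq> 0"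
  shows "2 ^ j < 2 * (2 * real l + 1)" "2 * real l + 1 < 2 * 2 ^ j" "l < 2 ^ j"
proof -
  show 1: "2 ^ j < 2 * (2 * real l + 1)" "2 * real l + 1 < 2 * 2 ^ j"
    using cutoff_support[OF assms] by (simp_all add: field_simps)
  have "real (2 * l + 1) < real (2 * 2 ^ j)" using 1(2) by simp
  then show "l < 2 ^ j" unfolding of_nat_less_iff by simp
qed

text \<open>
  If \<open>2\<^sup>i \<le> 2l+1 < 2\<^sup>i\<^sup>+\<^sup>1\<close>, then only the levels \<open>i\<close> and \<open>i+1\<close> contribute, and their arguments of \<open>\<kappa>\<close> are
  \<open>2t\<close> and \<open>t\<close> for \<open>t = (2l+1)/2\<^sup>i\<^sup>+\<^sup>1 \<in> [1/2,1]\<close>.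
\<close>

lemma cutoff_dyadic_partition:
  assumes \<kappa>: "cutoff_assumption r \<kappa>"
  shows "((\<lambda>j. (\<kappa> ((2 * real l + 1) / 2 ^ j))\<^sup>2) has_sum 1) UNIV"
proof -
  obtain i where i: "2 ^ i \<le> 2 * l + 1" "2 * l + 1 < 2 ^ (i + 1)"
    using ex_power_ivl1[of 2 "2 * l + 1"] by auto
  define x where "x = 2 * real l + 1"
  have "real (2 ^ i) \<le> real (2 * l + 1)" "real (2 * l + 1) < real (2 ^ (i + 1))"
    using i by (simp_all only: of_nat_le_iff of_nat_less_iff)
  then have x: "2 ^ i \<le> x" "x < 2 * 2 ^ i" by (simp_all add: x_def)
  have "(\<kappa> (x / 2 ^ j))\<^sup>2 = 0" if "j \<notin> {i, Suc i}" for j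
  proof (rule ccontr)
    assume "(\<kappa> (x / 2 ^ j))\<^sup>2 \<noteq> 0"
    then have "1/2 < x / 2 ^ j" "x / 2 ^ j < 2" using cutoff_support[OF \<kappa>, of "x / 2 ^ j"] by auto
    then have b: "2 ^ j < 2 * x" "x < 2 * 2 ^ j" by (simp_all add: field_simps)
    have "Suc j \<le> i \<or> Suc (Suc i) \<le> j" using that by auto
    then show False
    proof
      assume "Suc j \<le> i"
      then have "(2::real) ^ Suc j \<le> 2 ^ i" by (rule power_increasing) simp
      then show False using x b by simp
    next
      assume "Suc (Suc i) \<le> j"
      then have "(2::real) ^ Suc (Suc i) \<le> 2 ^ j" by (rule power_increasing) simp
      then show False using x b by simp
    qed
  qed
  moreover have "(\<kappa> (x / 2 ^ Suc i))\<^sup>2 + (\<kappa> (x / 2 ^ i))\<^sup>2 = 1"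
  proof -
    have "x / 2 ^ Suc i \<in> {1/2..1}" using x by (simp add: field_simps)
    then have "\<bar>\<kappa> (x / 2 ^ Suc i)\<bar>\<^sup>2 + \<bar>\<kappa> (2 * (x / 2 ^ Suc i))\<bar>\<^sup>2 = 1"
      using \<kappa> unfolding cutoff_assumption_def by blast
    then show ?thesis by simp
  qed
  ultimately show ?thesis
    by (intro has_sum_finite_neutralI[of "{i, Suc i}"]) (auto simp: x_def)
qed

section \<open>Needlets\<close>

text \<open>
  Of the random field, only the expansion of its covariance kernel into zonal kernels matters from
  here on; the bound on zonal kernels makes that expansion converge absolutely and uniformly.
\<close>

locale needlet_system =
  fixes N :: "nat \<Rightarrow> nat" and wt :: "nat \<Rightarrow> nat \<Rightarrow> real" and \<xi> :: "nat \<Rightarrow> nat \<Rightarrow> real^3"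
    and r :: nat and \<kappa> :: "real \<Rightarrow> real" and A :: "nat \<Rightarrow> real" and K :: "real^3 \<Rightarrow> real^3 \<Rightarrow> real"
  assumes quad: "quadrature_assumption N wt \<xi>"
    and cutoff: "cutoff_assumption r \<kappa>"
    and A_pos: "\<And>l. A l > 0"
    and A_summable: "summable (\<lambda>l. (2 * real l + 1) * A l)"
    and zonal_bound: "\<And>l s t. s \<in> S2 \<Longrightarrow> t \<in> S2 \<Longrightarrow> \<bar>zonal_kernel l s t\<bar> \<le> (2 * real l + 1) / (4 * pi)"
    and K_sums: "\<And>s t. s \<in> S2 \<Longrightarrow> t \<in> S2 \<Longrightarrow> (\<lambda>l. A l * zonal_kernel l s t) sums K s t"
begin

lemma node: "k \<in> {1..N j} \<Longrightarrow> \<xi> j k \<in> S2" and weight_pos: "k \<in> {1..N j} \<Longrightarrow> wt j k > 0"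
  using quad by (auto simp: quadrature_assumption_def)

definition quadrature :: "nat \<Rightarrow> (real^3 \<Rightarrow> real) \<Rightarrow> real" where
  "quadrature j f = (\<Sum>k=1..N j. wt j k * f (\<xi> j k))"

lemma quadrature_exact:
  "poly_degree_le (2 * (2 ^ j - 1)) p \<Longrightarrow> quadrature j p = (\<integral>s. p s \<partial>sphere_measure)"
  using quad by (simp add: quadrature_assumption_def quadrature_def)

lemma quadrature_const: "quadrature j (\<lambda>s. c) = 4 * pi * c"
  using quadrature_exact[OF poly_degree_le_const, of j c] by (simp add: measure_sphere_measure)

lemma quadrature_sum:
  "quadrature j (\<lambda>s. \<Sum>i\<in>I. a i * f i s) = (\<Sum>i\<in>I. a i * quadrature j (f i))"
  unfolding quadrature_def sum_distrib_left by (subst sum.swap) (simp add: mult_ac)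

lemma quadrature_diff: "quadrature j (\<lambda>s. f s - g s) = quadrature j f - quadrature j g"
  by (simp add: quadrature_def right_diff_distrib sum_subtractf)

text \<open>
  The weights are positive and sum to the area of the sphere, so quadratures are bounded functionals
  uniformly in the level.
\<close>

lemma abs_quadrature_le:
  assumes "\<And>s. s \<in> S2 \<Longrightarrow> \<bar>f s\<bar> \<le> B"
  shows "\<bar>quadrature j f\<bar> \<le> 4 * pi * B"
proof -
  have "\<bar>quadrature j f\<bar> \<le> (\<Sum>k=1..N j. \<bar>wt j k * f (\<xi> j k)\<bar>)"
    unfolding quadrature_def by (rule sum_abs)
  also have "\<dots> \<le> (\<Sum>k=1..N j. wt j k * B)"
  proof (rule sum_mono)
    fix k assume k: "k \<in> {1..N j}"
    show "\<bar>wt j k * f (\<xi> j k)\<bar> \<le> wt j k * B"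
      using weight_pos[OF k] assms[OF node[OF k]] by (simp add: abs_mult)
  qed
  also have "\<dots> = 4 * pi * B" using quadrature_const[of j B] by (simp add: quadrature_def)
  finally show ?thesis .
qed

lemma quadrature_zonal:
  assumes s: "s \<in> S2" and t: "t \<in> S2" and l: "l < 2 ^ j" "l' < 2 ^ j"
  shows "quadrature j (\<lambda>x. zonal_kernel l x s * zonal_kernel l' x t) = (if l = l' then zonal_kernel l s t else 0)"
proof -
  have "poly_degree_le (l + l') (\<lambda>x. zonal_kernel l x s * zonal_kernel l' x t)"
    by (intro poly_degree_le_mult poly_degree_le_zonal_kernel)
  then have "poly_degree_le (2 * (2 ^ j - 1)) (\<lambda>x. zonal_kernel l x s * zonal_kernel l' x t)"
    by (rule poly_degree_le_mono) (use l in linarith)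
  then show ?thesis
    using L2_inner_zonal_kernels[OF s t, of l l'] by (simp add: quadrature_exact L2_inner_def)
qed

lemma quadrature_zonal_sums:
  assumes s: "s \<in> S2" and t: "t \<in> S2" and n: "n \<le> 2 ^ j" "m \<le> 2 ^ j"
  shows "quadrature j (\<lambda>x. (\<Sum>l<n. a l * zonal_kernel l x s) * (\<Sum>l<m. b l * zonal_kernel l x t))
     = (\<Sum>l<min n m. a l * b l * zonal_kernel l s t)"
proof -
  have "quadrature j (\<lambda>x. (\<Sum>l<n. a l * zonal_kernel l x s) * (\<Sum>l<m. b l * zonal_kernel l x t))
    = quadrature j (\<lambda>x. \<Sum>(l, l')\<in>{..<n} \<times> {..<m}. (a l * b l') * (zonal_kernel l x s * zonal_kernel l' x t))"
    by (simp add: sum_product sum.cartesian_product mult_ac)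
  also have "\<dots> = (\<Sum>(l, l')\<in>{..<n} \<times> {..<m}. (a l * b l') * quadrature j (\<lambda>x. zonal_kernel l x s * zonal_kernel l' x t))"
    unfolding case_prod_unfold by (rule quadrature_sum)
  also have "\<dots> = (\<Sum>l<n. \<Sum>l'<m. if l = l' then a l * b l * zonal_kernel l s t else 0)"
    unfolding sum.cartesian_product[symmetric]
    using n by (intro sum.cong refl) (simp add: quadrature_zonal[OF s t])
  also have "\<dots> = (\<Sum>l<n. if l < m then a l * b l * zonal_kernel l s t else 0)" by simp
  also have "\<dots> = (\<Sum>l<min n m. a l * b l * zonal_kernel l s t)"
    by (intro sum.mono_neutral_cong_right) auto
  finally show ?thesis .
qed

definition level_coeff :: "nat \<Rightarrow> nat \<Rightarrow> real" where
  "level_coeff j l = \<kappa> ((2 * real l + 1) / 2 ^ j)"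

abbreviation needlet :: "nat \<Rightarrow> nat \<Rightarrow> real^3 \<Rightarrow> real" where
  "needlet \<equiv> modified_needlet \<kappa> A wt \<xi>"

lemma level_coeff_support:
  assumes "level_coeff j l \<noteq> 0"
  shows "2 ^ j < 2 * (2 * real l + 1)" "2 * real l + 1 < 2 * 2 ^ j" "l < 2 ^ j"
  using cutoff_dyadic_support[OF cutoff] assms unfolding level_coeff_def by blast+

text \<open>
  A finite sum in place of the series: by \<open>level_coeff_support\<close> only degrees below \<open>2\<^sup>j\<close> occur.
\<close>

lemma needlet_eq:
  "needlet j k s = sqrt (wt j k) * (\<Sum>l<2 ^ j. level_coeff j l * sqrt (A l) * zonal_kernel l s (\<xi> j k))"
proof -
  have "(\<Sum>l. \<kappa> ((2 * real l + 1) / 2 ^ j) * sqrt (A l) * ((2 * real l + 1) / (4 * pi)) * legendre l (s \<bullet> \<xi> j k))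
     = (\<Sum>l<2 ^ j. level_coeff j l * sqrt (A l) * zonal_kernel l s (\<xi> j k))"
  proof (subst suminf_finite[of "{..<2 ^ j}"])
    fix l assume "l \<notin> {..<2 ^ j :: nat}"
    then have "level_coeff j l = 0" using level_coeff_support(3)[of j l] by auto
    then show "\<kappa> ((2 * real l + 1) / 2 ^ j) * sqrt (A l) * ((2 * real l + 1) / (4 * pi)) * legendre l (s \<bullet> \<xi> j k) = 0"
      by (simp add: level_coeff_def)
  qed (simp_all add: level_coeff_def zonal_kernel_def mult.assoc)
  then show ?thesis by (simp add: modified_needlet_def)
qed

text \<open>
  The sum over \<open>k\<close> is the quadrature of a product of two zonal sums of degree below \<open>2\<^sup>j\<close>, read as a
  function of the node; this is the step for which the exactness \<open>2(2\<^sup>j - 1)\<close> is needed.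
\<close>

lemma needlet_level_product:
  assumes s: "s \<in> S2" and t: "t \<in> S2"
  shows "(\<Sum>k=1..N j. needlet j k s * needlet j k t)
     = (\<Sum>l<2 ^ j. (level_coeff j l)\<^sup>2 * (A l * zonal_kernel l s t))"
proof -
  have "(\<Sum>k=1..N j. needlet j k s * needlet j k t)
    = quadrature j (\<lambda>x. (\<Sum>l<2 ^ j. (level_coeff j l * sqrt (A l)) * zonal_kernel l x s)
        * (\<Sum>l<2 ^ j. (level_coeff j l * sqrt (A l)) * zonal_kernel l x t))"
    unfolding quadrature_def
  proof (intro sum.cong refl)
    fix k assume k: "k \<in> {1..N j}"
    have "sqrt w * a * (sqrt w * b) = w * (a * b)" if "w > 0" for w a b :: real
    proof -
      have "sqrt w * a * (sqrt w * b) = (sqrt w * sqrt w) * (a * b)" by (simp only: mult_ac)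
      then show ?thesis using that by simp
    qed
    from this[OF weight_pos[OF k]] show "needlet j k s * needlet j k t
      = wt j k * ((\<Sum>l<2 ^ j. (level_coeff j l * sqrt (A l)) * zonal_kernel l (\<xi> j k) s)
        * (\<Sum>l<2 ^ j. (level_coeff j l * sqrt (A l)) * zonal_kernel l (\<xi> j k) t))"
      unfolding needlet_eq zonal_kernel_commute[of _ _ "\<xi> j k"] by blast
  qed
  also have "\<dots> = (\<Sum>l<2 ^ j. (level_coeff j l * sqrt (A l)) * (level_coeff j l * sqrt (A l)) * zonal_kernel l s t)"
    by (subst quadrature_zonal_sums[OF s t]) simp_all
  also have "\<dots> = (\<Sum>l<2 ^ j. (level_coeff j l)\<^sup>2 * (A l * zonal_kernel l s t))"
  proof (intro sum.cong refl)
    fix l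
    have "(level_coeff j l * sqrt (A l)) * (level_coeff j l * sqrt (A l)) * zonal_kernel l s t
       = (level_coeff j l)\<^sup>2 * ((sqrt (A l) * sqrt (A l)) * zonal_kernel l s t)"
      by (simp only: power2_eq_square mult_ac)
    then show "(level_coeff j l * sqrt (A l)) * (level_coeff j l * sqrt (A l)) * zonal_kernel l s t
       = (level_coeff j l)\<^sup>2 * (A l * zonal_kernel l s t)"
      using A_pos[of l] by simp
  qed
  finally show ?thesis .
qed

text \<open>
  The contribution of degree \<open>l\<close> to the variance \<open>K(s,s)\<close>, and a bound for its contribution to every
  \<open>K(s,t)\<close>.
\<close>

definition variance_term :: "nat \<Rightarrow> real" where
  "variance_term l = A l * ((2 * real l + 1) / (4 * pi))"

lemma variance_term_nonneg: "variance_term l \<ge> 0"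
  using A_pos[of l] by (simp add: variance_term_def)

lemma summable_variance_term: "summable variance_term"
  using summable_mult2[OF A_summable, of "1 / (4 * pi)"] by (simp add: variance_term_def[abs_def] mult.commute)

lemma abs_kernel_term_le:
  assumes "s \<in> S2" "t \<in> S2"
  shows "\<bar>A l * zonal_kernel l s t\<bar> \<le> variance_term l"
  using mult_left_mono[OF zonal_bound[OF assms, of l], of "A l"] A_pos[of l]
  by (simp add: variance_term_def abs_mult)

text \<open>
  The double series over levels and degrees converges absolutely, because the variance terms do; so
  summing over the levels first, which by the partition leaves the series of \<open>K\<close>, gives the same
  value as summing over the degrees first.
\<close>

lemma needlet_level_has_sum:
  assumes s: "s \<in> S2" and t: "t \<in> S2"
  shows "((\<lambda>j. \<Sum>l<2 ^ j. (level_coeff j l)\<^sup>2 * (A l * zonal_kernel l s t)) has_sum K s t) UNIV"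
proof -
  let ?h = "\<lambda>(l, j). (level_coeff j l)\<^sup>2 * (A l * zonal_kernel l s t)"
  let ?v = "\<lambda>(l, j). (level_coeff j l)\<^sup>2 * variance_term l"
  have part: "((\<lambda>j. (level_coeff j l)\<^sup>2) has_sum 1) UNIV" for l
    unfolding level_coeff_def by (rule cutoff_dyadic_partition[OF cutoff])
  have "?v summable_on (UNIV \<times> UNIV)"
  proof (rule summable_on_SigmaI)
    show "((\<lambda>j. ?v (l, j)) has_sum variance_term l) UNIV" for l
      using has_sum_cmult_left[OF part[of l], of "variance_term l"] by simp
    show "variance_term summable_on UNIV"
      by (rule summable_nonneg_imp_summable_on) (simp_all add: summable_variance_term variance_term_nonneg)
  qed (simp add: variance_term_nonneg)
  then have "(\<lambda>p. norm (?v p)) summable_on (UNIV \<times> UNIV)"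
    by (simp add: case_prod_unfold variance_term_nonneg)
  then have "(\<lambda>p. norm (?h p)) summable_on (UNIV \<times> UNIV)"
  proof (rule Infinite_Sum.abs_summable_on_comparison_test)
    fix p :: "nat \<times> nat"
    show "norm (?h p) \<le> norm (?v p)"
      using abs_kernel_term_le[OF s t, of "fst p"] variance_term_nonneg[of "fst p"]
      by (simp add: case_prod_unfold abs_mult mult_left_mono)
  qed
  then have sm: "?h summable_on (UNIV \<times> UNIV)" by (rule abs_summable_summable)
  have "((\<lambda>l. A l * zonal_kernel l s t) has_sum K s t) UNIV"
  proof (rule norm_summable_imp_has_sum[OF _ K_sums[OF s t]])
    show "summable (\<lambda>n. norm (A n * zonal_kernel n s t))"
      using abs_kernel_term_le[OF s t] by (intro summable_comparison_test[OF _ summable_variance_term]) auto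
  qed
  then have "(?h has_sum K s t) (UNIV \<times> UNIV)"
  proof (rule has_sum_SigmaI[OF _ _ sm, rotated])
    show "((\<lambda>j. ?h (l, j)) has_sum A l * zonal_kernel l s t) UNIV" for l
      using has_sum_cmult_left[OF part[of l], of "A l * zonal_kernel l s t"] by simp
  qed
  then have "((\<lambda>(j, l). ?h (l, j)) has_sum K s t) (UNIV \<times> UNIV)" by (subst (asm) has_sum_swap)
  then show ?thesis
  proof (rule has_sum_SigmaD)
    fix j
    show "((\<lambda>l. (\<lambda>(j, l). ?h (l, j)) (j, l)) has_sum (\<Sum>l<2 ^ j. (level_coeff j l)\<^sup>2 * (A l * zonal_kernel l s t))) UNIV"
      using level_coeff_support(3)[of j]
      by (intro has_sum_finite_neutralI[of "{..<2 ^ j}"]) force+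
  qed
qed

text \<open>
  On the diagonal all terms are nonnegative, and the sums over each level are summable. Off the
  diagonal, absolute summability follows from the diagonal by \<open>|a b| \<le> a\<^sup>2 + b\<^sup>2\<close>, after which the sum may
  be taken level by level.
\<close>

lemma needlet_kernel_expansion:
  assumes s: "s \<in> S2" and t: "t \<in> S2"
  shows "((\<lambda>(j, k). needlet j k s * needlet j k t) has_sum K s t) (SIGMA j:UNIV. {1..N j})"
proof -
  let ?I = "SIGMA j:UNIV. {1..N j}"
  have sq: "(\<lambda>(j, k). needlet j k x * needlet j k x) summable_on ?I" if x: "x \<in> S2" for x
  proof (rule summable_on_SigmaI)
    show "((\<lambda>k. (\<lambda>(j, k). needlet j k x * needlet j k x) (j, k)) has_sum
        (\<Sum>l<2 ^ j. (level_coeff j l)\<^sup>2 * (A l * zonal_kernel l x x))) {1..N j}" for j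
      by (rule has_sum_finiteI) (simp_all only: finite_atLeastAtMost needlet_level_product[OF x x] prod.case)
    show "(\<lambda>j. \<Sum>l<2 ^ j. (level_coeff j l)\<^sup>2 * (A l * zonal_kernel l x x)) summable_on UNIV"
      using needlet_level_has_sum[OF x x] by (rule has_sum_imp_summable)
  qed simp
  let ?f = "\<lambda>(j, k). needlet j k s * needlet j k t"
  let ?g = "\<lambda>(j, k). needlet j k s * needlet j k s + needlet j k t * needlet j k t"
  have "?g summable_on ?I"
    using summable_on_add[OF sq[OF s] sq[OF t]] by (simp add: case_prod_unfold)
  then have "(\<lambda>p. norm (?g p)) summable_on ?I" by (simp add: case_prod_unfold)
  then have "(\<lambda>p. norm (?f p)) summable_on ?I"
  proof (rule Infinite_Sum.abs_summable_on_comparison_test)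
    fix p :: "nat \<times> nat"
    have "\<bar>a * b\<bar> \<le> a * a + b * b" for a b :: real
    proof -
      have "0 \<le> \<bar>a\<bar> * \<bar>b\<bar>" by simp
      moreover have "2 * \<bar>a\<bar> * \<bar>b\<bar> \<le> a * a + b * b"
        using sum_squares_bound[of "\<bar>a\<bar>" "\<bar>b\<bar>"] by (simp add: power2_eq_square)
      ultimately show ?thesis unfolding abs_mult by linarith
    qed
    then show "norm (?f p) \<le> norm (?g p)" by (simp add: case_prod_unfold)
  qed
  then have "?f summable_on ?I" by (rule abs_summable_summable)
  then show ?thesis
  proof (rule has_sum_SigmaI[OF _ needlet_level_has_sum[OF s t], rotated])
    show "((\<lambda>k. ?f (j, k)) has_sum (\<Sum>l<2 ^ j. (level_coeff j l)\<^sup>2 * (A l * zonal_kernel l s t))) {1..N j}" for j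
      by (rule has_sum_finiteI) (simp_all only: finite_atLeastAtMost needlet_level_product[OF s t] prod.case)
  qed
qed

definition kernel_tail :: "nat \<Rightarrow> real" where
  "kernel_tail m = (\<Sum>l. variance_term l) - (\<Sum>l<m. variance_term l)"

lemma kernel_tail_tendsto: "kernel_tail \<longlonglongrightarrow> 0"
  using tendsto_diff[OF tendsto_const summable_LIMSEQ[OF summable_variance_term], of "suminf variance_term"]
  by (simp add: kernel_tail_def[abs_def])

lemma kernel_truncation:
  assumes s: "s \<in> S2" and t: "t \<in> S2"
  shows "\<bar>K s t - (\<Sum>l<m. A l * zonal_kernel l s t)\<bar> \<le> kernel_tail m"
proof -
  let ?f = "\<lambda>l. A l * zonal_kernel l s t"
  have f: "summable ?f" "suminf ?f = K s t" using K_sums[OF s t] by (auto simp: sums_iff)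
  have v: "summable (\<lambda>l. variance_term (l + m))"
    using summable_variance_term by (subst summable_iff_shift)
  have b: "norm (?f (l + m)) \<le> variance_term (l + m)" for l
    using abs_kernel_term_le[OF s t] by simp
  have "\<bar>K s t - (\<Sum>l<m. ?f l)\<bar> = norm (\<Sum>l. ?f (l + m))"
    using suminf_minus_initial_segment[OF f(1), of m] f(2) by simp
  also have "\<dots> \<le> (\<Sum>l. norm (?f (l + m)))"
    by (intro summable_norm summable_comparison_test[OF _ v] exI[of _ 0] allI impI) (use b in auto)
  also have "\<dots> \<le> (\<Sum>l. variance_term (l + m))"
    by (intro suminf_le b v summable_comparison_test[OF _ v] exI[of _ 0] allI impI) (use b in auto)
  also have "\<dots> = kernel_tail m"
    by (simp add: kernel_tail_def suminf_minus_initial_segment[OF summable_variance_term])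
  finally show ?thesis .
qed

text \<open>
  The coefficients of \<open>\<Sum>\<^sub>k \<lambda>\<^sub>j\<^sub>k w(\<xi>\<^sub>j\<^sub>k) K(\<xi>\<^sub>j\<^sub>k,\<cdot>)\<close> as a function of the point: nodes that coincide
  are added up.
\<close>

definition node_coeffs :: "nat \<Rightarrow> (real^3 \<Rightarrow> real) \<Rightarrow> real^3 \<Rightarrow> real" where
  "node_coeffs j w p = (\<Sum>k | k \<in> {1..N j} \<and> \<xi> j k = p. wt j k * w p)"

lemma node_coeffs_support: "{p. node_coeffs j w p \<noteq> 0} \<subseteq> \<xi> j ` {1..N j}"
proof (rule subsetI, rule ccontr)
  fix p assume p: "p \<in> {p. node_coeffs j w p \<noteq> 0}" "p \<notin> \<xi> j ` {1..N j}"
  then have "{k. k \<in> {1..N j} \<and> \<xi> j k = p} = {}" by blast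
  then have "node_coeffs j w p = 0" by (simp only: node_coeffs_def sum.empty)
  with p show False by simp
qed

lemma node_coeffs_fin: "node_coeffs j w \<in> fin_coeffs S2"
proof -
  have "\<xi> j ` {1..N j} \<subseteq> S2" using node by blast
  moreover have "finite {p. node_coeffs j w p \<noteq> 0}"
    by (rule finite_subset[OF node_coeffs_support]) simp
  ultimately show ?thesis using node_coeffs_support[of j w] unfolding fin_coeffs_def by blast
qed

lemma analysis_node_coeffs: "analysis_coeff (node_coeffs j w) g = quadrature j (\<lambda>x. w x * g x)"
proof -
  have "analysis_coeff (node_coeffs j w) g = (\<Sum>p\<in>\<xi> j ` {1..N j}. node_coeffs j w p * g p)"
    unfolding analysis_coeff_def
    by (intro sum.mono_neutral_left) (use node_coeffs_support in auto)
  also have "\<dots> = (\<Sum>p\<in>\<xi> j ` {1..N j}. \<Sum>k | k \<in> {1..N j} \<and> \<xi> j k = p. wt j k * (w (\<xi> j k) * g (\<xi> j k)))"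
    unfolding node_coeffs_def sum_distrib_right by (intro sum.cong refl) auto
  also have "\<dots> = (\<Sum>k\<in>{1..N j}. wt j k * (w (\<xi> j k) * g (\<xi> j k)))"
    by (rule sum.group) auto
  finally show ?thesis by (simp add: quadrature_def)
qed

text \<open>
  The function is \<open>\<integral> w(s) K(s,\<cdot>) d\<sigma>(s)\<close> with \<open>w = \<Sum>\<^sub>l a\<^sub>l Z\<^sub>l(\<cdot>,x)\<close>, and the quadratures of level \<open>J\<close> turn
  this integral into combinations of kernel sections. Up to the tail of the kernel beyond degree \<open>2\<^sup>J\<close>
  the quadrature is exact, which gives pointwise convergence. Applying it twice shows that all inner
  products of two such combinations tend to the same number \<open>G\<close> as both levels grow, so the sequence is
  Cauchy.
\<close>

lemma zonal_sum_in_rkhs: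
  assumes x: "x \<in> S2"
  shows "(\<lambda>s. \<Sum>l<n. A l * a l * zonal_kernel l s x) \<in> rkhs S2 K"
proof -
  define w where "w s = (\<Sum>l<n. a l * zonal_kernel l s x)" for s
  define f where "f s = (\<Sum>l<n. A l * a l * zonal_kernel l s x)" for s
  (* the approximating combination of kernel sections at the nodes of level J *)
  define c where "c J = node_coeffs J w" for J
  define B where "B = (\<Sum>l<n. \<bar>a l\<bar> * ((2 * real l + 1) / (4 * pi)))"
  define G where "G = (\<Sum>l<n. A l * a l * a l * zonal_kernel l x x)"
  have B: "\<bar>w s\<bar> \<le> B" if "s \<in> S2" for s
  proof -
    have "\<bar>w s\<bar> \<le> (\<Sum>l<n. \<bar>a l * zonal_kernel l s x\<bar>)" unfolding w_def by (rule sum_abs)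
    also have "\<dots> \<le> B" unfolding B_def abs_mult
      by (intro sum_mono mult_left_mono zonal_bound that x) simp
    finally show ?thesis .
  qed
  have "0 \<le> \<bar>w x\<bar>" by simp
  then have B0: "B \<ge> 0" using B[OF x] by linarith
  define D where "D = 4 * pi * B"
  have D0: "D \<ge> 0" using B0 by (simp add: D_def)
  obtain J0 where J0: "n \<le> 2 ^ J0"
    using less_exp[of n] less_imp_le by blast
  have nJ: "n \<le> 2 ^ J" if "J \<ge> J0" for J
    using J0 power_increasing[OF that, of "2::nat"] by linarith
  have comb: "kernel_comb K (c J) t = quadrature J (\<lambda>s. w s * K s t)" for J t
    using analysis_node_coeffs[of J w "\<lambda>s. K s t"] by (simp add: c_def kernel_comb_def analysis_coeff_def)
  have approx: "\<bar>kernel_comb K (c J) t - f t\<bar> \<le> D * kernel_tail (2 ^ J)" if J: "J \<ge> J0" and t: "t \<in> S2" for J t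
  proof -
    have "f t = quadrature J (\<lambda>s. w s * (\<Sum>l<2 ^ J. A l * zonal_kernel l s t))"
      unfolding w_def using nJ[OF J]
      by (subst quadrature_zonal_sums[OF x t])
        (auto simp: f_def min_absorb1 zonal_kernel_commute[of _ t x] intro!: sum.cong)
    then have "kernel_comb K (c J) t - f t
        = quadrature J (\<lambda>s. w s * (K s t - (\<Sum>l<2 ^ J. A l * zonal_kernel l s t)))"
      by (simp add: comb right_diff_distrib flip: quadrature_diff)
    also have "\<bar>\<dots>\<bar> \<le> 4 * pi * (B * kernel_tail (2 ^ J))"
      unfolding abs_mult
      by (intro abs_quadrature_le) (auto simp: abs_mult intro!: mult_mono B kernel_truncation t B0)
    finally show ?thesis by (simp add: D_def mult.assoc)
  qed
  have form: "\<bar>kernel_form K (c J) (c J') - G\<bar> \<le> D * (D * kernel_tail (2 ^ J))"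
    if J: "J \<ge> J0" and J': "J' \<ge> J0" for J J'
  proof -
    have "G = quadrature J' (\<lambda>s. w s * f s)"
      unfolding w_def f_def using nJ[OF J']
      by (subst quadrature_zonal_sums[OF x x]) (auto simp: G_def intro!: sum.cong)
    moreover have "kernel_form K (c J) (c J') = quadrature J' (\<lambda>s. w s * kernel_comb K (c J) s)"
      using analysis_node_coeffs[of J' w "kernel_comb K (c J)"]
      by (simp add: kernel_form_comb analysis_coeff_def c_def)
    ultimately have "kernel_form K (c J) (c J') - G = quadrature J' (\<lambda>s. w s * (kernel_comb K (c J) s - f s))"
      by (simp add: right_diff_distrib flip: quadrature_diff)
    also have "\<bar>\<dots>\<bar> \<le> 4 * pi * (B * (D * kernel_tail (2 ^ J)))"
      by (intro abs_quadrature_le) (auto simp: abs_mult intro!: mult_mono B approx J B0)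
    finally show ?thesis by (simp add: D_def mult.assoc)
  qed
  have tail: "(\<lambda>J. kernel_tail (2 ^ J)) \<longlonglongrightarrow> 0"
    by (rule filterlim_compose[OF kernel_tail_tendsto]) real_asymp
  have "rkhs_approx S2 K c f"
    unfolding rkhs_approx_def
  proof (intro conjI allI impI ballI)
    show fc: "c J \<in> fin_coeffs S2" for J unfolding c_def by (rule node_coeffs_fin)
    show "(\<lambda>J. kernel_comb K (c J) t) \<longlonglongrightarrow> f t" if t: "t \<in> S2" for t
    proof (rule LIM_zero_cancel, rule Lim_null_comparison)
      show "\<forall>\<^sub>F J in sequentially. norm (kernel_comb K (c J) t - f t) \<le> D * kernel_tail (2 ^ J)"
        unfolding eventually_sequentially using approx[OF _ t] by auto
      show "(\<lambda>J. D * kernel_tail (2 ^ J)) \<longlonglongrightarrow> 0" using tendsto_mult_left[OF tail, of D] by simp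
    qed
    fix e :: real assume e: "e > 0"
    have "(\<lambda>J. D * (D * kernel_tail (2 ^ J))) \<longlonglongrightarrow> 0"
      using tendsto_mult_left[OF tail, of "D * D"] by (simp add: mult.assoc)
    then have "\<forall>\<^sub>F J in sequentially. D * (D * kernel_tail (2 ^ J)) < e\<^sup>2 / 4"
      using e by (intro order_tendstoD(2)) auto
    then obtain J1 where J1: "\<And>J. J \<ge> J1 \<Longrightarrow> D * (D * kernel_tail (2 ^ J)) < e\<^sup>2 / 4"
      unfolding eventually_sequentially by blast
    have "sqrt (kernel_form K (\<lambda>s. c m s - c n s) (\<lambda>s. c m s - c n s)) < e"
      if m: "m \<ge> max J0 J1" and n: "n \<ge> max J0 J1" for m n
    proof -
      (* the squared distance is a signed sum of four inner products, each within e^2/4 of G,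
         in which the four copies of G cancel *)
      have bd: "G - e\<^sup>2 / 4 < kernel_form K (c i) (c i') \<and> kernel_form K (c i) (c i') < G + e\<^sup>2 / 4"
        if "i = m \<or> i = n" "i' = m \<or> i' = n" for i i'
      proof -
        have "J0 \<le> i" "J0 \<le> i'" "J1 \<le> i" using that m n by auto
        then show ?thesis using form[of i i'] J1[of i] unfolding abs_le_iff by linarith
      qed
      have "kernel_form K (\<lambda>s. c m s - c n s) (\<lambda>s. c m s - c n s)
        = kernel_form K (c m) (c m) - kernel_form K (c m) (c n) - kernel_form K (c n) (c m) + kernel_form K (c n) (c n)"
        by (simp add: kernel_form_diff(1)[OF fc fc fin_coeffs_diff[OF fc fc]] kernel_form_diff(2)[OF fc fc fc])
      also have "\<dots> < e\<^sup>2"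
        using bd[of m m] bd[of m n] bd[of n m] bd[of n n] by (simp only: simp_thms True_implies_equals) linarith
      finally have "sqrt (kernel_form K (\<lambda>s. c m s - c n s) (\<lambda>s. c m s - c n s)) < sqrt (e\<^sup>2)"
        by (rule real_sqrt_less_mono)
      then show ?thesis using e by simp
    qed
    then show "\<exists>n0. \<forall>m\<ge>n0. \<forall>n\<ge>n0. sqrt (kernel_form K (\<lambda>s. c m s - c n s) (\<lambda>s. c m s - c n s)) < e"
      by blast
  qed
  then show ?thesis unfolding rkhs_def f_def[abs_def] by blast
qed

lemma needlet_in_rkhs:
  assumes k: "k \<in> {1..N j}"
  shows "needlet j k \<in> rkhs S2 K"
proof -
  have "A l * (sqrt (wt j k) * level_coeff j l / sqrt (A l)) = sqrt (wt j k) * (level_coeff j l * sqrt (A l))" for l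
  proof -
    have "A l * (sqrt (wt j k) * level_coeff j l / sqrt (A l)) = (A l / sqrt (A l)) * (sqrt (wt j k) * level_coeff j l)"
      by simp
    also have "A l / sqrt (A l) = sqrt (A l)" by (rule real_div_sqrt[OF less_imp_le[OF A_pos]])
    finally show ?thesis by (simp only: mult_ac)
  qed
  then have eq: "needlet j k = (\<lambda>s. \<Sum>l<2 ^ j. A l * (sqrt (wt j k) * level_coeff j l / sqrt (A l)) * zonal_kernel l s (\<xi> j k))"
    by (intro ext) (simp add: needlet_eq sum_distrib_left mult.assoc)
  show ?thesis unfolding eq by (rule zonal_sum_in_rkhs[OF node[OF k]])
qed

theorem needlets_parseval_frame:
  "parseval_frame (rkhs S2 K) (rkhs_inner S2 K) (SIGMA j:UNIV. {1..N j}) (\<lambda>(j, k). needlet j k)"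
proof -
  interpret kernel_expansion S2 K "SIGMA j:UNIV. {1..N j}" "\<lambda>(j, k). needlet j k"
    by unfold_locales (use needlet_kernel_expansion in \<open>simp add: case_prod_unfold\<close>)
  show ?thesis
    by (rule parseval_frame_rkhs) (auto intro: needlet_in_rkhs)
qed

lemma polynomial_zonal_kernel: "real_polynomial_function (\<lambda>s. zonal_kernel l s t)"
  by (rule real_polynomial_function_poly_degree_le[OF poly_degree_le_zonal_kernel])

lemma L2_inner_needlet:
  assumes "real_polynomial_function p"
  shows "L2_inner (needlet j k) p
    = (\<Sum>l<2 ^ j. sqrt (wt j k) * level_coeff j l * sqrt (A l) * L2_inner (\<lambda>s. zonal_kernel l s (\<xi> j k)) p)"
proof -
  have "needlet j k = (\<lambda>s. \<Sum>l<2 ^ j. sqrt (wt j k) * level_coeff j l * sqrt (A l) * zonal_kernel l s (\<xi> j k))"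
    by (intro ext) (simp add: needlet_eq sum_distrib_left mult.assoc)
  then show ?thesis
    using L2_inner_sum_left[of "{..<2 ^ j}" "\<lambda>l s. zonal_kernel l s (\<xi> j k)" p] assms
    by (simp add: polynomial_zonal_kernel)
qed

lemma polynomial_needlet: "real_polynomial_function (needlet j k)"
proof -
  have "needlet j k = (\<lambda>s. sqrt (wt j k) * (\<Sum>l<2 ^ j. level_coeff j l * sqrt (A l) * zonal_kernel l s (\<xi> j k)))"
    by (intro ext) (rule needlet_eq)
  then show ?thesis
    by (simp add: real_polynomial_function_sum polynomial_zonal_kernel)
qed

text \<open>
  The supports of the two cutoffs share no degree, and different degrees are orthogonal.
\<close>

lemma needlets_orthogonal:
  assumes k: "k \<in> {1..N j}" "k' \<in> {1..N j'}" and jj: "j + 2 \<le> j' \<or> j' + 2 \<le> j"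
  shows "L2_inner (needlet j k) (needlet j' k') = 0"
  unfolding L2_inner_needlet[OF polynomial_needlet]
proof (intro sum.neutral ballI)
  fix l
  have "L2_inner (\<lambda>s. zonal_kernel l s (\<xi> j k)) (needlet j' k') = 0" if l: "level_coeff j l \<noteq> 0"
  proof -
    (* 2^j and 2^j' differ at least by the factor 4, while the degrees of one level spread by less *)
    have zero: "level_coeff j' l = 0"
    proof (rule ccontr)
      assume l': "level_coeff j' l \<noteq> 0"
      have "(4::real) * 2 ^ j \<le> 2 ^ j' \<or> (4::real) * 2 ^ j' \<le> 2 ^ j"
        using jj power_increasing[of "j + 2" j' "2::real"] power_increasing[of "j' + 2" j "2::real"]
        by (auto simp: power_add)
      moreover have False if "4 * a \<le> b" "b < 2 * x" "x < 2 * a" for a b x :: real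
        using that by linarith
      ultimately show False
        using level_coeff_support(1,2)[OF l] level_coeff_support(1,2)[OF l'] by blast
    qed
    have "L2_inner (needlet j' k') (\<lambda>s. zonal_kernel l s (\<xi> j k)) = 0"
      unfolding L2_inner_needlet[OF polynomial_zonal_kernel] using zero
      by (intro sum.neutral ballI) (simp add: L2_inner_zonal_kernels[OF node[OF k(2)] node[OF k(1)]])
    then show ?thesis by (simp add: L2_inner_commute)
  qed
  then show "sqrt (wt j k) * level_coeff j l * sqrt (A l) * L2_inner (\<lambda>s. zonal_kernel l s (\<xi> j k)) (needlet j' k') = 0"
    by auto
qed

lemma needlet_orthogonal_low_degree:
  assumes j: "j > 1" and k: "k \<in> {1..N j}" and p: "poly_degree_le n p" and n: "real n < (2 ^ (j - 1) - 1) / 2"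
  shows "L2_inner (needlet j k) p = 0"
  unfolding L2_inner_needlet[OF real_polynomial_function_poly_degree_le[OF p]]
proof (intro sum.neutral ballI)
  fix l
  have "n < l" if "level_coeff j l \<noteq> 0"
  proof -
    have "(2::real) ^ j = 2 * 2 ^ (j - 1)" using j by (cases j) auto
    then have "real n < real l" using level_coeff_support(1)[OF that] n by (simp add: field_simps)
    then show ?thesis by simp
  qed
  then show "sqrt (wt j k) * level_coeff j l * sqrt (A l) * L2_inner (\<lambda>s. zonal_kernel l s (\<xi> j k)) p = 0"
    using L2_inner_zonal_poly[OF node[OF k] p, of l] by auto
qed

end

theorem theorem11:
  fixes N :: "nat \<Rightarrow> nat"
    and wt :: "nat \<Rightarrow> nat \<Rightarrow> real"
    and \<xi> :: "nat \<Rightarrow> nat \<Rightarrow> real^3"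
    and r :: nat
    and \<kappa> :: "real \<Rightarrow> real"
    and A :: "nat \<Rightarrow> real"
    and M :: "'w measure"
    and Y :: "nat \<Rightarrow> int \<Rightarrow> real^3 \<Rightarrow> real"
    and y :: "nat \<Rightarrow> int \<Rightarrow> 'w \<Rightarrow> real"
    and u :: "real^3 \<Rightarrow> 'w \<Rightarrow> real"
  assumes "quadrature_assumption N wt \<xi>"
    and "cutoff_assumption r \<kappa>"
    and "\<And>l. A l > 0"
    and "summable (\<lambda>l. (2 * real l + 1) * A l)"
    and "real_spherical_harmonics Y"
    and "isotropic_gaussian_field M A Y y u"
  shows "parseval_frame
           (rkhs S2 (covariance_kernel M u)) (rkhs_inner S2 (covariance_kernel M u))
           (SIGMA j:UNIV. {1..N j}) (\<lambda>(j, k). modified_needlet \<kappa> A wt \<xi> j k) \<and>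
         (\<forall>j j'. \<forall>k\<in>{1..N j}. \<forall>k'\<in>{1..N j'}. \<bar>int j - int j'\<bar> \<ge> 2 \<longrightarrow>
           L2_inner (modified_needlet \<kappa> A wt \<xi> j k) (modified_needlet \<kappa> A wt \<xi> j' k') = 0) \<and>
         (\<forall>j>1. \<forall>k\<in>{1..N j}. \<forall>n p. poly_degree_le n p \<and> real n < (2 ^ (j - 1) - 1) / 2 \<longrightarrow>
           L2_inner (modified_needlet \<kappa> A wt \<xi> j k) p = 0)"
proof -
  interpret needlet_system N wt \<xi> r \<kappa> A "covariance_kernel M u"
  proof unfold_locales
    fix l and s t :: "real^3" assume s: "s \<in> S2" and t: "t \<in> S2"
    show "\<bar>zonal_kernel l s t\<bar> \<le> (2 * real l + 1) / (4 * pi)"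
      using mult_left_mono[OF abs_legendre_le_1[OF assms(5) s t, of l], of "(2 * real l + 1) / (4 * pi)"]
      by (simp add: zonal_kernel_def abs_mult)
    show "(\<lambda>l. A l * zonal_kernel l s t) sums covariance_kernel M u s t"
      using covariance_kernel_sums[OF assms(6,5) less_imp_le[OF assms(3)] s t]
      by (simp add: zonal_kernel_def mult.assoc)
  qed (fact assms)+
  show ?thesis
  proof (intro conjI allI ballI impI)
    show "L2_inner (needlet j k) (needlet j' k') = 0"
      if "k \<in> {1..N j}" "k' \<in> {1..N j'}" "\<bar>int j - int j'\<bar> \<ge> 2" for j j' k k'
      using that(3) by (intro needlets_orthogonal that) linarith
    show "L2_inner (needlet j k) p = 0"
      if "j > 1" "k \<in> {1..N j}" "poly_degree_le n p \<and> real n < (2 ^ (j - 1) - 1) / 2" for j k n p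
      using that by (intro needlet_orthogonal_low_degree) blast+
  qed (rule needlets_parseval_frame)
qed

end
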